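(* Let $n\ge2$. The quotient monoid $\mathrm{End}(X_n^{\mathbb Z},\sigma_n)/\langle\sigma_n\rangle$ is isomorphic to the monoid $\widetilde{\mathcal L}_n$, via $T\mapsto$ the class of $(T,\alpha)$ for any annotation $\alpha$ of $T\in\widetilde{\mathcal L}_n$. The action of the monoid $\mathcal M_n$ on prime cyclic words yields a monomorphism (injective monoid homomorphism) $\Pi:\mathcal M_n\to\mathrm{Tr}(\mathsf W_n)$, $T\mapsto(T)\Pi$, into the monoid of all transformations of the set $\mathsf W_n$ of all finite prime cyclic words on an alphabet of size $n$. The restriction of $\Pi$ to the monoid $\widetilde{\mathcal L}_n$ is (under the isomorphism $\widetilde{\mathcal L}_n\to\mathrm{End}(X_n^{\mathbb Z},\sigma_n)/\langle\sigma_n\rangle$ sending $T$ to the class of $(T,\alpha)$ for any annotation $\alpha$ of $T$) the periodic orbit representation of $\mathrm{End}(X_n^{\mathbb Z},\sigma_n)/\langle\sigma_n\rangle$.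
   Context: Functions are written on the right of arguments and composed left to right. **Transducers.** $X_n=\{0,\dots,n-1\}$; $X_n^*$ is the set of finite words ($\varepsilon$ the empty word), $X_n^+=X_n^*\setminus\{\varepsilon\}$, $X_n^{\mathbb N}$ the set of right-infinite words, $|w|$ the length of $w$. A transducer is $T=(X_n,Q_T,\pi_T,\lambda_T)$ with $Q_T$ a finite nonempty set of states, $\pi_T:X_n\times Q_T\to Q_T$, $\lambda_T:X_n\times Q_T\to X_n^*$, extended to words by $\pi_T(\varepsilon,q)=q$, $\lambda_T(\varepsilon,q)=\varepsilon$, $\pi_T(wx,q)=\pi_T(x,\pi_T(w,q))$, $\lambda_T(wx,q)=\lambda_T(w,q)\lambda_T(x,\pi_T(w,q))$, and $\lambda_T$ extended to infinite words. Always assumed: if $w\in X_n^+$ and $\pi_T(w,q)=q$ then $\lambda_T(w,q)\ne\varepsilon$. Each state $q$ induces a continuous map $h_q:X_n^{\mathbb N}\to X_n^{\mathbb N}$, $w\mapsto\lambda_T(w,q)$. States $p,q$ (possibly of different transducers) are $\omega$-equivalent if $h_p=h_q$; $T$ is weakly minimal if distinct states are never $\omega$-equivalent. $\Lambda(w,q)$ is the greatest common prefix of $\{\lambda_T(wx,q):x\in X_n^{\mathbb N}\}$; $|\Lambda(\varepsilon,q)|\in\mathbb N\cup\{\infty\}$ is the extent of incomplete response of $q$, and $q$ is a state of incomplete response if $\Lambda(\varepsilon,q)\neq\varepsilon$. $T$ is strongly synchronizing if for some $k\ge 0$ (a synchronizing level), for each $w\in X_n^k$ the state $\pi_T(w,q)$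 is independent of $q$ (the state forced by $w$). The states forced by words of length $k$ form a subtransducer $\mathrm{core}(T)$; $T$ is core if $T=\mathrm{core}(T)$. For $x\in X_n^+$, $Z_x$ is the one-state transducer with output $x$ on every letter. A word is prime if it is nonempty and not a proper power of a shorter word. A transducer is called minimal if either it is weakly minimal, strongly connected and has no states of incomplete response, or it is $Z_x$ with $x$ prime and lexicographically least among its rotations. Transducers are considered equal if there is a bijection of state sets matching $\omega$-equivalent states. **Reduction.** For a strongly synchronizing core transducer $C$ define a minimal transducer $[C]$: if some (equivalently every) state has infinite extent of incomplete response, each state of $C$ is $\omega$-equivalent to the state of some $Z_x$ with $x$ prime (unique up to rotation) and $[C]:=Z_{\bar x}$ with $\bar x$ the lexicographically least rotation of $x$; otherwise keep states and transitions, replace the output $\lambda_C(x,q)$ ($x\in X_n$) by the word obtained by deleting the prefix $\Lambda(\varepsilon,q)$ from $\Lambda(x,q)$, and then identify $\omega$-equivalent states. **Monoids.** $T*U$ has states $Q_T\times Q_U$, $\pi_{T*U}(x,(p,q))=(\pi_T(x,p),\pi_U(\lambda_T(x,p),q))$, $\lambda_{T*U}(x,(p,q))=\lambda_U(\lambda_T(x,p),q)$. $\mathcal M_n$ is the monoid of minimal, strongly synchronizing, core transducers over $X_n$ with product $TU:=[\mathrm{core}(T*U)]$; its identity is the one-state identity transducer. $\widetilde{\mathcal L}_n\subseteq\mathcal M_n$ is the submonoid of those $T$ with $|\lambda_T(a,q)|=|a|$ whenever $a\in X_n^*$, $q\in Q_T$, $\pi_T(a,q)=q$. **Action on prime cyclic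 words.** $\mathsf W_n$ is the set of rotation classes $[\gamma]$ of prime words $\gamma$ over $X_n$. For $T\in\mathcal M_n$ and $\gamma$ prime there is a unique state $q_\gamma$ with $\pi_T(\gamma,q_\gamma)=q_\gamma$; write $\lambda_T(\gamma,q_\gamma)=\delta^s$ with $\delta$ prime, $s\ge1$, and put $([\gamma])(T)\Pi:=[\delta]$. **Shift and annotations.** $X_n^{\mathbb Z}$ has the product topology; $(x)\sigma_n=y$ with $y_i=x_{i-1}$. $\mathrm{End}(X_n^{\mathbb Z},\sigma_n)$ is the monoid of continuous maps $X_n^{\mathbb Z}\to X_n^{\mathbb Z}$ commuting with $\sigma_n$; $\langle\sigma_n\rangle$ also denotes the congruence relating $\varphi,\psi$ when $\varphi=\sigma_n^i\psi$ for some $i\in\mathbb Z$. An annotation of $T\in\widetilde{\mathcal L}_n$ is a map $\alpha:Q_T\to\mathbb Z$ with $(\pi_T(w,q))\alpha=(q)\alpha+|\lambda_T(w,q)|-|w|$ for all $q\in Q_T$, $w\in X_n^*$ (these exist and are unique up to an additive constant). The map $(T,\alpha):X_n^{\mathbb Z}\to X_n^{\mathbb Z}$ sends $x$ to the $y$ such that for each $i\in\mathbb Z$, if $q$ is the state forced by $x_{i-k}\cdots x_{i-1}$ ($k$ a synchronizing level), $\rho=(q)\alpha$ and $w=\lambda_T(x_i,q)$, then $y_{i+\rho}y_{i+\rho+1}\cdots y_{i+\rho+|w|-1}=w$. **Periodic orbit representation.** The $\sigma_n$-orbits of $\sigma_n$-periodic points are in bijection with $\mathsf W_n$: the orbit of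 a point $x$ of least period $k$ corresponds to $[x_0x_1\cdots x_{k-1}]$. Each $\varphi\in\mathrm{End}(X_n^{\mathbb Z},\sigma_n)$ maps periodic orbits to periodic orbits, and the induced transformation of $\mathsf W_n$ depends only on the class of $\varphi$ mod $\langle\sigma_n\rangle$; this gives the periodic orbit representation $\mathrm{End}(X_n^{\mathbb Z},\sigma_n)/\langle\sigma_n\rangle\to\mathrm{Tr}(\mathsf W_n)$. *)

theory Defs
  imports
    "HOL-Analysis.Function_Topology"
    "HOL-Algebra.Group"
    "HOL-Library.Omega_Words_Fun"
    "HOL-Library.Extended_Nat"
begin

section \<open>Words\<close>

text \<open>The alphabet is \<open>{..<n}\<close>; finite words are elements of \<open>lists {..<n}\<close>.\<close>

definition words_of_length :: "nat \<Rightarrow> nat \<Rightarrow> nat list set" where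
  "words_of_length n k = {w \<in> lists {..<n}. length w = k}"

definition inf_words :: "nat \<Rightarrow> nat word set" where
  "inf_words n = {x. range x \<subseteq> {..<n}}"

definition wpow :: "'a list \<Rightarrow> nat \<Rightarrow> 'a list" where
  "wpow u k = concat (replicate k u)"

definition prime_word :: "'a list \<Rightarrow> bool" where
  "prime_word w \<longleftrightarrow> w \<noteq> [] \<and> \<not> (\<exists>u k. length u < length w \<and> w = wpow u k)"

definition rotations :: "'a list \<Rightarrow> 'a list set" where
  "rotations w = range (\<lambda>k. rotate k w)"

definition least_prime_word :: "nat \<Rightarrow> nat list \<Rightarrow> bool" where
  "least_prime_word n x \<longleftrightarrow> x \<in> lists {..<n} \<and> prime_word x \<and>
     (\<forall>y \<in> rotations x. x = y \<or> (x, y) \<in> lexord less_than)"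

definition prime_cyclic_words :: "nat \<Rightarrow> nat list set set" where
  "prime_cyclic_words n = rotations ` {w \<in> lists {..<n}. prime_word w}"

definition transformation_monoid :: "'a set \<Rightarrow> ('a \<Rightarrow> 'a) monoid" where
  "transformation_monoid W =
     \<lparr>carrier = W \<rightarrow>\<^sub>E W, monoid.mult = (\<lambda>f g. compose W g f), one = (\<lambda>x\<in>W. x)\<rparr>"


section \<open>Transducers\<close>

text \<open>Only the restrictions of \<open>step\<close> and \<open>out\<close> to letters below \<open>n\<close> and states in \<open>St\<close> are
  meaningful.\<close>

record 'q transducer =
  St :: "'q set"
  step :: "nat \<Rightarrow> 'q \<Rightarrow> 'q"
  out :: "nat \<Rightarrow> 'q \<Rightarrow> nat list"

primrec steps :: "'q transducer \<Rightarrow> nat list \<Rightarrow> 'q \<Rightarrow> 'q" where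
  "steps T [] q = q"
| "steps T (a # w) q = steps T w (step T a q)"

primrec outs :: "'q transducer \<Rightarrow> nat list \<Rightarrow> 'q \<Rightarrow> nat list" where
  "outs T [] q = []"
| "outs T (a # w) q = out T a q @ outs T w (step T a q)"

definition is_transducer :: "nat \<Rightarrow> 'q transducer \<Rightarrow> bool" where
  "is_transducer n T \<longleftrightarrow> finite (St T) \<and> St T \<noteq> {} \<and>
     (\<forall>a<n. \<forall>q\<in>St T. step T a q \<in> St T \<and> out T a q \<in> lists {..<n}) \<and>
     (\<forall>w\<in>lists {..<n}. \<forall>q\<in>St T. w \<noteq> [] \<longrightarrow> steps T w q = q \<longrightarrow> outs T w q \<noteq> [])"

text \<open>The map induced by the state \<open>q\<close> on infinite words: the outputs on the finite prefixes of \<open>x\<close>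
  extend each other and their lengths are unbounded, so letter \<open>i\<close> of the output can be read off
  from any sufficiently long prefix.\<close>

definition state_map :: "'q transducer \<Rightarrow> 'q \<Rightarrow> nat word \<Rightarrow> nat word" where
  "state_map T q x = (\<lambda>i.
     outs T (x [0 \<rightarrow> (LEAST m. i < length (outs T (x [0 \<rightarrow> m]) q))]) q ! i)"

definition omega_equiv :: "nat \<Rightarrow> 'p transducer \<Rightarrow> 'p \<Rightarrow> 'q transducer \<Rightarrow> 'q \<Rightarrow> bool" where
  "omega_equiv n T p U q \<longleftrightarrow> (\<forall>x\<in>inf_words n. state_map T p x = state_map U q x)"

definition weakly_minimal :: "nat \<Rightarrow> 'q transducer \<Rightarrow> bool" where
  "weakly_minimal n T \<longleftrightarrow> (\<forall>p\<in>St T. \<forall>q\<in>St T. p \<noteq> q \<longrightarrow> \<not> omega_equiv n T p T q)"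

definition transducer_eq :: "nat \<Rightarrow> 'p transducer \<Rightarrow> 'q transducer \<Rightarrow> bool" where
  "transducer_eq n T U \<longleftrightarrow>
     (\<exists>f. bij_betw f (St T) (St U) \<and> (\<forall>q\<in>St T. omega_equiv n T q U (f q)))"

text \<open>The greatest common prefix \<open>\<Lambda>(w,q)\<close> may be an infinite word. It is represented by the set of
  its finite prefixes; \<open>Lam\<close> is the greatest common prefix as a finite word, and is
  meaningful only when \<open>\<Lambda>(w,q)\<close> is finite.\<close>

definition common_prefixes :: "nat \<Rightarrow> 'q transducer \<Rightarrow> nat list \<Rightarrow> 'q \<Rightarrow> nat list set" where
  "common_prefixes n T w q =
     {u. \<forall>x\<in>inf_words n. (state_map T q (w \<frown> x)) [0 \<rightarrow> length u] = u}"

definition Lam :: "nat \<Rightarrow> 'q transducer \<Rightarrow> nat list \<Rightarrow> 'q \<Rightarrow> nat list" where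
  "Lam n T w q = (THE u. u \<in> common_prefixes n T w q \<and>
     (\<forall>v\<in>common_prefixes n T w q. length v \<le> length u))"

definition extent :: "nat \<Rightarrow> 'q transducer \<Rightarrow> 'q \<Rightarrow> enat" where
  "extent n T q = (SUP u\<in>common_prefixes n T [] q. enat (length u))"

definition incomplete_response :: "nat \<Rightarrow> 'q transducer \<Rightarrow> 'q \<Rightarrow> bool" where
  "incomplete_response n T q \<longleftrightarrow> extent n T q \<noteq> 0"

definition strongly_connected :: "nat \<Rightarrow> 'q transducer \<Rightarrow> bool" where
  "strongly_connected n T \<longleftrightarrow>
     (\<forall>p\<in>St T. \<forall>q\<in>St T. \<exists>w\<in>lists {..<n}. steps T w p = q)"

definition sync_level :: "nat \<Rightarrow> 'q transducer \<Rightarrow> nat \<Rightarrow> bool" where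
  "sync_level n T k \<longleftrightarrow>
     (\<forall>w\<in>words_of_length n k. \<forall>p\<in>St T. \<forall>q\<in>St T. steps T w p = steps T w q)"

definition strongly_synchronizing :: "nat \<Rightarrow> 'q transducer \<Rightarrow> bool" where
  "strongly_synchronizing n T \<longleftrightarrow> (\<exists>k. sync_level n T k)"

text \<open>The set of states forced by words of length \<open>k\<close> does not depend on the synchronizing level
  \<open>k\<close>.\<close>

definition core :: "nat \<Rightarrow> 'q transducer \<Rightarrow> 'q transducer" where
  "core n T = T\<lparr>St := {steps T w q | k w q.
     sync_level n T k \<and> w \<in> words_of_length n k \<and> q \<in> St T}\<rparr>"

definition is_core :: "nat \<Rightarrow> 'q transducer \<Rightarrow> bool" where
  "is_core n T \<longleftrightarrow> core n T = T"

definition Z_transducer :: "'q \<Rightarrow> nat list \<Rightarrow> 'q transducer" where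
  "Z_transducer s x = \<lparr>St = {s}, step = (\<lambda>a q. s), out = (\<lambda>a q. x)\<rparr>"

definition is_Z_transducer :: "nat \<Rightarrow> nat list \<Rightarrow> 'q transducer \<Rightarrow> bool" where
  "is_Z_transducer n x T \<longleftrightarrow>
     (\<exists>s. St T = {s} \<and> (\<forall>a<n. step T a s = s \<and> out T a s = x))"

definition minimal_transducer :: "nat \<Rightarrow> 'q transducer \<Rightarrow> bool" where
  "minimal_transducer n T \<longleftrightarrow> is_transducer n T \<and>
     ((weakly_minimal n T \<and> strongly_connected n T \<and> (\<forall>q\<in>St T. \<not> incomplete_response n T q)) \<or>
      (\<exists>x. least_prime_word n x \<and> is_Z_transducer n x T))"


section \<open>Reduction and product\<close>

definition remove_incomplete_response :: "nat \<Rightarrow> 'q transducer \<Rightarrow> 'q transducer" where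
  "remove_incomplete_response n C =
     C\<lparr>out := (\<lambda>a q. drop (length (Lam n C [] q)) (Lam n C [a] q))\<rparr>"

definition omega_class :: "nat \<Rightarrow> 'q transducer \<Rightarrow> 'q \<Rightarrow> 'q set" where
  "omega_class n C q = {p \<in> St C. omega_equiv n C p C q}"

definition identify_equiv_states :: "nat \<Rightarrow> 'q transducer \<Rightarrow> 'q set transducer" where
  "identify_equiv_states n C =
     \<lparr>St = omega_class n C ` St C,
      step = (\<lambda>a A. omega_class n C (step C a (SOME q. q \<in> A))),
      out = (\<lambda>a A. out C a (SOME q. q \<in> A))\<rparr>"

text \<open>When the extents are infinite, all states are collapsed to the single state \<open>St C\<close>.\<close>

definition reduction :: "nat \<Rightarrow> 'q transducer \<Rightarrow> 'q set transducer" where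
  "reduction n C =
     (if \<exists>q\<in>St C. extent n C q = \<infinity>
      then Z_transducer (St C) (THE x. least_prime_word n x \<and>
             (\<exists>q\<in>St C. \<exists>y\<in>rotations x. omega_equiv n C q (Z_transducer () y) ()))
      else identify_equiv_states n (remove_incomplete_response n C))"

definition transducer_prod :: "'p transducer \<Rightarrow> 'q transducer \<Rightarrow> ('p \<times> 'q) transducer" where
  "transducer_prod T U =
     \<lparr>St = St T \<times> St U,
      step = (\<lambda>a (p, q). (step T a p, steps U (out T a p) q)),
      out = (\<lambda>a (p, q). outs U (out T a p) q)\<rparr>"


section \<open>The monoids of transducers\<close>

text \<open>Transducers are considered up to \<open>transducer_eq\<close>. As state sets are finite, natural
  numbers suffice as states of representatives; \<open>transducer_class n T\<close> is the class of \<open>T\<close>, where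
  \<open>T\<close> itself may have states of any type.\<close>

definition M_transducer :: "nat \<Rightarrow> 'q transducer \<Rightarrow> bool" where
  "M_transducer n T \<longleftrightarrow> minimal_transducer n T \<and> strongly_synchronizing n T \<and> is_core n T"

definition transducer_class :: "nat \<Rightarrow> 'q transducer \<Rightarrow> nat transducer set" where
  "transducer_class n T = {V. M_transducer n V \<and> transducer_eq n T V}"

definition identity_transducer :: "unit transducer" where
  "identity_transducer = \<lparr>St = {()}, step = (\<lambda>a q. ()), out = (\<lambda>a q. [a])\<rparr>"

definition M_monoid :: "nat \<Rightarrow> nat transducer set monoid" where
  "M_monoid n =
     \<lparr>carrier = transducer_class n ` {T :: nat transducer. M_transducer n T},
      monoid.mult = (\<lambda>A B. \<Union>T\<in>A. \<Union>U\<in>B.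
        transducer_class n (reduction n (core n (transducer_prod T U)))),
      one = transducer_class n identity_transducer\<rparr>"

definition L_transducer :: "nat \<Rightarrow> 'q transducer \<Rightarrow> bool" where
  "L_transducer n T \<longleftrightarrow> M_transducer n T \<and>
     (\<forall>a\<in>lists {..<n}. \<forall>q\<in>St T. steps T a q = q \<longrightarrow> length (outs T a q) = length a)"

definition L_set :: "nat \<Rightarrow> nat transducer set set" where
  "L_set n = transducer_class n ` {T :: nat transducer. L_transducer n T}"

definition L_monoid :: "nat \<Rightarrow> nat transducer set monoid" where
  "L_monoid n = (M_monoid n)\<lparr>carrier := L_set n\<rparr>"


section \<open>The action on prime cyclic words\<close>

definition prime_root :: "'a list \<Rightarrow> 'a list" where
  "prime_root w = (THE d. prime_word d \<and> (\<exists>s\<ge>1. w = wpow d s))"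

definition loop_state :: "'q transducer \<Rightarrow> nat list \<Rightarrow> 'q" where
  "loop_state T g = (THE q. q \<in> St T \<and> steps T g q = q)"

definition cyclic_image :: "'q transducer \<Rightarrow> nat list \<Rightarrow> nat list set" where
  "cyclic_image T g = rotations (prime_root (outs T g (loop_state T g)))"

definition cyclic_action ::
  "nat \<Rightarrow> nat transducer set \<Rightarrow> nat list set \<Rightarrow> nat list set" where
  "cyclic_action n A = (\<lambda>c\<in>prime_cyclic_words n. THE d. \<exists>T\<in>A. \<exists>g\<in>c. d = cyclic_image T g)"


section \<open>Endomorphisms of the full shift\<close>

definition full_shift :: "nat \<Rightarrow> (int \<Rightarrow> nat) topology" where
  "full_shift n = product_topology (\<lambda>_. discrete_topology {..<n}) UNIV"

abbreviation Xz :: "nat \<Rightarrow> (int \<Rightarrow> nat) set" where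
  "Xz n \<equiv> topspace (full_shift n)"

text \<open>The \<open>k\<close>-th power of the shift \<open>shift_power n 1\<close>, in closed form so that \<open>k\<close> may be negative.\<close>

definition shift_power :: "nat \<Rightarrow> int \<Rightarrow> (int \<Rightarrow> nat) \<Rightarrow> (int \<Rightarrow> nat)" where
  "shift_power n k = (\<lambda>x\<in>Xz n. \<lambda>i. x (i - k))"

text \<open>Maps on \<open>Xz n\<close> are represented by functions that are \<open>undefined\<close> outside \<open>Xz n\<close>.\<close>

definition shift_End :: "nat \<Rightarrow> ((int \<Rightarrow> nat) \<Rightarrow> (int \<Rightarrow> nat)) set" where
  "shift_End n = {\<phi> \<in> extensional (Xz n). continuous_map (full_shift n) (full_shift n) \<phi> \<and>
     (\<forall>x\<in>Xz n. \<phi> (shift_power n 1 x) = shift_power n 1 (\<phi> x))}"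

text \<open>Maps act on the right, so \<open>\<phi>\<psi>\<close> is \<open>compose (Xz n) \<psi> \<phi>\<close>.\<close>

definition shift_congruence ::
  "nat \<Rightarrow> (((int \<Rightarrow> nat) \<Rightarrow> (int \<Rightarrow> nat)) \<times> ((int \<Rightarrow> nat) \<Rightarrow> (int \<Rightarrow> nat))) set" where
  "shift_congruence n = {(\<phi>, \<psi>). \<phi> \<in> shift_End n \<and> \<psi> \<in> shift_End n \<and>
     (\<exists>i. \<phi> = compose (Xz n) \<psi> (shift_power n i))}"

abbreviation shift_class ::
  "nat \<Rightarrow> ((int \<Rightarrow> nat) \<Rightarrow> (int \<Rightarrow> nat)) \<Rightarrow> ((int \<Rightarrow> nat) \<Rightarrow> (int \<Rightarrow> nat)) set" where
  "shift_class n \<phi> \<equiv> shift_congruence n `` {\<phi>}"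

definition End_quotient :: "nat \<Rightarrow> ((int \<Rightarrow> nat) \<Rightarrow> (int \<Rightarrow> nat)) set monoid" where
  "End_quotient n =
     \<lparr>carrier = shift_End n // shift_congruence n,
      monoid.mult = (\<lambda>A B. \<Union>\<phi>\<in>A. \<Union>\<psi>\<in>B. shift_class n (compose (Xz n) \<psi> \<phi>)),
      one = shift_class n (\<lambda>x\<in>Xz n. x)\<rparr>"


section \<open>Annotations\<close>

definition annotation :: "nat \<Rightarrow> 'q transducer \<Rightarrow> ('q \<Rightarrow> int) \<Rightarrow> bool" where
  "annotation n T \<alpha> \<longleftrightarrow> (\<forall>q\<in>St T. \<forall>w\<in>lists {..<n}.
     \<alpha> (steps T w q) = \<alpha> q + int (length (outs T w q)) - int (length w))"

definition annotated_map ::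
  "nat \<Rightarrow> 'q transducer \<Rightarrow> ('q \<Rightarrow> int) \<Rightarrow> (int \<Rightarrow> nat) \<Rightarrow> (int \<Rightarrow> nat)" where
  "annotated_map n T \<alpha> = (\<lambda>x\<in>Xz n. THE y. y \<in> Xz n \<and>
     (\<forall>i k p q. sync_level n T k \<and> p \<in> St T \<and> q = steps T (map x [i - int k..i - 1]) p \<longrightarrow>
        (\<forall>j < length (out T (x i) q). y (i + \<alpha> q + int j) = out T (x i) q ! j)))"

text \<open>The map sending the class of \<open>T\<close> to the class of \<open>(T,\<alpha>)\<close>. The union over all representatives
  and all annotations is a single congruence class precisely when annotations exist and the choices
  do not matter.\<close>

definition L_to_End :: "nat \<Rightarrow> nat transducer set \<Rightarrow> ((int \<Rightarrow> nat) \<Rightarrow> (int \<Rightarrow> nat)) set" where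
  "L_to_End n A = (\<Union>T\<in>A. \<Union>\<alpha>\<in>{\<alpha>. annotation n T \<alpha>}. shift_class n (annotated_map n T \<alpha>))"


section \<open>The periodic orbit representation\<close>

definition periodic_point :: "nat \<Rightarrow> (int \<Rightarrow> nat) \<Rightarrow> bool" where
  "periodic_point n x \<longleftrightarrow> x \<in> Xz n \<and> (\<exists>k::nat. 0 < k \<and> shift_power n (int k) x = x)"

definition least_period :: "nat \<Rightarrow> (int \<Rightarrow> nat) \<Rightarrow> nat" where
  "least_period n x = (LEAST k. 0 < k \<and> shift_power n (int k) x = x)"

text \<open>The prime cyclic word corresponding to the orbit of the periodic point \<open>x\<close>.\<close>

definition orbit_word :: "nat \<Rightarrow> (int \<Rightarrow> nat) \<Rightarrow> nat list set" where
  "orbit_word n x = rotations (map x [0..int (least_period n x) - 1])"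

definition periodic_orbit_rep ::
  "nat \<Rightarrow> ((int \<Rightarrow> nat) \<Rightarrow> (int \<Rightarrow> nat)) set \<Rightarrow> nat list set \<Rightarrow> nat list set" where
  "periodic_orbit_rep n A = (\<lambda>c\<in>prime_cyclic_words n.
     THE d. \<exists>\<phi>\<in>A. \<exists>x. periodic_point n x \<and> orbit_word n x = c \<and> d = orbit_word n (\<phi> x))"

end

theory Submission
  imports Defs
begin

text \<open>
  Everything rests on the injectivity of \<open>\<Pi>\<close>. Let \<open>T\<close> and \<open>U\<close> have the same action, and let \<open>p\<close> and
  \<open>q\<close> be the states of \<open>T\<close> and \<open>U\<close> forced by a common word. On the words that are loops at both \<open>p\<close>
  and \<open>q\<close>, the outputs define homomorphisms \<open>f\<close> and \<open>g\<close> to the free monoid such that \<open>f w\<close> and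
  \<open>g w\<close> always have conjugate prime roots. If \<open>f u\<close> and \<open>f v\<close> do not commute, then \<open>f u\<^sup>a f v\<close> is
  prime for all large \<open>a\<close>; comparing lengths shows that \<open>f w\<close> and \<open>g w\<close> are conjugate for every
  loop \<open>w\<close>. Long powers of a loop with prime output then align the two outputs, and the alignment
  turns out to be the same for all \<open>w\<close>. Hence the maps induced by \<open>p\<close> and \<open>q\<close> agree up to a fixed
  finite prefix, and they agree exactly when there is no incomplete response. If all the words \<open>f w\<close>
  commute, then \<open>T\<close> is some \<open>Z\<^sub>x\<close>.

  Since the product and the reduction are compatible with the action on prime cyclic words,
  injectivity yields that the product is well defined on classes, associative and unital. An
  endomorphism of the shift is a sliding block code; its transducer, reduced, represents the
  endomorphism up to a power of the shift. As an annotated transducer acts on periodic orbits through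
  \<open>\<Pi>\<close>, injectivity of \<open>\<Pi>\<close> also shows that the correspondence with endomorphisms is an injective
  homomorphism.
\<close>

section \<open>Combinatorics on words\<close>

text \<open>The obstacle is that the action records only prime roots: an output
  \<open>wpow d s\<close> is seen as \<open>d\<close>, so lengths of outputs cannot be compared loop
  by loop. Primality forces the exponent 1, and two consecutive large exponents a then give the
  lengths of f u and f v separately. The alignment found for one loop is not rigid either, since the
  power of the prime word x in it may vary from loop to loop. It becomes rigid by placing two loops
  w and w' in one loop w z z w', where z has output x and the output of w does not commute with x:
  any other shift would make a word built from that output a power of x. Loops are enough because
  one word forces both states at once, so every finite word is a prefix of a joint loop. Cyclic
  images do not mention the state set. Comparing transducers through them absorbs the change of
  state types under products and reductions, the choice of representatives with natural numbers as
  states, and the choices made in the reduction.\<close>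

lemma wpow_0 [simp]: "wpow u 0 = []"
  by (simp add: wpow_def)

lemma wpow_Suc [simp]: "wpow u (Suc k) = u @ wpow u k"
  by (simp add: wpow_def)

lemma wpow_add: "wpow u (i + j) = wpow u i @ wpow u j"
  by (simp add: wpow_def replicate_add)

lemma wpow_1: "wpow u 1 = u"
  by simp

lemma wpow_Suc_right: "wpow u (Suc k) = wpow u k @ u"
  using wpow_add[of u k 1] by simp

lemma length_wpow [simp]: "length (wpow u k) = k * length u"
  by (induction k) auto

lemma wpow_mult: "wpow (wpow u i) j = wpow u (i * j)"
  by (induction j) (auto simp: wpow_add)

lemma wpow_Nil [simp]: "wpow [] k = []"
  by (induction k) auto

lemma wpow_eq_Nil_iff: "wpow u k = [] \<longleftrightarrow> u = [] \<or> k = 0"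
  by (cases k) (auto)

lemma wpow_in_lists: "u \<in> lists A \<Longrightarrow> wpow u k \<in> lists A"
  by (induction k) auto

lemma wpow_commute: "wpow u i @ wpow u j = wpow u j @ wpow u i"
  by (metis add.commute wpow_add)

lemma commute_wpow:
  assumes "u @ v = v @ u"
  shows "u @ wpow v k = wpow v k @ u"
proof (induction k)
  case (Suc k)
  have "u @ wpow v (Suc k) = v @ u @ wpow v k"
    using assms by (metis append.assoc wpow_Suc)
  then show ?case
    using Suc by simp
qed simp

lemma append_prefix_unique:
  assumes "u @ r = v @ s" "length u \<le> length v"
  shows "\<exists>t. v = u @ t \<and> r = t @ s"
  using assms by (auto simp: append_eq_append_conv2)

text \<open>A power of \<open>w\<close> at least as long as \<open>u @ v\<close> commutes with both
  products, so each of them is its prefix of that length.\<close>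

lemma commute_trans:
  assumes "w \<noteq> []" "u @ w = w @ u" "v @ w = w @ v"
  shows "u @ v = v @ u"
proof -
  define Z where "Z = wpow w (length u + length v)"
  have len: "length Z \<ge> length u + length v"
    using assms(1) by (cases w) (auto simp: Z_def)
  have uZ: "u @ Z = Z @ u" and vZ: "v @ Z = Z @ v"
    unfolding Z_def using assms commute_wpow by blast+
  have "u @ v @ Z = Z @ u @ v" "v @ u @ Z = Z @ v @ u"
    using uZ vZ by (metis append.assoc)+
  then have "(u @ v) @ Z = Z @ (u @ v)" "(v @ u) @ Z = Z @ (v @ u)" by auto
  then have "take (length u + length v) Z = u @ v" "take (length u + length v) Z = v @ u"
    using len by (metis add.commute append_eq_append_conv_if length_append)+
  then show ?thesis by simp
qed

section \<open>Prime words and prime roots\<close>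

lemma prime_word_not_Nil [simp]: "prime_word d \<Longrightarrow> d \<noteq> []"
  by (simp add: prime_word_def)

lemma prime_wpow_eq:
  assumes "prime_word d" "d = wpow u k"
  shows "u = d \<and> k = 1"
proof -
  have "d \<noteq> []" using assms(1) by simp
  then have "k \<noteq> 0" "u \<noteq> []"
    using assms(2) by (metis wpow_0, metis wpow_Nil)
  moreover have "length d \<le> length u"
  proof (rule ccontr)
    assume "\<not> length d \<le> length u"
    then have "\<exists>u' k'. length u' < length d \<and> d = wpow u' k'"
      using assms(2) by (metis not_le)
    then show False using assms(1) unfolding prime_word_def by blast
  qed
  then have "k * length u \<le> 1 * length u" by (simp add: assms(2))
  ultimately have "k = 1"
    by (simp only: mult_le_cancel2) simp
  then show ?thesis using assms(2) by simp
qed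

lemma commute_prime:
  assumes "prime_word d" "u @ d = d @ u"
  shows "\<exists>i. u = wpow d i"
proof -
  obtain m k z where "wpow z m = u" "wpow z k = d"
    using comm_append_are_replicate[OF assms(2)] unfolding wpow_def by blast
  then show ?thesis
    using prime_wpow_eq[OF assms(1)] by metis
qed

lemma prime_commute_eq:
  assumes "prime_word d" "prime_word e" "d @ e = e @ d"
  shows "d = e"
  using commute_prime[OF assms(2,3)] prime_wpow_eq[OF assms(1)] by metis

lemma prime_root_exists:
  assumes "w \<noteq> []"
  shows "\<exists>d s. prime_word d \<and> s \<ge> 1 \<and> w = wpow d s"
  using assms
proof (induction "length w" arbitrary: w rule: less_induct)
  case less
  show ?case
  proof (cases "prime_word w")
    case True
    then show ?thesis using wpow_1[of w] by (metis order_refl)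
  next
    case False
    then obtain u k where u: "length u < length w" "w = wpow u k"
      using less.prems by (auto simp: prime_word_def)
    then have "u \<noteq> []" "k \<noteq> 0" using less.prems by auto
    then obtain d s where "prime_word d" "s \<ge> 1" "u = wpow d s"
      using less.hyps u by blast
    then show ?thesis
      using u \<open>k \<noteq> 0\<close> by (metis One_nat_def Suc_leI mult_pos_pos not_gr_zero wpow_mult
          less_eq_Suc_le)
  qed
qed

text \<open>Two prime words with a common power both commute with that power, hence with each other,
  and commuting prime words are equal. So the description in \<open>prime_root\<close> has a unique
  solution.\<close>

lemma prime_root_wpow:
  assumes "prime_word d" "s \<ge> 1"
  shows "prime_root (wpow d s) = d"
  unfolding prime_root_def
proof (rule the_equality)
  show "prime_word d \<and> (\<exists>s'\<ge>1. wpow d s = wpow d s')"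
    using assms by blast
next
  fix e assume "prime_word e \<and> (\<exists>s'\<ge>1. wpow d s = wpow e s')"
  then obtain t where e: "prime_word e" "t \<ge> 1" "wpow d s = wpow e t" by blast
  have "wpow d s \<noteq> []" using assms by (simp add: wpow_eq_Nil_iff)
  moreover have "d @ wpow d s = wpow d s @ d" "e @ wpow d s = wpow d s @ e"
    using e(3) commute_wpow by metis+
  ultimately have "e @ d = d @ e" using commute_trans by metis
  then show "e = d" using prime_commute_eq assms e by blast
qed

lemma prime_root_prime: "prime_word d \<Longrightarrow> prime_root d = d"
  using prime_root_wpow[of d 1] by simp

lemma prime_rootE:
  assumes "w \<noteq> []"
  obtains s where "prime_word (prime_root w)" "s \<ge> 1" "w = wpow (prime_root w) s"
  using prime_root_exists[OF assms] prime_root_wpow by metis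

lemma prime_root_of_wpow:
  assumes "w \<noteq> []" "k \<ge> 1"
  shows "prime_root (wpow w k) = prime_root w"
proof -
  obtain s where s: "prime_word (prime_root w)" "s \<ge> 1" "w = wpow (prime_root w) s"
    using assms prime_rootE by metis
  have "wpow w k = wpow (prime_root w) (s * k)"
    by (subst s(3)) (rule wpow_mult)
  moreover have "s * k \<ge> 1" using s(2) assms(2) by simp
  ultimately show ?thesis using prime_root_wpow[OF s(1)] by metis
qed

lemma commute_prime_root:
  assumes "u \<noteq> []" "v \<noteq> []" "u @ v = v @ u"
  shows "prime_root u = prime_root v"
proof -
  obtain s where s: "prime_word (prime_root u)" "s \<ge> 1" "u = wpow (prime_root u) s"
    using assms prime_rootE by metis
  have "v @ u = u @ v" using assms by simp
  moreover have "prime_root u @ u = u @ prime_root u"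
    using s(3) commute_wpow by metis
  ultimately have "v @ prime_root u = prime_root u @ v"
    using commute_trans assms(1) by metis
  then obtain i where i: "v = wpow (prime_root u) i" using commute_prime s(1) by metis
  then have "i \<ge> 1" using assms(2) by (cases i) auto
  then show ?thesis using i prime_root_wpow[OF s(1)] by metis
qed

lemma prime_root_in_lists:
  assumes "w \<noteq> []" "w \<in> lists A"
  shows "prime_root w \<in> lists A"
proof -
  obtain s where s: "s \<ge> 1" "w = wpow (prime_root w) s"
    using assms prime_rootE by metis
  then obtain t where "s = Suc t" by (cases s) auto
  then have "w = prime_root w @ wpow (prime_root w) t" using s by (metis wpow_Suc)
  then show ?thesis using assms(2) by (metis append_in_lists_conv)
qed

section \<open>Rotations\<close>

lemma rotate1_wpow: "rotate1 (wpow u k) = wpow (rotate1 u) k"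
proof (cases u)
  case (Cons a v)
  have "wpow (a # v) k @ [a] = a # wpow (v @ [a]) k"
    by (induction k) auto
  then show ?thesis
    by (cases k) (auto simp: Cons)
qed simp

lemma rotate_wpow: "rotate m (wpow u k) = wpow (rotate m u) k"
  by (induction m) (auto simp: rotate1_wpow)

lemma rotate_in_lists: "w \<in> lists A \<Longrightarrow> rotate m w \<in> lists A"
  by (auto simp: lists_eq_set)

lemma rotations_iff: "v \<in> rotations w \<longleftrightarrow> (\<exists>s t. w = s @ t \<and> v = t @ s)"
proof
  assume "v \<in> rotations w"
  then obtain k where "v = rotate k w" by (auto simp: rotations_def)
  then show "\<exists>s t. w = s @ t \<and> v = t @ s"
    by (metis append_take_drop_id rotate_drop_take)
next
  assume "\<exists>s t. w = s @ t \<and> v = t @ s"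
  then show "v \<in> rotations w"
    unfolding rotations_def by (metis rangeI rotate_append)
qed

lemma self_in_rotations [simp]: "w \<in> rotations w"
  using rotations_iff by fastforce

lemma rotations_append: "rotations (u @ v) = rotations (v @ u)"
proof -
  have "rotations (u @ v) \<subseteq> rotations (v @ u)" for u v :: "'a list"
  proof
    fix x assume "x \<in> rotations (u @ v)"
    then obtain k where "x = rotate k (u @ v)" by (auto simp: rotations_def)
    then have "x = rotate (k + length v) (v @ u)"
      by (metis rotate_append rotate_rotate)
    then show "x \<in> rotations (v @ u)" by (auto simp: rotations_def)
  qed
  then show ?thesis by blast
qed

lemma rotations_eq: "v \<in> rotations w \<Longrightarrow> rotations v = rotations w"
  using rotations_iff rotations_append by metis

lemma rotations_rotate [simp]: "rotations (rotate k w) = rotations w"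
  by (rule rotations_eq) (simp add: rotations_def)

lemma rotations_length: "v \<in> rotations w \<Longrightarrow> length v = length w"
  by (auto simp: rotations_def)

lemma finite_rotations: "finite (rotations w)"
proof -
  have "rotations w \<subseteq> {v. set v \<subseteq> set w \<and> length v = length w}"
    by (auto simp: rotations_def)
  then show ?thesis
    using finite_lists_length_eq[of "set w" "length w"] finite_subset by blast
qed

lemma prime_rotate:
  assumes "prime_word w"
  shows "prime_word (rotate m w)"
  unfolding prime_word_def
proof (intro conjI notI)
  assume "rotate m w = []"
  then show False using assms by simp
next
  assume "\<exists>u k. length u < length (rotate m w) \<and> rotate m w = wpow u k"
  then obtain u k where u: "length u < length w" "rotate m w = wpow u k" by auto
  have "w \<in> rotations (wpow u k)"
    using u(2) rotations_rotate self_in_rotations by metis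
  then obtain j where "w = wpow (rotate j u) k"
    by (auto simp: rotations_def rotate_wpow)
  then show False using u(1) assms by (metis length_rotate prime_word_def)
qed

lemma prime_rotations: "prime_word w \<Longrightarrow> v \<in> rotations w \<Longrightarrow> prime_word v"
  by (auto simp: rotations_def prime_rotate)

lemma prime_root_rotate:
  assumes "w \<noteq> []"
  shows "prime_root (rotate m w) = rotate m (prime_root w)"
proof -
  obtain s where s: "prime_word (prime_root w)" "s \<ge> 1" "w = wpow (prime_root w) s"
    using assms prime_rootE by metis
  have "rotate m w = wpow (rotate m (prime_root w)) s"
    using s(3) rotate_wpow by metis
  then show ?thesis using prime_root_wpow prime_rotate s by metis
qed

lemma rotations_prime_root_cong:
  assumes "w \<noteq> []" "v \<in> rotations w"
  shows "rotations (prime_root v) = rotations (prime_root w)"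
proof -
  obtain m where "v = rotate m w" using assms(2) by (auto simp: rotations_def)
  then show ?thesis using prime_root_rotate[OF assms(1)] rotations_rotate by metis
qed

text \<open>Over conjugate roots, equal lengths force equal exponents. The length thus supplies what
  the action on cyclic words discards.\<close>

lemma rotations_of_same_length:
  assumes "u \<noteq> []" "v \<noteq> []" "rotations (prime_root u) = rotations (prime_root v)"
    "length u = length v"
  shows "v \<in> rotations u"
proof -
  obtain s where s: "prime_word (prime_root u)" "u = wpow (prime_root u) s"
    using assms prime_rootE by metis
  obtain t where t: "prime_word (prime_root v)" "v = wpow (prime_root v) t"
    using assms prime_rootE by metis
  have "prime_root v \<in> rotations (prime_root u)" using assms(3) by simp
  then obtain m where m: "prime_root v = rotate m (prime_root u)"
    by (auto simp: rotations_def)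
  have "s * length (prime_root u) = t * length (prime_root v)"
    using s(2) t(2) assms(4) length_wpow by metis
  then have "s = t" using m s(1) by simp
  then have "v = rotate m u" using s(2) t(2) m rotate_wpow by metis
  then show ?thesis by (auto simp: rotations_def)
qed

text \<open>Leading copies of \<open>x\<close> are stripped from \<open>e\<close>. A nonempty
  remainder shorter than \<open>x\<close> makes the occurrence of \<open>x\<close> overlap two
  consecutive factors; the remainder then commutes with \<open>x\<close>, so it is a power of
  \<open>x\<close>.\<close>

lemma prime_inside_power:
  assumes "prime_word x" "wpow x N = e @ x @ r"
  shows "\<exists>i. e = wpow x i"
  using assms(2)
proof (induction "length e" arbitrary: e N rule: less_induct)
  case less
  have x: "x \<noteq> []" using assms(1) by simp
  have "N \<noteq> 0" using less.prems x by (cases N) auto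
  then obtain N' where N: "N = Suc N'" by (cases N) auto
  show ?case
  proof (cases "length x \<le> length e")
    case True
    then obtain e' where e': "e = x @ e'"
      using less.prems append_prefix_unique[of x "wpow x N'" e "x @ r"] N by auto
    then have "wpow x N' = e' @ x @ r" using less.prems N by simp
    then obtain i where "e' = wpow x i"
      using less.hyps[of e' N'] e' x by auto
    then have "e = wpow x (Suc i)" using e' by simp
    then show ?thesis by blast
  next
    case False
    show ?thesis
    proof (cases "e = []")
      case True
      then have "e = wpow x 0" by simp
      then show ?thesis by blast
    next
      case e: False
      obtain q where q: "x = e @ q"
        using append_prefix_unique[of e "x @ r" x "wpow x N'"] less.prems N False by auto
      \<comment> \<open>As \<open>e\<close> is nonempty, the occurrence of \<open>x\<close> runs
        beyond the first factor, so there is a second one.\<close>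
      have "length (wpow x N) \<ge> length e + length x" using less.prems by simp
      then have "N' \<noteq> 0" using e N by (cases N') auto
      then obtain N'' where "N' = Suc N''" by (cases N') auto
      then have "e @ q @ e @ q @ wpow x N'' = e @ (e @ q) @ r"
        using less.prems N by (metis append.assoc q wpow_Suc)
      then have "q @ e = e @ q"
        by (metis append.assoc append_eq_append_conv length_append add.commute same_append_eq)
      then have "e @ x = x @ e" using q by (metis append.assoc)
      then show ?thesis using commute_prime assms(1) by blast
    qed
  qed
qed

text \<open>As \<open>x\<close> is prime, it occurs inside its powers only at multiples of its length, so the long runs
  in the two rotations must be aligned.\<close>

lemma long_run_alignment:
  assumes x: "prime_word x" and len: "length a = length b" and N: "N \<ge> length a + 2"
    and rot: "wpow x N @ b \<in> rotations (wpow x N @ a)"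
  shows "\<exists>i. wpow x i @ b = a @ wpow x i \<or> wpow x i @ a = b @ wpow x i"
proof -
  \<comment> \<open>The length conditions say that the cut after \<open>e\<close> leaves a whole
    \<open>x\<close> of the run, and that \<open>e'\<close> is long enough to begin with
    \<open>x\<close>. Then \<open>x\<close> occurs in the run right after \<open>e\<close>.\<close>
  have shift: "\<exists>i. wpow x i @ b' = a' @ wpow x i"
    if e: "wpow x N @ a' = e @ e'" "wpow x N @ b' = e' @ e" and
      le: "length e \<le> (N - 1) * length x" "length e' \<ge> length x" and "length a' = length b'"
    for a' b' e e'
  proof -
    obtain N' where N': "N = Suc N'" using N by (cases N) auto
    have "x @ wpow x N' @ b' = e' @ e" using e N' by simp
    then obtain f where f: "e' = x @ f"
      using append_prefix_unique le(2) by metis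
    have "(e @ x) @ f = wpow x N @ a'" using e f by simp
    moreover have "length (e @ x) \<le> length (wpow x N)" using le N' by simp
    ultimately obtain r where "wpow x N = (e @ x) @ r"
      using append_prefix_unique by metis
    then obtain i where i: "e = wpow x i"
      using prime_inside_power[OF x] by (metis append.assoc)
    have "i \<le> N" using le(1) i N' x by simp
    then have split: "wpow x N = wpow x i @ wpow x (N - i)"
      by (metis le_add_diff_inverse wpow_add)
    then have "e' = wpow x (N - i) @ a'" using e(1) i by simp
    then have "wpow x N @ b' = wpow x (N - i) @ a' @ wpow x i" using e(2) i by simp
    moreover have "wpow x N = wpow x (N - i) @ wpow x i"
      using split wpow_commute by metis
    ultimately have "wpow x i @ b' = a' @ wpow x i" by simp
    then show ?thesis by blast
  qed
  obtain e e' where e: "wpow x N @ a = e @ e'" "wpow x N @ b = e' @ e"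
    using rot by (auto simp: rotations_iff)
  have "length x \<ge> 1" using prime_word_not_Nil[OF x] by (cases x) auto
  \<comment> \<open>The total length of \<open>e\<close> and \<open>e'\<close> lies between
    \<open>N * length x\<close> and \<open>(2 * N - 2) * length x\<close>, so at least one of the
    two orders meets both length conditions of \<open>shift\<close>.\<close>
  have "length a \<le> (N - 2) * length x"
    using N \<open>length x \<ge> 1\<close> by (metis add_le_imp_le_diff le_trans mult_le_mono2 mult.right_neutral)
  moreover have "length e + length e' = N * length x + length a"
    using e(1) by (metis length_append length_wpow)
  moreover obtain N' where "N = Suc (Suc N')"
    using N by (intro that[of "N - 2"]) simp
  ultimately consider "length e \<le> (N - 1) * length x" "length e' \<ge> length x"
    | "length e' \<le> (N - 1) * length x" "length e \<ge> length x"
    by (cases "length e \<le> (N - 1) * length x"; cases "length e' \<ge> length x") auto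
  then show ?thesis
  proof cases
    case 1
    then show ?thesis using shift[OF e] len by blast
  next
    case 2
    then show ?thesis using shift[OF e(2,1)] len by metis
  qed
qed

text \<open>Copies of \<open>wpow x e\<close> are stripped from \<open>b\<close> until it is shorter
  than that power. Then \<open>b @ x\<close> is a prefix of \<open>wpow x (e + e)\<close>, so
  \<open>x\<close> occurs in its own power right after \<open>b\<close>.\<close>

lemma prefix_of_shift_is_power:
  assumes x: "prime_word x" and e: "e \<ge> 1" and eq: "b @ x @ r = wpow x e @ b @ r'"
  shows "\<exists>j. b = wpow x j"
  using eq
proof (induction "length b" arbitrary: b rule: less_induct)
  case less
  define u where "u = wpow x e"
  have ux: "length x \<le> length u" and u: "u \<noteq> []" using e x by (auto simp: u_def wpow_eq_Nil_iff)
  show ?case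
  proof (cases "length u \<le> length b")
    case True
    then obtain b' where b': "b = u @ b'"
      using append_prefix_unique[of u _ b] less.prems u_def by metis
    then have "b' @ x @ r = wpow x e @ b' @ r'" using less.prems u_def by simp
    then obtain j where "b' = wpow x j" using less.hyps[of b'] b' u by auto
    then have "b = wpow x (e + j)" using b' by (simp add: u_def wpow_add)
    then show ?thesis by blast
  next
    case False
    then obtain b' where b': "u = b @ b'"
      using append_prefix_unique[of b "x @ r" u] less.prems u_def by (metis nat_le_linear)
    have "(b @ x) @ r = (u @ b) @ r'" using less.prems u_def by simp
    then obtain t where "u @ b = (b @ x) @ t"
      using append_prefix_unique[of "b @ x" r "u @ b" r'] ux by auto
    then have "wpow x (e + e) = b @ x @ t @ b'"
      using b' by (simp add: wpow_add flip: u_def)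
    then show ?thesis using prime_inside_power[OF x] by metis
  qed
qed

text \<open>If the shift for the longer words differed from the shift \<open>k\<close> for their
  first factors, \<open>b @ x\<close> would recur after a nontrivial power of \<open>x\<close>,
  which makes \<open>b\<close> a power of \<open>x\<close>. With equal shifts the first factors
  cancel and leave the alignment of \<open>c\<close> with \<open>d\<close>.\<close>

lemma alignment_transfer:
  assumes x: "prime_word x" and k: "wpow x k @ a = b @ wpow x k" and b: "\<nexists>j. b = wpow x j"
    and i: "wpow x i @ a @ x @ c = b @ x @ d @ wpow x i \<or>
      wpow x i @ b @ x @ d = a @ x @ c @ wpow x i"
  shows "wpow x k @ c = d @ wpow x k"
proof -
  have xx: "wpow x m @ x = x @ wpow x m" for m
    using wpow_Suc_right[of x m] by simp
  have no: False if "b @ x @ r = wpow x e @ b @ r'" "e \<ge> 1" for e r r'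
    using prefix_of_shift_is_power[OF x that(2,1)] b by blast
  have kk: "wpow x k @ a @ x @ c = b @ x @ wpow x k @ c"
  proof -
    have "wpow x k @ a @ x @ c = (wpow x k @ a) @ x @ c" by simp
    also have "\<dots> = b @ (wpow x k @ x) @ c" unfolding k by (simp only: append.assoc)
    also have "\<dots> = b @ x @ wpow x k @ c" unfolding xx by (simp only: append.assoc)
    finally show ?thesis .
  qed
  from i show ?thesis
  proof
    assume i: "wpow x i @ a @ x @ c = b @ x @ d @ wpow x i"
    consider "i = k" | "i < k" | "k < i" by linarith
    then show ?thesis
    proof cases
      case 1
      then show ?thesis using i kk by simp
    next
      case 2
      then have "wpow x k = wpow x (k - i) @ wpow x i"
        by (metis le_add_diff_inverse2 less_imp_le wpow_add)
      then have "b @ x @ wpow x k @ c = wpow x (k - i) @ b @ x @ d @ wpow x i"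
        using kk i by simp
      moreover have "1 \<le> k - i" using 2 by simp
      ultimately show ?thesis using no by blast
    next
      case 3
      then have "wpow x i = wpow x (i - k) @ wpow x k"
        by (metis le_add_diff_inverse2 less_imp_le wpow_add)
      then have "wpow x i @ a @ x @ c = wpow x (i - k) @ wpow x k @ a @ x @ c"
        by (simp only: append.assoc)
      then have "b @ x @ d @ wpow x i = wpow x (i - k) @ b @ x @ wpow x k @ c"
        by (simp only: kk i)
      moreover have "1 \<le> i - k" using 3 by simp
      ultimately show ?thesis using no by blast
    qed
  next
    \<comment> \<open>This form of alignment shifts the opposite way. The two shifts add up to
      \<open>k + i\<close>, which must therefore vanish.\<close>
    assume i: "wpow x i @ b @ x @ d = a @ x @ c @ wpow x i"
    then have "wpow x (k + i) @ b @ x @ d = (wpow x k @ a @ x @ c) @ wpow x i"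
      by (simp add: wpow_add)
    then have "b @ x @ wpow x k @ c @ wpow x i = wpow x (k + i) @ b @ x @ d"
      by (simp only: kk append.assoc)
    then have "k = 0" "i = 0" using no by fastforce+
    then show ?thesis using i k by simp
  qed
qed

text \<open>An argument in the manner of Fine and Wilf: if the word were a power of a shorter
  \<open>z\<close>, both \<open>x @ z\<close> and \<open>z @ x\<close> would be prefixes of it. Then
  \<open>x\<close> commutes with \<open>z\<close>, hence with the whole word, hence with
  \<open>y\<close>.\<close>

lemma noncommuting_power_prime:
  assumes nc: "x @ y \<noteq> y @ x" and a: "a \<ge> length y + 2"
  shows "prime_word (wpow x a @ y)"
proof (rule ccontr)
  define W where "W = wpow x a @ y"
  have x: "length x \<ge> 1" using nc by (cases x) auto
  obtain a' where a': "a = Suc a'" using a by (cases a) auto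
  assume "\<not> prime_word (wpow x a @ y)"
  moreover have "W \<noteq> []" using x a by (auto simp: W_def wpow_eq_Nil_iff)
  ultimately obtain z c where z: "length z < length W" "W = wpow z c"
    by (auto simp: prime_word_def W_def)
  have "c \<noteq> 0" "c \<noteq> 1" using z \<open>W \<noteq> []\<close> by auto
  then obtain c' where c': "c = Suc (Suc c')" by (metis One_nat_def not0_implies_Suc)
  have W1: "W = x @ wpow x a' @ y" and W2: "W = z @ wpow z (Suc c')"
    using a' c' z(2) by (auto simp: W_def)
  have "2 * length z \<le> length W" using W2 by simp
  moreover have "length W = a * length x + length y" by (simp add: W_def)
  \<comment> \<open>Here the bound on \<open>a\<close> enters: \<open>z\<close> is at most half of
    \<open>W\<close>, so the run of \<open>x\<close> exceeds it by at least one more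
    \<open>x\<close>.\<close>
  moreover have "length y + 2 * length x \<le> a * length x"
  proof -
    have "(length y + 2) * length x \<le> a * length x" using a by (rule mult_le_mono1)
    moreover have "length y * 1 \<le> length y * length x" using x by (rule mult_le_mono2)
    ultimately show ?thesis by (simp only: distrib_right)
  qed
  ultimately have le: "length z + length x \<le> a * length x" by linarith
  have "z @ wpow z (Suc c') = wpow x a' @ x @ y"
    using W1 W2 wpow_Suc_right[of x a'] by (metis append.assoc wpow_Suc)
  then obtain t where t: "wpow x a' = z @ t"
    using append_prefix_unique[of z _ "wpow x a'"] le a' by auto
  have lW: "length x + length z \<le> length W" using le by (simp add: W_def)
  have "wpow z (Suc c') @ z = x @ wpow x a' @ y"
    using W1 z(2) c' wpow_Suc_right by metis
  then obtain t' where t': "wpow z (Suc c') = x @ t'"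
    using append_prefix_unique[of x _ "wpow z (Suc c')" z] lW W2
    by (metis add.commute add_le_cancel_left length_append)
  have "x @ z @ t @ y = z @ x @ t'" using W1 W2 t t' by (metis append.assoc)
  then have "(x @ z) @ t @ y = (z @ x) @ t'" by simp
  then have "x @ z = z @ x" by (metis add.commute append_eq_append_conv length_append)
  then have "x @ W = W @ x" using z(2) commute_wpow by metis
  then have "wpow x a @ x @ y = wpow x a @ y @ x"
    unfolding W_def using wpow_Suc wpow_Suc_right by (metis append.assoc)
  then show False using nc by simp
qed


section \<open>Homomorphisms with pairwise conjugate roots\<close>

text \<open>\<open>L\<close> stands for the words that loop at two given states, \<open>f\<close>
  and \<open>g\<close> for the outputs there. Only the prime roots are assumed conjugate, because
  the action on cyclic words forgets exponents.\<close>

locale conjugate_root_homs =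
  fixes L :: "'b list set" and f g :: "'b list \<Rightarrow> 'a list"
  assumes L_append: "u \<in> L \<Longrightarrow> v \<in> L \<Longrightarrow> u @ v \<in> L"
    and f_append: "u \<in> L \<Longrightarrow> v \<in> L \<Longrightarrow> f (u @ v) = f u @ f v"
    and g_append: "u \<in> L \<Longrightarrow> v \<in> L \<Longrightarrow> g (u @ v) = g u @ g v"
    and f_eq_Nil: "u \<in> L \<Longrightarrow> f u = [] \<longleftrightarrow> u = []"
    and g_eq_Nil: "u \<in> L \<Longrightarrow> g u = [] \<longleftrightarrow> u = []"
    and conj: "u \<in> L \<Longrightarrow> u \<noteq> [] \<Longrightarrow> rotations (prime_root (f u)) = rotations (prime_root (g u))"
begin

lemma power_append:
  assumes "u \<in> L" "v \<in> L"
  shows "wpow u k @ v \<in> L \<and> f (wpow u k @ v) = wpow (f u) k @ f v \<and>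
    g (wpow u k @ v) = wpow (g u) k @ g v"
proof (induction k)
  case (Suc k)
  then show ?case
    using L_append[OF assms(1)] f_append[OF assms(1)] g_append[OF assms(1)] by simp
qed (use assms in simp)

text \<open>For large \<open>b\<close> the word \<open>wpow (f u) b @ f v\<close> is prime, hence as
  long as the prime root of the corresponding word for \<open>g\<close>. If \<open>g u\<close> and
  \<open>g v\<close> commuted, that root would stay fixed while the length grows. So the word for
  \<open>g\<close> is prime as well, and the full lengths agree for all large
  \<open>b\<close>.\<close>

lemma noncommuting_length:
  assumes L: "u \<in> L" "v \<in> L" and nc: "f u @ f v \<noteq> f v @ f u"
  shows "g u @ g v \<noteq> g v @ g u" "length (f u) = length (g u)" "length (f v) = length (g v)"
proof -
  have "u \<noteq> []" "v \<noteq> []" using nc f_eq_Nil L by fastforce+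
  then have nN: "f u \<noteq> []" "g u \<noteq> []" using f_eq_Nil g_eq_Nil L by auto
  define a where "a = length (f v) + length (g v) + 2"
  have prime_f: "prime_word (wpow (f u) b @ f v)" if "b \<ge> a" for b
    using noncommuting_power_prime[OF nc] that by (simp add: a_def)
  have rot: "rotations (wpow (f u) b @ f v) = rotations (prime_root (wpow (g u) b @ g v))"
    if "b \<ge> a" for b
    using conj[of "wpow u b @ v"] power_append[OF L, of b] prime_root_prime[OF prime_f[OF that]]
      \<open>v \<noteq> []\<close> by auto
  show nc_g: "g u @ g v \<noteq> g v @ g u"
  proof
    assume comm: "g u @ g v = g v @ g u"
    have "length (wpow (f u) b @ f v) = length (prime_root (g u))" if "b \<ge> a" for b
    proof -
      have "g u @ wpow (g u) b @ g v = (wpow (g u) b @ g v) @ g u"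
        using comm wpow_Suc_right[of "g u" b] by (metis append.assoc wpow_Suc)
      moreover have "wpow (g u) b @ g v \<noteq> []" using L g_eq_Nil \<open>v \<noteq> []\<close> by simp
      ultimately have "prime_root (g u) = prime_root (wpow (g u) b @ g v)"
        using commute_prime_root nN(2) by blast
      then show ?thesis using rot[OF that] rotations_length self_in_rotations by metis
    qed
    \<comment> \<open>The right side does not depend on \<open>b\<close>, while the left side grows
      by \<open>length (f u)\<close> with each step.\<close>
    from this[of a] this[of "Suc a"] have "length (f u) = 0" by simp
    then show False using nN by simp
  qed
  have len: "b * length (f u) + length (f v) = b * length (g u) + length (g v)" if "b \<ge> a" for b
  proof -
    have "prime_word (wpow (g u) b @ g v)"
      using noncommuting_power_prime[OF nc_g] that by (simp add: a_def)
    then have "rotations (wpow (f u) b @ f v) = rotations (wpow (g u) b @ g v)"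
      using rot[OF that] prime_root_prime by metis
    then have "length (wpow (f u) b @ f v) = length (wpow (g u) b @ g v)"
      using rotations_length self_in_rotations by metis
    then show ?thesis by simp
  qed
  \<comment> \<open>Subtracting two consecutive instances isolates the lengths for
    \<open>u\<close>.\<close>
  from len[of a] len[of "Suc a"] show "length (f u) = length (g u)" by simp
  with len[of a] show "length (f v) = length (g v)" by simp
qed

text \<open>A nonempty \<open>f w\<close> cannot commute with both \<open>f u\<close> and
  \<open>f v\<close>, since these would then commute with each other. So
  \<open>noncommuting_length\<close> applies to \<open>w\<close> together with one of them.\<close>

lemma length_eq:
  assumes L: "u \<in> L" "v \<in> L" "w \<in> L" and nc: "f u @ f v \<noteq> f v @ f u"
  shows "length (f w) = length (g w)"
proof (cases "w = []")
  case True
  then show ?thesis using f_eq_Nil[OF L(3)] g_eq_Nil[OF L(3)] by simp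
next
  case False
  then have "f w \<noteq> []" using f_eq_Nil L by simp
  then have "f w @ f u \<noteq> f u @ f w \<or> f w @ f v \<noteq> f v @ f w"
    using commute_trans[of "f w" "f u" "f v"] nc by metis
  then show ?thesis using noncommuting_length L by blast
qed

lemma aligned:
  assumes L: "u \<in> L" "v \<in> L" and nc: "f u @ f v \<noteq> f v @ f u"
  shows "\<exists>c d c' d'. \<forall>w\<in>L. c @ f w @ d = c' @ g w @ d'"
proof -
  \<comment> \<open>Large enough for \<open>noncommuting_power_prime\<close> on the side of
    \<open>f\<close> and on that of \<open>g\<close>.\<close>
  define a where "a = length (f v) + length (g v) + 2"
  define z where "z = wpow u a @ v"
  define x where "x = f z"
  define y where "y = g z"
  have zL: "z \<in> L" and xz: "x = wpow (f u) a @ f v" and yz: "y = wpow (g u) a @ g v"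
    using power_append[OF L] by (auto simp: z_def x_def y_def)
  have "v \<noteq> []" using nc f_eq_Nil L by fastforce
  then have "z \<noteq> []" by (simp add: z_def)
  have x: "prime_word x"
    unfolding xz by (rule noncommuting_power_prime[OF nc]) (simp add: a_def)
  have y: "prime_word y"
    unfolding yz by (rule noncommuting_power_prime[OF noncommuting_length(1)[OF L nc]])
      (simp add: a_def)
  have "y \<in> rotations x"
    using conj[OF zL \<open>z \<noteq> []\<close>] prime_root_prime[OF x] prime_root_prime[OF y]
    by (simp add: x_def y_def)
  then obtain s t where st: "x = t @ s" "y = s @ t" by (auto simp: rotations_iff)
  \<comment> \<open>With \<open>x = t @ s\<close> and \<open>y = s @ t\<close>, framing
    \<open>g w\<close> by \<open>t\<close> and \<open>s\<close> turns runs of \<open>y\<close> into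
    runs of \<open>x\<close>. The extra \<open>x\<close> in \<open>A\<close> balances the lengths of
    the frame.\<close>
  define A where "A w = x @ f w" for w
  define B where "B w = t @ g w @ s" for w
  have y_x: "wpow y k = s @ wpow x j @ t" if "k = Suc j" for k j
    unfolding that
  proof (induction j)
    case (Suc j)
    have "wpow y (Suc (Suc j)) = y @ s @ wpow x j @ t" using Suc by simp
    also have "\<dots> = s @ wpow x (Suc j) @ t" by (simp add: st)
    finally show ?case .
  qed (simp add: st)
  have align: "\<exists>i. wpow x i @ B w = A w @ wpow x i \<or> wpow x i @ A w = B w @ wpow x i"
    if w: "w \<in> L" for w
  proof (rule long_run_alignment[OF x])
    have lw: "length (f w) = length (g w)" using length_eq L w nc by blast
    then show len: "length (A w) = length (B w)" by (simp add: A_def B_def st)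
    define N where "N = length (A w) + 2"
    show "N \<ge> length (A w) + 2" by (simp add: N_def)
    have zw: "wpow z (Suc N) @ w \<in> L" "f (wpow z (Suc N) @ w) = wpow x (Suc N) @ f w"
      "g (wpow z (Suc N) @ w) = wpow y (Suc N) @ g w"
      using power_append[OF zL w, of "Suc N"] by (simp_all add: x_def y_def)
    have "wpow y (Suc N) @ g w \<in> rotations (wpow x (Suc N) @ f w)"
    proof (rule rotations_of_same_length)
      have "wpow z (Suc N) @ w \<noteq> []" using \<open>z \<noteq> []\<close> by simp
      then show "rotations (prime_root (wpow x (Suc N) @ f w)) =
          rotations (prime_root (wpow y (Suc N) @ g w))"
        using conj[OF zw(1)] unfolding zw(2,3) by blast
      show "wpow x (Suc N) @ f w \<noteq> []" "wpow y (Suc N) @ g w \<noteq> []"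
        using prime_word_not_Nil[OF x] prime_word_not_Nil[OF y] by simp_all
      show "length (wpow x (Suc N) @ f w) = length (wpow y (Suc N) @ g w)"
        by (simp add: st lw)
    qed
    moreover have "wpow x (Suc N) @ f w = wpow x N @ A w"
      by (simp only: wpow_Suc_right A_def append.assoc)
    moreover have "wpow y (Suc N) @ g w = s @ (wpow x N @ t @ g w)" using y_x by simp
    then have "rotations (wpow y (Suc N) @ g w) = rotations (wpow x N @ B w)"
      using rotations_append[of s "wpow x N @ t @ g w"] by (simp add: B_def)
    ultimately show "wpow x N @ B w \<in> rotations (wpow x N @ A w)"
      using rotations_eq self_in_rotations by metis
  qed
  \<comment> \<open>Two copies of \<open>z\<close> are needed: on the side of \<open>g\<close> they
    give \<open>s @ t @ s @ t\<close>, which supplies the closing \<open>s\<close> of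
    \<open>B w\<close>, one full \<open>x\<close>, and the opening \<open>t\<close> of
    \<open>B w'\<close>.\<close>
  have AB_append: "A (w @ z @ z @ w') = A w @ x @ A w'" "B (w @ z @ z @ w') = B w @ x @ B w'"
    if "w \<in> L" "w' \<in> L" for w w'
    using that zL L_append by (auto simp: A_def B_def f_append g_append st
        simp flip: x_def y_def)
  \<comment> \<open>This loop serves as the reference: as \<open>f w\<close> does not commute with
    \<open>x\<close>, \<open>A w\<close> is no power of \<open>x\<close>, and its shift
    \<open>k\<close> can be transferred to all other loops.\<close>
  obtain w where w: "w \<in> L" "f w @ x \<noteq> x @ f w"
  proof -
    have "f u @ x \<noteq> x @ f u \<or> f v @ x \<noteq> x @ f v"
      using commute_trans[of x "f u" "f v"] nc x by (metis prime_word_not_Nil)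
    then show ?thesis using that L by blast
  qed
  have A_not_power: "\<nexists>j. A w = wpow x j"
  proof
    assume "\<exists>j. A w = wpow x j"
    then obtain j where "x @ f w = wpow x j" by (auto simp: A_def)
    then have "x @ (f w @ x) = x @ (x @ f w)"
      by (metis append.assoc wpow_Suc wpow_Suc_right)
    then show False using w(2) by simp
  qed
  from align[OF w(1)] obtain k
    where "wpow x k @ B w = A w @ wpow x k \<or> wpow x k @ A w = B w @ wpow x k" by blast
  then show ?thesis
  proof
    assume k: "wpow x k @ B w = A w @ wpow x k"
    have "wpow x k @ B w' = A w' @ wpow x k" if w': "w' \<in> L" for w'
    proof -
      have "w @ z @ z @ w' \<in> L" using w w' zL L_append by blast
      from align[OF this] obtain i where "wpow x i @ B w @ x @ B w' = A w @ x @ A w' @ wpow x i \<or>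
        wpow x i @ A w @ x @ A w' = B w @ x @ B w' @ wpow x i"
        unfolding AB_append[OF w(1) w'] append.assoc by blast
      then show ?thesis using alignment_transfer[OF x k A_not_power] by blast
    qed
    then have "\<forall>w'\<in>L. x @ f w' @ wpow x k = (wpow x k @ t) @ g w' @ s"
      by (simp add: A_def B_def)
    then show ?thesis by blast
  next
    assume k: "wpow x k @ A w = B w @ wpow x k"
    have B_not_power: "\<nexists>j. B w = wpow x j"
    proof
      assume "\<exists>j. B w = wpow x j"
      then obtain j where "wpow x k @ A w = wpow x j @ wpow x k" using k by auto
      then have "A w = wpow x j" by (metis same_append_eq wpow_commute)
      then show False using A_not_power by blast
    qed
    have "wpow x k @ A w' = B w' @ wpow x k" if w': "w' \<in> L" for w'
    proof -
      have "w @ z @ z @ w' \<in> L" using w w' zL L_append by blast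
      from align[OF this] obtain i where "wpow x i @ A w @ x @ A w' = B w @ x @ B w' @ wpow x i \<or>
        wpow x i @ B w @ x @ B w' = A w @ x @ A w' @ wpow x i"
        unfolding AB_append[OF w(1) w'] append.assoc by blast
      then show ?thesis using alignment_transfer[OF x k B_not_power] by blast
    qed
    then have "\<forall>w'\<in>L. (wpow x k @ x) @ f w' @ [] = t @ g w' @ (s @ wpow x k)"
      by (simp add: A_def B_def)
    then show ?thesis by blast
  qed
qed

end


section \<open>Infinite words\<close>

lemma inf_words_conc: "w \<in> lists {..<n} \<Longrightarrow> x \<in> inf_words n \<Longrightarrow> w \<frown> x \<in> inf_words n"
  by (auto simp: inf_words_def simp flip: lists_eq_set)

lemma inf_words_conc_iff: "w \<frown> x \<in> inf_words n \<longleftrightarrow> w \<in> lists {..<n} \<and> x \<in> inf_words n"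
  by (auto simp: inf_words_def lists_eq_set)

lemma subsequence_in_lists: "x \<in> inf_words n \<Longrightarrow> x [i \<rightarrow> j] \<in> lists {..<n}"
  by (auto simp: inf_words_def lists_eq_set)

lemma suffix_in_inf_words: "x \<in> inf_words n \<Longrightarrow> suffix k x \<in> inf_words n"
  by (auto simp: inf_words_def)

lemma iter_in_inf_words: "w \<in> lists {..<n} \<Longrightarrow> w \<noteq> [] \<Longrightarrow> w\<^sup>\<omega> \<in> inf_words n"
  by (auto simp: inf_words_def lists_eq_set)
    (metis lessThan_iff mod_less_divisor nth_mem subsetD length_greater_0_conv)

lemma inf_words_nonempty: "n \<ge> 1 \<Longrightarrow> (\<lambda>_. 0) \<in> inf_words n"
  by (auto simp: inf_words_def)

lemma conc_left_cancel: "length u \<le> length v \<Longrightarrow> u \<frown> x = v \<frown> y \<Longrightarrow> \<exists>e. v = u @ e \<and> x = e \<frown> y"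
proof -
  assume le: "length u \<le> length v" and eq: "u \<frown> x = v \<frown> y"
  have "v = take (length u) v @ drop (length u) v" by simp
  then have "u \<frown> x = take (length u) v \<frown> (drop (length u) v \<frown> y)" using eq by simp
  then have "u = take (length u) v \<and> x = drop (length u) v \<frown> y"
    using le by (subst (asm) concat_eq) auto
  then show ?thesis by (metis append_take_drop_id)
qed

lemma conc_fixpoint_unique:
  assumes "w \<noteq> []" "x = w \<frown> x"
  shows "x = w\<^sup>\<omega>"
proof
  fix i show "x i = w\<^sup>\<omega> i"
  proof (induction i rule: less_induct)
    case (less i)
    show ?case
    proof (cases "i < length w")
      case True
      then show ?thesis using assms by (metis conc_fst iter_nth length_greater_0_conv mod_less)
    next
      case False
      then have "x i = x (i - length w)" using assms(2) by (metis conc_snd)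
      also have "\<dots> = w\<^sup>\<omega> (i - length w)"
        by (rule less) (use False assms(1) in \<open>cases w; simp\<close>)
      also have "\<dots> = w\<^sup>\<omega> i" using False assms(1) by (simp add: le_mod_geq)
      finally show ?thesis .
    qed
  qed
qed

lemma iter_unroll': "w \<noteq> [] \<Longrightarrow> w \<frown> w\<^sup>\<omega> = w\<^sup>\<omega>"
  using iter_unroll[of w] by simp

lemma wpow_conc_iter: "w \<noteq> [] \<Longrightarrow> wpow w k \<frown> w\<^sup>\<omega> = w\<^sup>\<omega>"
proof (induction k)
  case (Suc k)
  then show ?case using iter_unroll'[of w] by (metis conc_conc wpow_Suc)
qed simp

lemma iter_wpow: "w \<noteq> [] \<Longrightarrow> k \<ge> 1 \<Longrightarrow> (wpow w k)\<^sup>\<omega> = w\<^sup>\<omega>"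
  using conc_fixpoint_unique[of "wpow w k" "w\<^sup>\<omega>"] wpow_conc_iter[of w k]
  by (simp add: wpow_eq_Nil_iff)

lemma iter_rotate: "w = u @ v \<Longrightarrow> w \<noteq> [] \<Longrightarrow> u \<frown> (v @ u)\<^sup>\<omega> = w\<^sup>\<omega>"
proof -
  assume w: "w = u @ v" "w \<noteq> []"
  have "(v @ u) \<frown> (v @ u)\<^sup>\<omega> = (v @ u)\<^sup>\<omega>" by (rule iter_unroll') (use w in auto)
  then have "u \<frown> (v @ u)\<^sup>\<omega> = u \<frown> ((v @ u) \<frown> (v @ u)\<^sup>\<omega>)" by (simp only:)
  also have "\<dots> = w \<frown> (u \<frown> (v @ u)\<^sup>\<omega>)" using w by simp
  finally show ?thesis using conc_fixpoint_unique w(2) by blast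
qed

lemma prefix_iter: "w \<noteq> [] \<Longrightarrow> prefix (k * length w) (w\<^sup>\<omega>) = wpow w k"
  using prefix_conc_length[of "wpow w k" "w\<^sup>\<omega>"] wpow_conc_iter[of w k] by simp

text \<open>The common prefix of length \<open>length d * length e\<close> is a power of both
  words.\<close>

lemma iter_eq_prime_root:
  assumes "d \<noteq> []" "e \<noteq> []" "d\<^sup>\<omega> = e\<^sup>\<omega>"
  shows "prime_root d = prime_root e"
proof -
  have "wpow d (length e) = wpow e (length d)"
    using prefix_iter[OF assms(1), of "length e"] prefix_iter[OF assms(2), of "length d"] assms(3)
    by (simp add: mult.commute)
  moreover have "length d \<ge> 1" "length e \<ge> 1" using assms(1,2) by (cases d; cases e; simp)+
  ultimately show ?thesis using prime_root_of_wpow assms(1,2) by metis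
qed

lemma suffix_iter:
  assumes "w \<noteq> []"
  shows "\<exists>v\<in>rotations w. suffix k (w\<^sup>\<omega>) = v\<^sup>\<omega>"
proof -
  define u where "u = take (k mod length w) w"
  define v where "v = drop (k mod length w) w"
  have uv: "w = u @ v" by (simp add: u_def v_def)
  have "length u = k mod length w" using assms by (simp add: u_def)
  moreover have "k = (k div length w) * length w + k mod length w" by simp
  ultimately have k: "k = length (wpow w (k div length w) @ u)" by simp
  have "w\<^sup>\<omega> = wpow w (k div length w) \<frown> (u \<frown> (v @ u)\<^sup>\<omega>)"
    using iter_rotate[OF uv assms] wpow_conc_iter[OF assms] by simp
  then have "w\<^sup>\<omega> = (wpow w (k div length w) @ u) \<frown> (v @ u)\<^sup>\<omega>" by simp
  then have "suffix k (w\<^sup>\<omega>) = (v @ u)\<^sup>\<omega>"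
    using k suffix_conc_length[of "wpow w (k div length w) @ u" "(v @ u)\<^sup>\<omega>"] by metis
  moreover have "v @ u \<in> rotations w" using uv rotations_iff by blast
  ultimately show ?thesis by blast
qed

text \<open>Dropping the longer of the two prefixes leaves a tail that is purely periodic in both
  descriptions. This allows cyclic images to be read off from the maps on infinite words.\<close>

lemma conc_iter_eq_rotations:
  assumes "d \<noteq> []" "e \<noteq> []" "u \<frown> d\<^sup>\<omega> = v \<frown> e\<^sup>\<omega>"
  shows "rotations (prime_root d) = rotations (prime_root e)"
proof -
  have main: "rotations (prime_root d) = rotations (prime_root e)"
    if de: "d \<noteq> []" "e \<noteq> []" "u \<frown> d\<^sup>\<omega> = v \<frown> e\<^sup>\<omega>" "length u \<le> length v" for d e u v :: "'a list"
  proof -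
    obtain r where r: "d\<^sup>\<omega> = r \<frown> e\<^sup>\<omega>" using conc_left_cancel de(3,4) by blast
    obtain d' where d': "d' \<in> rotations d" "suffix (length r) (d\<^sup>\<omega>) = d'\<^sup>\<omega>"
      using suffix_iter[OF de(1)] by blast
    then have "d'\<^sup>\<omega> = e\<^sup>\<omega>" using r by simp
    moreover have "d' \<noteq> []" using d'(1) de(1) rotations_length by fastforce
    ultimately have "prime_root d' = prime_root e" using iter_eq_prime_root de(2) by blast
    then show ?thesis using rotations_prime_root_cong[OF de(1) d'(1)] by simp
  qed
  show ?thesis
    using main[OF assms] main[OF assms(2,1) assms(3)[symmetric]] by (metis nat_le_linear)
qed


section \<open>Runs of transducers\<close>

lemma steps_append [simp]: "steps T (u @ v) q = steps T v (steps T u q)"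
  by (induction u arbitrary: q) auto

lemma outs_append [simp]: "outs T (u @ v) q = outs T u q @ outs T v (steps T u q)"
  by (induction u arbitrary: q) auto

lemma steps_in_St:
  "is_transducer n T \<Longrightarrow> w \<in> lists {..<n} \<Longrightarrow> q \<in> St T \<Longrightarrow> steps T w q \<in> St T"
  by (induction w arbitrary: q) (auto simp: is_transducer_def)

lemma outs_in_lists:
  "is_transducer n T \<Longrightarrow> w \<in> lists {..<n} \<Longrightarrow> q \<in> St T \<Longrightarrow> outs T w q \<in> lists {..<n}"
  by (induction w arbitrary: q) (auto simp: is_transducer_def)

lemma outs_loop_not_Nil:
  "is_transducer n T \<Longrightarrow> w \<in> lists {..<n} \<Longrightarrow> q \<in> St T \<Longrightarrow> w \<noteq> [] \<Longrightarrow> steps T w q = q \<Longrightarrow>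
    outs T w q \<noteq> []"
  by (simp add: is_transducer_def)

lemma finite_St: "is_transducer n T \<Longrightarrow> finite (St T)"
  by (simp add: is_transducer_def)

lemma St_nonempty: "is_transducer n T \<Longrightarrow> St T \<noteq> {}"
  by (simp add: is_transducer_def)

lemma steps_loop_wpow: "steps T w q = q \<Longrightarrow> steps T (wpow w k) q = q"
  by (induction k) auto

lemma outs_loop_wpow: "steps T w q = q \<Longrightarrow> outs T (wpow w k) q = wpow (outs T w q) k"
  by (induction k) auto

text \<open>By the pigeonhole principle the run visits some state twice, and the loop in between has
  nonempty output.\<close>

lemma outs_long_not_Nil:
  assumes T: "is_transducer n T" and w: "w \<in> lists {..<n}" "card (St T) \<le> length w"
    and q: "q \<in> St T"
  shows "outs T w q \<noteq> []"
proof -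
  define f where "f i = steps T (take i w) q" for i
  have take_w: "take i w \<in> lists {..<n}" "drop i w \<in> lists {..<n}" for i
    using w(1) by (metis append_in_lists_conv append_take_drop_id)+
  have "f ` {..card (St T)} \<subseteq> St T"
    using steps_in_St[OF T take_w(1) q] by (auto simp: f_def)
  then have "card (f ` {..card (St T)}) < card {..card (St T)}"
    using card_mono[OF finite_St[OF T], of "f ` {..card (St T)}"] by simp
  then have "\<not> inj_on f {..card (St T)}" using pigeonhole by blast
  then obtain i j where ij: "i < j" "j \<le> card (St T)" "f i = f j"
    by (metis atMost_iff inj_on_def linorder_neqE_nat)
  define u where "u = drop i (take j w)"
  have t: "take j w = take i w @ u"
    using ij(1) by (simp add: u_def) (metis append_take_drop_id less_imp_le min.absorb1 take_take)
  have "u \<noteq> []" using ij w(2) by (simp add: u_def)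
  moreover have "u \<in> lists {..<n}" using take_w(1)[of j] t by simp
  moreover have "steps T u (f i) = f i" using ij(3) t by (simp add: f_def)
  moreover have "f i \<in> St T" using steps_in_St[OF T take_w(1) q] by (simp add: f_def)
  ultimately have "outs T u (f i) \<noteq> []" using outs_loop_not_Nil[OF T] by blast
  moreover have "w = take i w @ u @ drop j w" using t by (metis append.assoc append_take_drop_id)
  then have "outs T w q = outs T (take i w) q @ outs T u (f i) @ outs T (drop j w) (steps T u (f i))"
    by (metis f_def outs_append)
  ultimately show ?thesis by simp
qed

text \<open>The word contains \<open>l\<close> blocks of \<open>card (St T)\<close> letters, each
  with nonempty output. The bound makes outputs on infinite words infinite, and it later gives
  synchronization of products.\<close>

lemma length_outs_ge:
  assumes T: "is_transducer n T" and w: "w \<in> lists {..<n}" "l * card (St T) \<le> length w"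
    and q: "q \<in> St T"
  shows "l \<le> length (outs T w q)"
  using w q
proof (induction l arbitrary: w q)
  case (Suc l)
  define u where "u = take (card (St T)) w"
  define v where "v = drop (card (St T)) w"
  have uv: "w = u @ v" by (simp add: u_def v_def)
  then have l: "u \<in> lists {..<n}" "v \<in> lists {..<n}" using Suc.prems(1) by auto
  have "card (St T) \<le> length u" using Suc.prems(2) by (simp add: u_def)
  then have "outs T u q \<noteq> []" using outs_long_not_Nil[OF T l(1)] Suc.prems by blast
  moreover have "l \<le> length (outs T v (steps T u q))"
    using Suc.IH[OF l(2)] steps_in_St[OF T l(1)] Suc.prems by (simp add: v_def)
  moreover have "length (outs T u q) \<ge> 1" using calculation(1) by (cases "outs T u q") auto
  ultimately show ?case by (simp add: uv)
qed simp

lemma outs_prefix_unbounded: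
  assumes "is_transducer n T" "q \<in> St T" "x \<in> inf_words n"
  shows "\<exists>m\<ge>k. i < length (outs T (prefix m x) q)"
proof -
  define m where "m = k + Suc i * card (St T)"
  have "Suc i \<le> length (outs T (prefix m x) q)"
    using assms by (intro length_outs_ge[OF assms(1)] subsequence_in_lists) (auto simp: m_def)
  then show ?thesis by (intro exI[of _ m]) (simp add: m_def)
qed

text \<open>Outputs on longer prefixes extend those on shorter ones, so the least prefix chosen in
  \<open>state_map\<close> may be replaced by any one that is long enough.\<close>

lemma state_map_nth:
  assumes "i < length (outs T (prefix m x) q)"
  shows "state_map T q x i = outs T (prefix m x) q ! i"
proof -
  define k where "k = (LEAST m. i < length (outs T (prefix m x) q))"
  have k: "i < length (outs T (prefix k x) q)" "k \<le> m"
    unfolding k_def using assms LeastI Least_le by metis+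
  have "prefix m x = prefix k x @ x [k \<rightarrow> m]"
    using subsequence_append[where i = k and j = "m - k" and w = x] k(2) by simp
  then have "outs T (prefix m x) q =
      outs T (prefix k x) q @ outs T (x [k \<rightarrow> m]) (steps T (prefix k x) q)"
    by (metis outs_append)
  then have "outs T (prefix m x) q ! i = outs T (prefix k x) q ! i"
    using k(1) by (simp add: nth_append)
  then show ?thesis by (simp add: state_map_def k_def)
qed

lemma state_map_conc:
  assumes T: "is_transducer n T" and q: "q \<in> St T" and w: "w \<in> lists {..<n}"
    and x: "x \<in> inf_words n"
  shows "state_map T q (w \<frown> x) = outs T w q \<frown> state_map T (steps T w q) x"
proof
  fix i
  have wx: "w \<frown> x \<in> inf_words n" using inf_words_conc w x by blast
  obtain m where m: "m \<ge> length w" "i < length (outs T (prefix m (w \<frown> x)) q)"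
    using outs_prefix_unbounded[OF T q wx] by blast
  have p: "outs T (prefix m (w \<frown> x)) q =
      outs T w q @ outs T (prefix (m - length w) x) (steps T w q)"
    using m(1) by simp
  show "state_map T q (w \<frown> x) i = (outs T w q \<frown> state_map T (steps T w q) x) i"
  proof (cases "i < length (outs T w q)")
    case True
    then show ?thesis using state_map_nth[OF m(2)] p by (simp add: nth_append)
  next
    case False
    then have "i - length (outs T w q) < length (outs T (prefix (m - length w) x) (steps T w q))"
      using m(2) p by auto
    from state_map_nth[OF this] show ?thesis
      using state_map_nth[OF m(2)] p False by (simp add: nth_append)
  qed
qed

lemma state_map_in_inf_words:
  assumes T: "is_transducer n T" and q: "q \<in> St T" and x: "x \<in> inf_words n"
  shows "state_map T q x \<in> inf_words n"
proof -
  have "state_map T q x i < n" for i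
  proof -
    obtain m where m: "i < length (outs T (prefix m x) q)"
      using outs_prefix_unbounded[OF T q x] by blast
    then show ?thesis
      using state_map_nth[OF m] outs_in_lists[OF T subsequence_in_lists[OF x] q, of 0 m]
      by (metis in_listsD lessThan_iff nth_mem)
  qed
  then show ?thesis by (auto simp: inf_words_def)
qed

lemma state_map_loop:
  assumes T: "is_transducer n T" and q: "q \<in> St T" and w: "w \<in> lists {..<n}" "w \<noteq> []"
    and loop: "steps T w q = q"
  shows "state_map T q (w\<^sup>\<omega>) = (outs T w q)\<^sup>\<omega>"
proof (rule conc_fixpoint_unique)
  show "outs T w q \<noteq> []" using outs_loop_not_Nil[OF T w(1) q w(2) loop] .
  show "state_map T q (w\<^sup>\<omega>) = outs T w q \<frown> state_map T q (w\<^sup>\<omega>)"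
    using state_map_conc[OF T q w(1) iter_in_inf_words[OF w]] loop iter_unroll'[OF w(2)] by simp
qed

text \<open>Arbitrarily long prefixes suffice, again because the outputs extend each other. This is
  the usual way to compute a \<open>state_map\<close>.\<close>

lemma state_map_cong:
  assumes T: "is_transducer n T" and q: "q \<in> St T" and x: "x \<in> inf_words n"
    and y: "\<And>m. \<exists>k\<ge>m. prefix (length (outs T (prefix k x) q)) y = outs T (prefix k x) q"
  shows "state_map T q x = y"
proof
  fix i
  obtain m where m: "i < length (outs T (prefix m x) q)"
    using outs_prefix_unbounded[OF T q x] by blast
  obtain k where k: "k \<ge> m" "prefix (length (outs T (prefix k x) q)) y = outs T (prefix k x) q"
    using y by blast
  have "prefix k x = prefix m x @ x [m \<rightarrow> k]"
    using subsequence_append[where i = m and j = "k - m" and w = x] k(1) by simp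
  then have ik: "i < length (outs T (prefix k x) q)"
    using m by (metis length_append outs_append trans_less_add1)
  then have "y i = outs T (prefix k x) q ! i"
    using k(2) subsequence_nth[of i "length (outs T (prefix k x) q)" 0 y] by simp
  then show "state_map T q x i = y i" using state_map_nth[OF ik] by simp
qed

lemma state_map_suffix:
  assumes T: "is_transducer n T" and q: "q \<in> St T" and x: "x \<in> inf_words n"
  shows "state_map T q x = outs T (prefix m x) q \<frown> state_map T (steps T (prefix m x) q) (suffix m x)"
  using state_map_conc[OF T q subsequence_in_lists[OF x] suffix_in_inf_words[OF x], of 0 m m]
  by simp

section \<open>Equivalence of states\<close>

lemma omega_equiv_refl: "omega_equiv n T q T q"
  by (simp add: omega_equiv_def)

lemma omega_equiv_sym: "omega_equiv n T p U q \<Longrightarrow> omega_equiv n U q T p"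
  by (simp add: omega_equiv_def)

lemma omega_equiv_trans: "omega_equiv n T p U q \<Longrightarrow> omega_equiv n U q V r \<Longrightarrow> omega_equiv n T p V r"
  by (simp add: omega_equiv_def)


section \<open>Incomplete response\<close>

lemma common_prefixes_Nil [simp]: "[] \<in> common_prefixes n T w q"
  by (simp add: common_prefixes_def)

lemma in_common_prefixes_iff:
  "u \<in> common_prefixes n T w q \<longleftrightarrow> (\<forall>x\<in>inf_words n. \<exists>y. state_map T q (w \<frown> x) = u \<frown> y)"
proof -
  have "prefix (length u) y = u \<longleftrightarrow> (\<exists>z. y = u \<frown> z)" for y
    by (metis prefix_conc_length prefix_suffix)
  then show ?thesis by (simp add: common_prefixes_def)
qed

lemma common_prefixes_same_length:
  assumes "n \<ge> 1" "u \<in> common_prefixes n T w q" "v \<in> common_prefixes n T w q"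
    "length u = length v"
  shows "u = v"
proof -
  have "prefix (length u) (state_map T q (w \<frown> (\<lambda>_. 0))) = u"
    "prefix (length v) (state_map T q (w \<frown> (\<lambda>_. 0))) = v"
    using assms(2,3) inf_words_nonempty[OF assms(1)] unfolding common_prefixes_def by blast+
  then show ?thesis using assms(4) by metis
qed

lemma complete_response_iff:
  "\<not> incomplete_response n T q \<longleftrightarrow> (\<forall>u\<in>common_prefixes n T [] q. u = [])"
proof -
  have "extent n T q = 0 \<longleftrightarrow> (\<forall>u\<in>common_prefixes n T [] q. enat (length u) = 0)"
    unfolding extent_def bot_enat_def[symmetric] by (rule SUP_bot_conv(1))
  then show ?thesis by (simp add: incomplete_response_def zero_enat_def)
qed

text \<open>The part by which the longer of \<open>c\<close> and \<open>d\<close> exceeds the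
  shorter is a common prefix of all outputs of one of the states. Complete response makes it
  empty.\<close>

lemma complete_response_conc_eq:
  assumes p: "\<not> incomplete_response n T p" and q: "\<not> incomplete_response n U q"
    and eq: "\<And>x. x \<in> inf_words n \<Longrightarrow> c \<frown> state_map T p x = d \<frown> state_map U q x"
    and n: "n \<ge> 1"
  shows "c = d \<and> omega_equiv n T p U q"
proof -
  have main: "c = d" if q: "\<not> incomplete_response n U q" and le: "length c \<ge> length d"
    and eq: "\<And>x. x \<in> inf_words n \<Longrightarrow> c \<frown> state_map T p x = d \<frown> state_map U q x"
    for c d T and U :: "'c transducer" and p :: 'd and q
  proof -
    have "\<exists>e. c = d @ e \<and> state_map U q x = e \<frown> state_map T p x" if "x \<in> inf_words n" for x
      using conc_left_cancel[OF le] eq[OF that] by metis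
    then obtain e where "c = d @ e" and "\<And>x. x \<in> inf_words n \<Longrightarrow> state_map U q x = e \<frown> state_map T p x"
      using inf_words_nonempty[OF n] by (metis same_append_eq)
    then have "e \<in> common_prefixes n U [] q" "c = d @ e" unfolding in_common_prefixes_iff by auto
    then show ?thesis using q complete_response_iff by fastforce
  qed
  have "c = d"
    using main[of U q d c T p] main[of T p c d U q] p q eq by (metis nat_le_linear)
  then show ?thesis using eq by (simp add: omega_equiv_def)
qed

lemma finite_extentE:
  assumes n: "n \<ge> 1" and fin: "extent n T q \<noteq> \<infinity>"
  shows "Lam n T [] q \<in> common_prefixes n T [] q \<and>
    (\<forall>v\<in>common_prefixes n T [] q. length v \<le> length (Lam n T [] q))"
proof -
  let ?P = "\<lambda>k. \<exists>u\<in>common_prefixes n T [] q. length u = k"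
  obtain b where b: "extent n T q = enat b" using fin by (cases "extent n T q") auto
  have "length u \<le> b" if "u \<in> common_prefixes n T [] q" for u
    using b SUP_upper[OF that, of "\<lambda>u. enat (length u)"] by (simp add: extent_def)
  then have bd: "\<forall>k. ?P k \<longrightarrow> k \<le> b" by blast
  have "?P 0" using common_prefixes_Nil by force
  then have g: "?P (Greatest ?P)" "\<And>k. ?P k \<Longrightarrow> k \<le> Greatest ?P"
    using GreatestI_nat[of ?P 0 b] Greatest_le_nat[of ?P _ b] bd by blast+
  obtain u where u: "u \<in> common_prefixes n T [] q" "length u = Greatest ?P" using g(1) by blast
  have max: "\<forall>v\<in>common_prefixes n T [] q. length v \<le> length u" using g(2) u(2) by auto
  have "Lam n T [] q = u"
    unfolding Lam_def
  proof (rule the_equality)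
    show "u \<in> common_prefixes n T [] q \<and> (\<forall>v\<in>common_prefixes n T [] q. length v \<le> length u)"
      using u max by blast
    fix v assume v: "v \<in> common_prefixes n T [] q \<and> (\<forall>w\<in>common_prefixes n T [] q. length w \<le> length v)"
    then have "length u \<le> length v" using u(1) by blast
    moreover have "length v \<le> length u" using v max by blast
    ultimately have "length v = length u" by simp
    then show "v = u" using common_prefixes_same_length[OF n, of v T "[]" q u] v u(1) by simp
  qed
  then show ?thesis using u(1) max by simp
qed

text \<open>All outputs after \<open>w\<close> begin with \<open>outs T w q\<close>, so a common
  prefix longer than that splits into it and a common prefix at the state reached.\<close>

lemma Lam_append:
  assumes T: "is_transducer n T" and n: "n \<ge> 1" and q: "q \<in> St T" and w: "w \<in> lists {..<n}"
    and fin: "extent n T (steps T w q) \<noteq> \<infinity>"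
  shows "Lam n T w q = outs T w q @ Lam n T [] (steps T w q)"
proof -
  let ?u = "outs T w q @ Lam n T [] (steps T w q)"
  have in_iff: "outs T w q @ u \<in> common_prefixes n T w q \<longleftrightarrow>
      u \<in> common_prefixes n T [] (steps T w q)" for u
    using state_map_conc[OF T q w] unfolding in_common_prefixes_iff
    by (simp flip: conc_conc)
  have max: "length v \<le> length ?u" if v: "v \<in> common_prefixes n T w q" for v
  proof (cases "length v \<le> length (outs T w q)")
    case False
    have "\<exists>y. outs T w q \<frown> state_map T (steps T w q) x = v \<frown> y" if "x \<in> inf_words n" for x
      using v that state_map_conc[OF T q w that] unfolding in_common_prefixes_iff by metis
    then obtain v' where "v = outs T w q @ v'"
      using inf_words_nonempty[OF n] conc_left_cancel False by (metis nat_le_linear)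
    then show ?thesis using v in_iff finite_extentE[OF n fin] by auto
  qed simp
  have u: "?u \<in> common_prefixes n T w q" using in_iff finite_extentE[OF n fin] by blast
  show ?thesis
    unfolding Lam_def[of n T w q]
  proof (rule the_equality)
    show "?u \<in> common_prefixes n T w q \<and> (\<forall>v\<in>common_prefixes n T w q. length v \<le> length ?u)"
      using u max by blast
    fix v assume v: "v \<in> common_prefixes n T w q \<and> (\<forall>w'\<in>common_prefixes n T w q. length w' \<le> length v)"
    then have "length ?u \<le> length v" using u by blast
    moreover have "length v \<le> length ?u" using v max by blast
    ultimately have "length v = length ?u" by simp
    then show "v = ?u" using common_prefixes_same_length[OF n, of v T w q ?u] v u by simp
  qed
qed


section \<open>Synchronization and cyclic images\<close>

lemma take_in_lists: "w \<in> lists A \<Longrightarrow> take k w \<in> lists A"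
  by (metis append_in_lists_conv append_take_drop_id)

lemma drop_in_lists: "w \<in> lists A \<Longrightarrow> drop k w \<in> lists A"
  by (metis append_in_lists_conv append_take_drop_id)

lemma sync_levelD:
  assumes k: "sync_level n T k" and w: "w \<in> lists {..<n}" "k \<le> length w"
    and pq: "p \<in> St T" "q \<in> St T"
  shows "steps T w p = steps T w q"
proof -
  have "take k w \<in> words_of_length n k"
    unfolding words_of_length_def using take_in_lists[OF w(1)] w(2) by simp
  then have "steps T (take k w) p = steps T (take k w) q"
    using k pq unfolding sync_level_def by blast
  then show ?thesis
    by (metis append_take_drop_id steps_append)
qed

lemma sync_level_mono: "sync_level n T k \<Longrightarrow> k \<le> l \<Longrightarrow> sync_level n T l"
  unfolding sync_level_def[of n T l] words_of_length_def
  by (intro ballI sync_levelD[of n T k]) auto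

lemma sync_steps_wpow:
  assumes k: "sync_level n T k" and w: "w \<in> lists {..<n}" "w \<noteq> []"
    and pq: "p \<in> St T" "q \<in> St T" and loop: "steps T w q = q"
  shows "steps T (wpow w k) p = q"
proof -
  have "length w \<ge> 1" using w(2) by (cases w) auto
  then have "k \<le> length (wpow w k)" by simp
  then have "steps T (wpow w k) p = steps T (wpow w k) q"
    using sync_levelD[OF k wpow_in_lists[OF w(1)] _ pq] by blast
  then show ?thesis using steps_loop_wpow[OF loop] by simp
qed

text \<open>\<open>wpow w k\<close> is long enough to force a state. As it commutes with
  \<open>w\<close>, that state is fixed by \<open>w\<close>, and any other state fixed by
  \<open>w\<close> would be forced by the same power.\<close>

lemma loop_state_exists:
  assumes T: "is_transducer n T" "strongly_synchronizing n T" and w: "w \<in> lists {..<n}" "w \<noteq> []"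
  shows "loop_state T w \<in> St T \<and> steps T w (loop_state T w) = loop_state T w"
proof -
  obtain k where k: "sync_level n T k" using T(2) by (auto simp: strongly_synchronizing_def)
  obtain p where p: "p \<in> St T" using St_nonempty[OF T(1)] by blast
  define q where "q = steps T (wpow w k) p"
  have "length w \<ge> 1" using w(2) by (cases w) auto
  then have kl: "k \<le> length (wpow w k)" by simp
  have "steps T w q = steps T (wpow w k @ w) p" by (simp add: q_def)
  also have "\<dots> = steps T (w @ wpow w k) p" using wpow_Suc_right[of w k] by simp
  also have "\<dots> = q"
    using sync_levelD[OF k wpow_in_lists[OF w(1)] kl steps_in_St[OF T(1) w(1) p] p]
    by (simp add: q_def)
  finally have q: "steps T w q = q" .
  have qS: "q \<in> St T" using steps_in_St[OF T(1) wpow_in_lists[OF w(1)] p] by (simp add: q_def)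
  show ?thesis
    unfolding loop_state_def
  proof (rule theI)
    show "q \<in> St T \<and> steps T w q = q" using q qS by blast
    fix r assume "r \<in> St T \<and> steps T w r = r"
    then show "r = q" using sync_steps_wpow[OF k w, of r r] sync_steps_wpow[OF k w, of r q] q qS by simp
  qed
qed

lemma loop_state_unique:
  assumes T: "is_transducer n T" "strongly_synchronizing n T" and w: "w \<in> lists {..<n}" "w \<noteq> []"
    and q: "q \<in> St T" "steps T w q = q"
  shows "loop_state T w = q"
proof -
  obtain k where k: "sync_level n T k" using T(2) by (auto simp: strongly_synchronizing_def)
  show ?thesis
    using loop_state_exists[OF T w] sync_steps_wpow[OF k w q(1)] q by metis
qed

lemma cyclic_image_eq:
  assumes "is_transducer n T" "strongly_synchronizing n T" "w \<in> lists {..<n}" "w \<noteq> []"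
    "q \<in> St T" "steps T w q = q"
  shows "cyclic_image T w = rotations (prime_root (outs T w q))"
  using loop_state_unique[OF assms] by (simp add: cyclic_image_def)

lemma cyclic_image_rotations:
  assumes T: "is_transducer n T" "strongly_synchronizing n T" and w: "w \<in> lists {..<n}" "w \<noteq> []"
    and v: "v \<in> rotations w"
  shows "cyclic_image T v = cyclic_image T w"
proof -
  obtain s t where st: "w = s @ t" "v = t @ s" using v by (auto simp: rotations_iff)
  define q where "q = loop_state T w"
  have q: "q \<in> St T" "steps T w q = q" using loop_state_exists[OF T w] by (simp_all add: q_def)
  define r where "r = steps T s q"
  have st_lists: "s \<in> lists {..<n}" "v \<in> lists {..<n}" "v \<noteq> []" using w st by auto
  have r: "r \<in> St T" "steps T v r = r"
    using steps_in_St[OF T(1) st_lists(1) q(1)] q(2) st by (simp_all add: r_def)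
  have "outs T v r \<in> rotations (outs T w q)"
    using q(2) st by (auto simp: rotations_iff r_def)
  then have "rotations (prime_root (outs T v r)) = rotations (prime_root (outs T w q))"
    using rotations_prime_root_cong outs_loop_not_Nil[OF T(1) w(1) q(1) w(2) q(2)] by blast
  then show ?thesis
    using cyclic_image_eq[OF T w q] cyclic_image_eq[OF T st_lists(2,3) r] by simp
qed

lemma cyclic_image_wpow:
  assumes T: "is_transducer n T" "strongly_synchronizing n T" and w: "w \<in> lists {..<n}" "w \<noteq> []"
    and k: "k \<ge> 1"
  shows "cyclic_image T (wpow w k) = cyclic_image T w"
proof -
  define q where "q = loop_state T w"
  have q: "q \<in> St T" "steps T w q = q" using loop_state_exists[OF T w] by (simp_all add: q_def)
  have "outs T w q \<noteq> []" using outs_loop_not_Nil[OF T(1) w(1) q(1) w(2) q(2)] .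
  then have "prime_root (outs T (wpow w k) q) = prime_root (outs T w q)"
    using prime_root_of_wpow[OF _ k] outs_loop_wpow[OF q(2)] by metis
  moreover have "wpow w k \<noteq> []" using w(2) k by (simp add: wpow_eq_Nil_iff)
  ultimately show ?thesis
    using cyclic_image_eq[OF T w q]
      cyclic_image_eq[OF T wpow_in_lists[OF w(1)] _ q(1) steps_loop_wpow[OF q(2)]] by metis
qed

lemma cyclic_image_prime_root:
  assumes T: "is_transducer n T" "strongly_synchronizing n T" and w: "w \<in> lists {..<n}" "w \<noteq> []"
  shows "cyclic_image T (prime_root w) = cyclic_image T w"
proof -
  obtain s where s: "prime_word (prime_root w)" "s \<ge> 1" "w = wpow (prime_root w) s"
    using prime_rootE[OF w(2)] by metis
  show ?thesis
    using cyclic_image_wpow[OF T prime_root_in_lists[OF w(2,1)] prime_word_not_Nil[OF s(1)] s(2)]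
      s(3) by simp
qed

lemma rotations_in_prime_cyclic_words:
  "w \<in> lists {..<n} \<Longrightarrow> w \<noteq> [] \<Longrightarrow> rotations (prime_root w) \<in> prime_cyclic_words n"
  unfolding prime_cyclic_words_def using prime_root_in_lists prime_rootE[of w] by blast

lemma cyclic_image_in_prime_cyclic_words:
  assumes T: "is_transducer n T" "strongly_synchronizing n T" and w: "w \<in> lists {..<n}" "w \<noteq> []"
  shows "cyclic_image T w \<in> prime_cyclic_words n"
proof -
  define q where "q = loop_state T w"
  have q: "q \<in> St T" "steps T w q = q" using loop_state_exists[OF T w] by (simp_all add: q_def)
  show ?thesis
    unfolding cyclic_image_eq[OF T w q]
    using rotations_in_prime_cyclic_words outs_in_lists[OF T(1) w(1) q(1)]
      outs_loop_not_Nil[OF T(1) w(1) q(1) w(2) q(2)] by blast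
qed

lemma state_map_eventually_loop:
  assumes T: "is_transducer n T" "strongly_synchronizing n T" and w: "w \<in> lists {..<n}" "w \<noteq> []"
    and p: "p \<in> St T"
  shows "\<exists>u. state_map T p (w\<^sup>\<omega>) = u \<frown> (outs T w (loop_state T w))\<^sup>\<omega>"
proof -
  obtain k where k: "sync_level n T k" using T(2) by (auto simp: strongly_synchronizing_def)
  note q = loop_state_exists[OF T w]
  have "state_map T p (w\<^sup>\<omega>) = state_map T p (wpow w k \<frown> w\<^sup>\<omega>)"
    by (simp only: wpow_conc_iter[OF w(2)])
  also have "\<dots> = outs T (wpow w k) p \<frown> state_map T (steps T (wpow w k) p) (w\<^sup>\<omega>)"
    by (rule state_map_conc[OF T(1) p wpow_in_lists[OF w(1)] iter_in_inf_words[OF w]])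
  also have "steps T (wpow w k) p = loop_state T w"
    using sync_steps_wpow[OF k w p] q by blast
  finally show ?thesis using state_map_loop[OF T(1) _ w, of "loop_state T w"] q by metis
qed

text \<open>On the periodic input built from \<open>w\<close> both outputs end in the infinite power
  of the respective loop output, and finite prefixes, even ones depending on the input, do not
  change the period.\<close>

lemma cyclic_image_cong:
  assumes T: "is_transducer n T" "strongly_synchronizing n T"
    and U: "is_transducer n U" "strongly_synchronizing n U"
    and w: "w \<in> lists {..<n}" "w \<noteq> []" and p: "p \<in> St T" and q: "q \<in> St U"
    and eq: "\<And>x. x \<in> inf_words n \<Longrightarrow> \<exists>c d. c \<frown> state_map T p x = d \<frown> state_map U q x"
  shows "cyclic_image T w = cyclic_image U w"
proof -
  obtain c d where cd: "c \<frown> state_map T p (w\<^sup>\<omega>) = d \<frown> state_map U q (w\<^sup>\<omega>)"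
    using eq[OF iter_in_inf_words[OF w]] by blast
  obtain u where u: "state_map T p (w\<^sup>\<omega>) = u \<frown> (outs T w (loop_state T w))\<^sup>\<omega>"
    using state_map_eventually_loop[OF T w p] by blast
  obtain v where v: "state_map U q (w\<^sup>\<omega>) = v \<frown> (outs U w (loop_state U w))\<^sup>\<omega>"
    using state_map_eventually_loop[OF U w q] by blast
  have "(c @ u) \<frown> (outs T w (loop_state T w))\<^sup>\<omega> = (d @ v) \<frown> (outs U w (loop_state U w))\<^sup>\<omega>"
    using cd u v by simp
  moreover have "outs T w (loop_state T w) \<noteq> []" "outs U w (loop_state U w) \<noteq> []"
    using outs_loop_not_Nil[OF T(1) w(1) _ w(2)] loop_state_exists[OF T w]
      outs_loop_not_Nil[OF U(1) w(1) _ w(2)] loop_state_exists[OF U w] by blast+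
  ultimately show ?thesis
    using conc_iter_eq_rotations unfolding cyclic_image_def by blast
qed


section \<open>Core and product\<close>

lemma steps_St_update [simp]: "steps (T\<lparr>St := S\<rparr>) w q = steps T w q"
  by (induction w arbitrary: q) auto

lemma outs_St_update [simp]: "outs (T\<lparr>St := S\<rparr>) w q = outs T w q"
  by (induction w arbitrary: q) auto

lemma steps_core [simp]: "steps (core n T) w q = steps T w q"
  by (simp add: core_def)

lemma outs_core [simp]: "outs (core n T) w q = outs T w q"
  by (simp add: core_def)

lemma St_core: "St (core n T) = {steps T w q | k w q.
    sync_level n T k \<and> w \<in> words_of_length n k \<and> q \<in> St T}"
  by (simp add: core_def)

lemma core_subset: "is_transducer n T \<Longrightarrow> St (core n T) \<subseteq> St T"
  using steps_in_St[of n T] unfolding St_core words_of_length_def by blast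

lemma words_of_length_nonempty: "n \<ge> 1 \<Longrightarrow> replicate k 0 \<in> words_of_length n k"
  by (auto simp: words_of_length_def)

lemma is_core_iff: "is_core n T \<longleftrightarrow> St (core n T) = St T"
proof -
  have "core n T = T\<lparr>St := St (core n T)\<rparr>" by (simp add: core_def)
  then show ?thesis unfolding is_core_def
    by (metis (no_types, lifting) surjective transducer.cases_scheme transducer.update_convs(1) transducer.select_convs(1))
qed

lemma core_steps_closed:
  assumes q: "q \<in> St (core n T)" and a: "w \<in> lists {..<n}"
  shows "steps T w q \<in> St (core n T)"
proof -
  obtain k v p where v: "q = steps T v p" "sync_level n T k" "v \<in> words_of_length n k" "p \<in> St T"
    using q by (auto simp: St_core)
  have "steps T w q = steps T (v @ w) p" using v by simp
  moreover have "sync_level n T (k + length w)" using sync_level_mono[OF v(2)] by simp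
  moreover have "v @ w \<in> words_of_length n (k + length w)" using v a by (simp add: words_of_length_def)
  ultimately show ?thesis using v(4) unfolding St_core by blast
qed

lemma core_nonempty:
  assumes T: "is_transducer n T" "strongly_synchronizing n T" and n: "n \<ge> 1"
  shows "St (core n T) \<noteq> {}"
  using St_nonempty[OF T(1)] T(2) words_of_length_nonempty[OF n]
  by (fastforce simp: St_core strongly_synchronizing_def)

lemma core_is_transducer:
  assumes T: "is_transducer n T" "strongly_synchronizing n T" and n: "n \<ge> 1"
  shows "is_transducer n (core n T)"
  unfolding is_transducer_def
proof (intro conjI allI ballI impI)
  show "finite (St (core n T))" using core_subset[OF T(1)] finite_St[OF T(1)] finite_subset by blast
  show "St (core n T) \<noteq> {}" by (rule core_nonempty[OF assms])
  fix a q assume aq: "a < n" "q \<in> St (core n T)"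
  then have qT: "q \<in> St T" using core_subset[OF T(1)] by blast
  show "step (core n T) a q \<in> St (core n T)"
    using core_steps_closed[OF aq(2), of "[a]"] aq(1) by (simp add: core_def)
  show "out (core n T) a q \<in> lists {..<n}"
    using T(1) aq(1) qT by (simp add: core_def is_transducer_def)
next
  fix w q assume "w \<in> lists {..<n}" "q \<in> St (core n T)" "w \<noteq> []" "steps (core n T) w q = q"
  then show "outs (core n T) w q \<noteq> []"
    using outs_loop_not_Nil[OF T(1)] core_subset[OF T(1)] by auto
qed

lemma core_sync:
  assumes T: "is_transducer n T" "strongly_synchronizing n T"
  shows "strongly_synchronizing n (core n T)"
  using T(2) core_subset[OF T(1)] unfolding strongly_synchronizing_def sync_level_def
  by (metis steps_core subsetD)

text \<open>A forcing word forces the same state when the run starts inside the core, so every state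
  of the core is forced again there.\<close>

lemma core_is_core:
  assumes T: "is_transducer n T" "strongly_synchronizing n T" and n: "n \<ge> 1"
  shows "is_core n (core n T)"
  unfolding is_core_iff
proof
  show "St (core n (core n T)) \<subseteq> St (core n T)"
    by (rule core_subset[OF core_is_transducer[OF assms]])
  show "St (core n T) \<subseteq> St (core n (core n T))"
  proof
    fix q assume "q \<in> St (core n T)"
    then obtain k v p where v: "q = steps T v p" "sync_level n T k" "v \<in> words_of_length n k"
      "p \<in> St T"
      by (auto simp: St_core)
    obtain r where r: "r \<in> St (core n T)" using core_nonempty[OF assms] by blast
    then have "r \<in> St T" using core_subset[OF T(1)] by blast
    then have "q = steps T v r"
      using v(2-4) unfolding v(1) sync_level_def by blast
    moreover have "sync_level n (core n T) k"
      using v(2) core_subset[OF T(1)] unfolding sync_level_def steps_core by blast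
    ultimately show "q \<in> St (core n (core n T))"
      using v(3) r unfolding St_core[of n "core n T"] steps_core by blast
  qed
qed

lemma cyclic_image_core:
  assumes T: "is_transducer n T" "strongly_synchronizing n T" and n: "n \<ge> 1"
    and w: "w \<in> lists {..<n}" "w \<noteq> []"
  shows "cyclic_image (core n T) w = cyclic_image T w"
proof -
  let ?C = "core n T"
  have C: "is_transducer n ?C" "strongly_synchronizing n ?C"
    using core_is_transducer core_sync assms by blast+
  define q where "q = loop_state ?C w"
  have q: "q \<in> St ?C" "steps T w q = q" using loop_state_exists[OF C w] by (simp_all add: q_def)
  then show ?thesis
    using cyclic_image_eq[OF C w q(1)] cyclic_image_eq[OF T w _ q(2)] core_subset[OF T(1)] by auto
qed

lemma forcing_word:
  assumes C: "is_core n C" and q: "q \<in> St C"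
  shows "\<exists>k. \<exists>w\<in>words_of_length n k. sync_level n C k \<and> (\<forall>p\<in>St C. steps C w p = q)"
proof -
  have "q \<in> St (core n C)" using C q is_core_iff by metis
  then obtain k w p
    where kwp: "q = steps C w p" "sync_level n C k" "w \<in> words_of_length n k" "p \<in> St C"
    unfolding St_core by blast
  then have "\<forall>p'\<in>St C. steps C w p' = q" unfolding sync_level_def by blast
  then show ?thesis using kwp by blast
qed

lemma core_strongly_connected:
  assumes "is_core n C"
  shows "strongly_connected n C"
  unfolding strongly_connected_def
proof (intro ballI)
  fix p q assume "p \<in> St C" "q \<in> St C"
  then obtain k w where "w \<in> words_of_length n k" "steps C w p = q"
    using forcing_word[OF assms] by blast
  then show "\<exists>w\<in>lists {..<n}. steps C w p = q" by (auto simp: words_of_length_def)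
qed

section \<open>Products\<close>

lemma St_transducer_prod: "St (transducer_prod T U) = St T \<times> St U"
  by (simp add: transducer_prod_def)

lemma steps_transducer_prod:
  "steps (transducer_prod T U) w (p, q) = (steps T w p, steps U (outs T w p) q)"
  by (induction w arbitrary: p q) (auto simp: transducer_prod_def)

lemma outs_transducer_prod:
  "outs (transducer_prod T U) w (p, q) = outs U (outs T w p) q"
  by (induction w arbitrary: p q) (auto simp: transducer_prod_def)

lemma prod_is_transducer:
  assumes T: "is_transducer n T" and U: "is_transducer n U"
  shows "is_transducer n (transducer_prod T U)"
  unfolding is_transducer_def St_transducer_prod
proof (intro conjI allI ballI impI)
  show "finite (St T \<times> St U)" "St T \<times> St U \<noteq> {}"
    using finite_St[OF T] finite_St[OF U] St_nonempty[OF T] St_nonempty[OF U] by auto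
  fix a r assume ar: "a < n" "r \<in> St T \<times> St U"
  obtain p q where r: "r = (p, q)" by force
  have a: "[a] \<in> lists {..<n}" using ar by simp
  note o = outs_in_lists[OF T a, of p]
  show "step (transducer_prod T U) a r \<in> St T \<times> St U"
    using steps_in_St[OF T a, of p] steps_in_St[OF U o, of q] ar r by (simp add: transducer_prod_def)
  show "out (transducer_prod T U) a r \<in> lists {..<n}"
    using outs_in_lists[OF U o, of q] ar r by (simp add: transducer_prod_def)
next
  fix w r assume w: "w \<in> lists {..<n}" "r \<in> St T \<times> St U" "w \<noteq> []" "steps (transducer_prod T U) w r = r"
  obtain p q where r: "r = (p, q)" by force
  have p: "p \<in> St T" "steps T w p = p" and q: "q \<in> St U" "steps U (outs T w p) q = q"
    using w r by (auto simp: steps_transducer_prod)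
  have "outs T w p \<noteq> []" using outs_loop_not_Nil[OF T w(1) p(1) w(3) p(2)] .
  then show "outs (transducer_prod T U) w r \<noteq> []"
    using outs_loop_not_Nil[OF U outs_in_lists[OF T w(1) p(1)] q(1) _ q(2)]
    by (simp add: r outs_transducer_prod)
qed

lemma prod_sync:
  assumes T: "is_transducer n T" "strongly_synchronizing n T"
    and U: "is_transducer n U" "strongly_synchronizing n U"
  shows "strongly_synchronizing n (transducer_prod T U)"
proof -
  obtain k where k: "sync_level n T k" using T(2) by (auto simp: strongly_synchronizing_def)
  obtain l where l: "sync_level n U l" using U(2) by (auto simp: strongly_synchronizing_def)
  \<comment> \<open>After \<open>k\<close> letters the first factor is in a known state. During
    \<open>m\<close> further letters it outputs at least \<open>l\<close> letters, and these force
    the state of the second factor.\<close>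
  define m where "m = l * card (St T)"
  have forced: "steps U (outs T w p) q = steps U (outs T w p') q' \<and> steps T w p = steps T w p'"
    if w: "w \<in> words_of_length n (k + m)" and p: "p \<in> St T" "p' \<in> St T" and q: "q \<in> St U" "q' \<in> St U"
    for w p p' q q'
  proof -
    define u where "u = take k w"
    define v where "v = drop k w"
    have w_uv: "w = u @ v" by (simp add: u_def v_def)
    have uv: "u \<in> lists {..<n}" "v \<in> lists {..<n}" "length u = k" "length v = m"
      using w take_in_lists[of w] drop_in_lists[of w]
      by (simp_all add: words_of_length_def u_def v_def)
    have steps_u: "steps T u p = steps T u p'" using sync_levelD[OF k uv(1) _ p] uv by simp
    define r where "r = steps T u p"
    have r: "r \<in> St T" using steps_in_St[OF T(1) uv(1) p(1)] by (simp add: r_def)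
    have "l \<le> length (outs T v r)" using length_outs_ge[OF T(1) uv(2) _ r] uv(4) by (simp add: m_def)
    then have "steps U (outs T v r) (steps U (outs T u p) q) =
        steps U (outs T v r) (steps U (outs T u p') q')"
      by (rule sync_levelD[OF l outs_in_lists[OF T(1) uv(2) r]])
        (intro steps_in_St[OF U(1)] outs_in_lists[OF T(1) uv(1)] p q)+
    then show ?thesis using steps_u by (simp add: w_uv r_def)
  qed
  have "sync_level n (transducer_prod T U) (k + m)"
    unfolding sync_level_def St_transducer_prod
  proof (intro ballI)
    fix w r r' assume w: "w \<in> words_of_length n (k + m)" "r \<in> St T \<times> St U" "r' \<in> St T \<times> St U"
    obtain p q p' q' where r: "r = (p, q)" "r' = (p', q')" by force
    show "steps (transducer_prod T U) w r = steps (transducer_prod T U) w r'"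
      unfolding r steps_transducer_prod prod.inject using forced[OF w(1)] w(2,3) r by blast
  qed
  then show ?thesis by (auto simp: strongly_synchronizing_def)
qed

text \<open>The second factor reads the loop output of the first, which is a power of a rotation of
  \<open>v\<close>. Neither powers nor rotations affect a cyclic image.\<close>

lemma cyclic_image_prod:
  assumes T: "is_transducer n T" "strongly_synchronizing n T"
    and U: "is_transducer n U" "strongly_synchronizing n U"
    and w: "w \<in> lists {..<n}" "w \<noteq> []" and v: "v \<in> cyclic_image T w"
  shows "cyclic_image (transducer_prod T U) w = cyclic_image U v"
proof -
  define p where "p = loop_state T w"
  have p: "p \<in> St T" "steps T w p = p" using loop_state_exists[OF T w] by (simp_all add: p_def)
  define u where "u = outs T w p"
  have u: "u \<in> lists {..<n}" "u \<noteq> []"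
    using outs_in_lists[OF T(1) w(1) p(1)] outs_loop_not_Nil[OF T(1) w(1) p(1) w(2) p(2)]
    by (simp_all add: u_def)
  define q where "q = loop_state U u"
  have q: "q \<in> St U" "steps U u q = q" using loop_state_exists[OF U u] by (simp_all add: q_def)
  have pu: "prime_root u \<in> lists {..<n}" "prime_root u \<noteq> []"
    using prime_root_in_lists[OF u(2,1)] prime_rootE[OF u(2)] prime_word_not_Nil by metis+
  have "cyclic_image (transducer_prod T U) w = rotations (prime_root (outs U u q))"
    using cyclic_image_eq[OF prod_is_transducer[OF T(1) U(1)] prod_sync[OF T U] w, of "(p, q)"] p q
    by (simp add: St_transducer_prod steps_transducer_prod outs_transducer_prod u_def)
  also have "\<dots> = cyclic_image U u" using cyclic_image_eq[OF U u q] by simp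
  also have "\<dots> = cyclic_image U (prime_root u)" using cyclic_image_prime_root[OF U u] by simp
  also have "\<dots> = cyclic_image U v"
    by (rule cyclic_image_rotations[OF U pu, symmetric])
      (use v in \<open>simp add: cyclic_image_def u_def p_def\<close>)
  finally show ?thesis .
qed


section \<open>Cyclic images determine minimal transducers\<close>

lemma Z_transducer_runs:
  assumes "St T = {s}" "\<forall>a<n. step T a s = s \<and> out T a s = x" "w \<in> lists {..<n}"
  shows "steps T w s = s \<and> outs T w s = wpow x (length w)"
  using assms(3) by (induction w) (use assms(2) in auto)

lemma state_map_Z_transducer:
  assumes T: "is_transducer n T" and Z: "is_Z_transducer n x T" and n: "n \<ge> 1"
    and q: "q \<in> St T" and z: "z \<in> inf_words n"
  shows "state_map T q z = x\<^sup>\<omega>"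
proof -
  have s: "St T = {q}" "\<forall>a<n. step T a q = q \<and> out T a q = x"
    using Z q by (auto simp: is_Z_transducer_def)
  note runs = Z_transducer_runs[OF s]
  have "[0] \<in> lists {..<n}" using n by simp
  then have "x \<noteq> []" using outs_loop_not_Nil[OF T _ q, of "[0]"] s(2) n by simp
  show ?thesis
  proof (rule state_map_cong[OF T q z])
    fix m
    have "outs T (prefix m z) q = wpow x m" using runs[OF subsequence_in_lists[OF z, of 0 m]] by simp
    then show "\<exists>k\<ge>m. prefix (length (outs T (prefix k z) q)) (x\<^sup>\<omega>) = outs T (prefix k z) q"
      using prefix_iter[OF \<open>x \<noteq> []\<close>, of m] by auto
  qed
qed

lemma Z_transducer_incomplete:
  assumes T: "is_transducer n T" and Z: "is_Z_transducer n x T" and n: "n \<ge> 1" and q: "q \<in> St T"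
  shows "incomplete_response n T q"
proof -
  have s: "St T = {q}" "\<forall>a<n. step T a q = q \<and> out T a q = x"
    using Z q by (auto simp: is_Z_transducer_def)
  have "[0] \<in> lists {..<n}" using n by simp
  then have x: "x \<noteq> []"
    using outs_loop_not_Nil[OF T _ q, of "[0]"] s(2) n by simp
  have "x \<in> common_prefixes n T [] q"
    unfolding in_common_prefixes_iff
  proof
    fix z assume "z \<in> inf_words n"
    then have "state_map T q ([] \<frown> z) = x \<frown> x\<^sup>\<omega>"
      using state_map_Z_transducer[OF T Z n q] iter_unroll'[OF x] by simp
    then show "\<exists>y. state_map T q ([] \<frown> z) = x \<frown> y" by blast
  qed
  then show ?thesis using x complete_response_iff[of n T q] by blast
qed

text \<open>With equal cyclic images and complete response such pairs turn out to be
  omega-equivalent; they supply the bijection between two minimal transducers. A single word has to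
  force both states, so that it closes every run at either state into a loop.\<close>

definition jointly_forced :: "nat \<Rightarrow> 'p transducer \<Rightarrow> 'q transducer \<Rightarrow> 'p \<Rightarrow> 'q \<Rightarrow> bool" where
  "jointly_forced n T U p q \<longleftrightarrow> p \<in> St T \<and> q \<in> St U \<and> (\<exists>v\<in>lists {..<n}.
     (\<forall>r\<in>St T. steps T v r = p) \<and> (\<forall>r\<in>St U. steps U v r = q))"

lemma jointly_forced_sym: "jointly_forced n T U p q \<longleftrightarrow> jointly_forced n U T q p"
  by (auto simp: jointly_forced_def)

text \<open>A word forcing \<open>p\<close> still does so after any prefix. Zeros put in front make
  it long enough to synchronize \<open>U\<close> as well.\<close>

lemma jointly_forced_exists:
  assumes T: "is_transducer n T" "is_core n T" and U: "is_transducer n U" "strongly_synchronizing n U"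
    and n: "n \<ge> 1" and p: "p \<in> St T"
  shows "\<exists>q. jointly_forced n T U p q"
proof -
  obtain v where v: "v \<in> lists {..<n}" "\<forall>r\<in>St T. steps T v r = p"
    using forcing_word[OF T(2) p] by (auto simp: words_of_length_def)
  obtain l where l: "sync_level n U l" using U(2) by (auto simp: strongly_synchronizing_def)
  define w where "w = replicate l 0 @ v"
  have r0: "replicate l 0 \<in> lists {..<n}" using n by auto
  then have w: "w \<in> lists {..<n}" "l \<le> length w" using v(1) by (auto simp: w_def)
  obtain q0 where q0: "q0 \<in> St U" using St_nonempty[OF U(1)] by blast
  have "\<forall>r\<in>St U. steps U w r = steps U w q0" using sync_levelD[OF l w] q0 by blast
  moreover have "\<forall>r\<in>St T. steps T w r = p" using v steps_in_St[OF T(1) r0] by (simp add: w_def)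
  moreover have "steps U w q0 \<in> St U" using steps_in_St[OF U(1) w(1) q0] .
  ultimately show ?thesis using w(1) p unfolding jointly_forced_def by blast
qed

context
  fixes n :: nat and T :: "'p transducer" and U :: "'q transducer" and p q
  assumes n: "n \<ge> 1"
    and T: "is_transducer n T" "strongly_synchronizing n T"
    and U: "is_transducer n U" "strongly_synchronizing n U"
    and forced: "jointly_forced n T U p q"
    and same_image: "\<And>w. w \<in> lists {..<n} \<Longrightarrow> w \<noteq> [] \<Longrightarrow> cyclic_image T w = cyclic_image U w"
begin

definition joint_loops :: "nat list set" where
  "joint_loops = {w \<in> lists {..<n}. steps T w p = p \<and> steps U w q = q}"

lemma joint_states: "p \<in> St T" "q \<in> St U"
  using forced by (auto simp: jointly_forced_def)

lemma conjugate_root_homs: "conjugate_root_homs joint_loops (\<lambda>w. outs T w p) (\<lambda>w. outs U w q)"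
proof
  fix u assume u: "u \<in> joint_loops"
  then show "(outs T u p = []) = (u = [])" "(outs U u q = []) = (u = [])"
    using outs_loop_not_Nil[OF T(1)] outs_loop_not_Nil[OF U(1)] joint_states
    by (auto simp: joint_loops_def)
  assume "u \<noteq> []"
  then show "rotations (prime_root (outs T u p)) = rotations (prime_root (outs U u q))"
    using u same_image[of u] cyclic_image_eq[OF T, of u p] cyclic_image_eq[OF U, of u q] joint_states
    by (simp add: joint_loops_def)
qed (auto simp: joint_loops_def)

interpretation conjugate_root_homs joint_loops "\<lambda>w. outs T w p" "\<lambda>w. outs U w q"
  by (rule conjugate_root_homs)

text \<open>The word forcing both states leads back to them from anywhere. Hence the output on an
  arbitrary word is a prefix of the output on some joint loop.\<close>

lemma extend_to_joint_loop:
  "\<exists>v\<in>lists {..<n}. \<forall>u\<in>lists {..<n}. u @ v \<in> joint_loops"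
proof -
  obtain v where v: "v \<in> lists {..<n}" "\<forall>r\<in>St T. steps T v r = p" "\<forall>r\<in>St U. steps U v r = q"
    using forced by (auto simp: jointly_forced_def)
  have "u @ v \<in> joint_loops" if "u \<in> lists {..<n}" for u
    using v that steps_in_St[OF T(1) that joint_states(1)] steps_in_St[OF U(1) that joint_states(2)]
    by (simp add: joint_loops_def)
  then show ?thesis using v(1) by blast
qed

text \<open>Otherwise all outputs of joint loops are powers of one prime word \<open>d\<close>.
  Since every input prefix extends to a joint loop, each infinite output then begins with
  \<open>d\<close>, against complete response.\<close>

lemma noncommuting_loops:
  assumes "\<not> incomplete_response n T p"
  shows "\<exists>u\<in>joint_loops. \<exists>v\<in>joint_loops. outs T u p @ outs T v p \<noteq> outs T v p @ outs T u p"
proof (rule ccontr)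
  assume "\<not> ?thesis"
  then have comm: "outs T u p @ outs T v p = outs T v p @ outs T u p"
    if "u \<in> joint_loops" "v \<in> joint_loops" for u v
    using that by blast
  obtain v where v: "v \<in> lists {..<n}" "\<forall>u\<in>lists {..<n}. u @ v \<in> joint_loops"
    using extend_to_joint_loop by blast
  define w where "w = [0] @ v"
  have "[0] \<in> lists {..<n}" using n by simp
  then have w: "w \<in> joint_loops" "w \<noteq> []" using v(2) unfolding w_def by blast+
  define d where "d = prime_root (outs T w p)"
  have nN: "outs T w p \<noteq> []" using w f_eq_Nil by simp
  then obtain s where s: "prime_word d" "outs T w p = wpow d s"
    using prime_rootE d_def by metis
  have power: "\<exists>i. outs T u p = wpow d i" if "u \<in> joint_loops" for u
  proof (rule commute_prime[OF s(1)])
    show "outs T u p @ d = d @ outs T u p"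
      using commute_trans[OF nN comm[OF that w(1)], of d] s(2) commute_wpow[of d d s] by simp
  qed
  have "\<exists>y. state_map T p x = d \<frown> y" if x: "x \<in> inf_words n" for x
  proof -
    obtain m where m: "length d < length (outs T (prefix m x) p)"
      using outs_prefix_unbounded[OF T(1) joint_states(1) x] by blast
    have pm: "prefix m x \<in> lists {..<n}" using subsequence_in_lists[OF x] .
    then obtain i where i: "outs T (prefix m x @ v) p = wpow d i" using power v(2) by blast
    have "outs T (prefix m x) p @ outs T v (steps T (prefix m x) p) = wpow d i"
      using i by (simp only: outs_append)
    moreover have "i \<noteq> 0" using m calculation by (cases i) auto
    then obtain j where "i = Suc j" by (cases i) auto
    ultimately have "d @ wpow d j = outs T (prefix m x) p @ outs T v (steps T (prefix m x) p)"
      by simp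
    then obtain t where t: "outs T (prefix m x) p = d @ t"
      using append_prefix_unique m by (metis less_imp_le)
    then show ?thesis using state_map_suffix[OF T(1) joint_states(1) x, of m]
      by (metis conc_conc)
  qed
  then have "d \<in> common_prefixes n T [] p" by (simp add: in_common_prefixes_iff)
  then show False using assms complete_response_iff[of n T p] prime_word_not_Nil[OF s(1)] by auto
qed

text \<open>Each prefix of an input is closed to a joint loop by one fixed word, so
  \<open>aligned\<close> compares the outputs on that prefix; whatever is appended lies beyond the
  position compared. Complete response then cancels the leading words \<open>c\<close> and
  \<open>c'\<close>.\<close>

lemma forced_states_omega_equiv:
  assumes p: "\<not> incomplete_response n T p" and q: "\<not> incomplete_response n U q"
  shows "omega_equiv n T p U q"
proof -
  obtain u v where uv: "u \<in> joint_loops" "v \<in> joint_loops"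
    "outs T u p @ outs T v p \<noteq> outs T v p @ outs T u p"
    using noncommuting_loops[OF p] by blast
  obtain c d c' d' where cd: "\<forall>w\<in>joint_loops. c @ outs T w p @ d = c' @ outs U w q @ d'"
    using aligned[OF uv] by blast
  obtain v where v: "v \<in> lists {..<n}" "\<forall>u\<in>lists {..<n}. u @ v \<in> joint_loops"
    using extend_to_joint_loop by blast
  have "c \<frown> state_map T p x = c' \<frown> state_map U q x" if x: "x \<in> inf_words n" for x
  proof (rule ext)
    fix i
    obtain k where k: "i < length (outs T (prefix k x) p)"
      using outs_prefix_unbounded[OF T(1) joint_states(1) x] by blast
    obtain m where m: "m \<ge> k" "i < length (outs U (prefix m x) q)"
      using outs_prefix_unbounded[OF U(1) joint_states(2) x] by blast
    have "prefix m x = prefix k x @ x [k \<rightarrow> m]"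
      using subsequence_append[where i = k and j = "m - k" and w = x] m(1) by simp
    then have im: "i < length (outs T (prefix m x) p)"
      using k by (metis length_append outs_append trans_less_add1)
    have pm: "prefix m x \<in> lists {..<n}" using subsequence_in_lists[OF x] .
    have "c @ outs T (prefix m x @ v) p @ d = c' @ outs U (prefix m x @ v) q @ d'"
      using cd v(2) pm by blast
    then have eq: "(c @ outs T (prefix m x) p) @ outs T v (steps T (prefix m x) p) @ d =
        (c' @ outs U (prefix m x) q) @ outs U v (steps U (prefix m x) q) @ d'"
      by simp
    have nth: "(a \<frown> (o1 \<frown> z)) i = ((a @ o1) @ r) ! i" if "i < length o1" for a o1 z and r :: "nat list"
    proof -
      have "i - length a < length o1" using that by simp
      then show ?thesis by (simp add: nth_append conc_def)
    qed
    have "(c \<frown> state_map T p x) i = ((c @ outs T (prefix m x) p) @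
        outs T v (steps T (prefix m x) p) @ d) ! i"
      by (subst state_map_suffix[OF T(1) joint_states(1) x, of m]) (rule nth[OF im])
    moreover have "(c' \<frown> state_map U q x) i = ((c' @ outs U (prefix m x) q) @
        outs U v (steps U (prefix m x) q) @ d') ! i"
      by (subst state_map_suffix[OF U(1) joint_states(2) x, of m]) (rule nth[OF m(2)])
    ultimately show "(c \<frown> state_map T p x) i = (c' \<frown> state_map U q x) i" using eq by simp
  qed
  then show ?thesis using complete_response_conc_eq[OF p q _ n] by blast
qed

text \<open>A transducer with constant output yields powers of one word on all loops, and these
  commute, while loops with complete response have noncommuting outputs on both sides.\<close>

lemma complete_not_Z:
  assumes p: "\<not> incomplete_response n T p"
  shows "\<not> is_Z_transducer n x U"
proof
  assume "is_Z_transducer n x U"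
  then have s: "St U = {q}" "\<forall>a<n. step U a q = q \<and> out U a q = x"
    using joint_states by (auto simp: is_Z_transducer_def)
  obtain u v where uv: "u \<in> joint_loops" "v \<in> joint_loops"
    "outs T u p @ outs T v p \<noteq> outs T v p @ outs T u p"
    using noncommuting_loops[OF p] by blast
  have "outs U u q = wpow x (length u)" "outs U v q = wpow x (length v)"
    using Z_transducer_runs[OF s] uv by (auto simp: joint_loops_def)
  then show False using noncommuting_length(1)[OF uv] wpow_commute by metis
qed

end

lemma least_prime_word_unique:
  assumes "least_prime_word n x" "least_prime_word n y" "rotations x = rotations y"
  shows "x = y"
proof (rule ccontr)
  assume "x \<noteq> y"
  have "y \<in> rotations x" "x \<in> rotations y"
    using assms(3) self_in_rotations[of x] self_in_rotations[of y] by metis+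
  then have "(x, y) \<in> lexord less_than" "(y, x) \<in> lexord less_than"
    using assms(1,2) \<open>x \<noteq> y\<close> unfolding least_prime_word_def by metis+
  moreover have "asym less_than" by (auto intro: asymI)
  ultimately show False using lexord_asym by (meson asymD)
qed

lemma transducer_eq_if_same_cyclic_image:
  assumes n: "n \<ge> 1" and T: "M_transducer n T" and U: "M_transducer n U"
    and same: "\<And>w. w \<in> lists {..<n} \<Longrightarrow> w \<noteq> [] \<Longrightarrow> cyclic_image T w = cyclic_image U w"
  shows "transducer_eq n T U"
proof -
  have tT: "is_transducer n T" "strongly_synchronizing n T" "is_core n T" "minimal_transducer n T"
    and tU: "is_transducer n U" "strongly_synchronizing n U" "is_core n U" "minimal_transducer n U"
    using T U by (auto simp: M_transducer_def minimal_transducer_def)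
  have rT: "\<exists>q. jointly_forced n T U p q" if "p \<in> St T" for p
    by (rule jointly_forced_exists[OF tT(1,3) tU(1,2) n that])
  have rU: "\<exists>p. jointly_forced n T U p q" if "q \<in> St U" for q
    using jointly_forced_exists[OF tU(1,3) tT(1,2) n that] jointly_forced_sym by metis
  note not_Z = complete_not_Z[OF n tT(1,2) tU(1,2) _ same]
  have not_Z': "\<not> is_Z_transducer n x T" if "jointly_forced n T U p q" "\<not> incomplete_response n U q" for x p q
    using complete_not_Z[OF n tU(1,2) tT(1,2) _ same[symmetric]] that jointly_forced_sym by metis
  obtain p0 where "p0 \<in> St T" using St_nonempty[OF tT(1)] by blast
  then obtain q0 where pq0: "jointly_forced n T U p0 q0" using rT by blast
  then have pq0_St: "p0 \<in> St T" "q0 \<in> St U" by (simp_all add: jointly_forced_def)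
  consider "\<forall>p\<in>St T. \<not> incomplete_response n T p" "\<forall>p\<in>St U. \<not> incomplete_response n U p"
      "weakly_minimal n T" "weakly_minimal n U"
    | x y where "is_Z_transducer n x T" "is_Z_transducer n y U" "least_prime_word n x" "least_prime_word n y"
  proof -
    \<comment> \<open>The two mixed combinations of the alternatives in
      \<open>minimal_transducer\<close> are excluded by \<open>complete_not_Z\<close>, once in each
      direction.\<close>
    have "\<not> ((\<forall>p\<in>St T. \<not> incomplete_response n T p) \<and> is_Z_transducer n x U)" for x
      using not_Z[OF pq0] pq0_St by metis
    moreover have "\<not> ((\<forall>p\<in>St U. \<not> incomplete_response n U p) \<and> is_Z_transducer n x T)" for x
      using not_Z'[OF pq0] pq0_St by metis
    ultimately show ?thesis
      using that tT(4) tU(4) unfolding minimal_transducer_def by metis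
  qed
  then show ?thesis
  proof cases
    case 1
    have eqv: "omega_equiv n T p U q" if "jointly_forced n T U p q" for p q
    proof -
      have "p \<in> St T" "q \<in> St U" using that by (auto simp: jointly_forced_def)
      then show ?thesis using forced_states_omega_equiv[OF n tT(1,2) tU(1,2) that same] 1 by blast
    qed
    define f where "f p = (SOME q. jointly_forced n T U p q)" for p
    have f: "jointly_forced n T U p (f p)" if "p \<in> St T" for p
      unfolding f_def by (rule someI_ex) (rule rT[OF that])
    have fS: "f p \<in> St U" if "p \<in> St T" for p using f[OF that] by (simp add: jointly_forced_def)
    have "inj_on f (St T)"
    proof (rule inj_onI)
      fix p p' assume p: "p \<in> St T" "p' \<in> St T" "f p = f p'"
      then have "omega_equiv n T p T p'"
        using eqv[OF f] omega_equiv_sym omega_equiv_trans by metis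
      then show "p = p'" using 1(3) p by (auto simp: weakly_minimal_def)
    qed
    moreover have "St U \<subseteq> f ` St T"
    proof
      fix q assume q: "q \<in> St U"
      then obtain p where p: "jointly_forced n T U p q" using rU by blast
      then have pS: "p \<in> St T" by (simp add: jointly_forced_def)
      have "omega_equiv n U q U (f p)"
        using eqv[OF p] eqv[OF f[OF pS]] omega_equiv_sym omega_equiv_trans by metis
      then have "q = f p" using 1(4) q fS[OF pS] by (auto simp: weakly_minimal_def)
      then show "q \<in> f ` St T" using pS by blast
    qed
    ultimately have "bij_betw f (St T) (St U)" using fS by (auto simp: bij_betw_def)
    then show ?thesis unfolding transducer_eq_def using eqv[OF f] by blast
  next
    case 2
    \<comment> \<open>The cyclic image of a single letter is the rotation class of the constant
      output, and the least rotation is determined by its class.\<close>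
    have z: "[0] \<in> lists {..<n}" "[0] \<noteq> []" using n by auto
    have im: "cyclic_image V [0] = rotations x"
      if V: "is_transducer n V" "strongly_synchronizing n V" "is_Z_transducer n x V" "least_prime_word n x"
      for V :: "'c transducer" and x
    proof -
      obtain s where s: "St V = {s}" "\<forall>a<n. step V a s = s \<and> out V a s = x"
        using V by (auto simp: is_Z_transducer_def)
      show ?thesis
        using cyclic_image_eq[OF V(1,2) z, of s] s n V(4) prime_root_prime[of x]
        by (auto simp: least_prime_word_def)
    qed
    have "x = y"
      using least_prime_word_unique[OF 2(3,4)] im[OF tT(1,2) 2(1,3)] im[OF tU(1,2) 2(2,4)] same[OF z]
      by simp
    obtain s t where st: "St T = {s}" "St U = {t}" using 2 by (auto simp: is_Z_transducer_def)
    have "omega_equiv n T s U t"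
      unfolding omega_equiv_def using state_map_Z_transducer[OF tT(1) 2(1) n]
        state_map_Z_transducer[OF tU(1) 2(2) n] st \<open>x = y\<close> by simp
    then show ?thesis
      unfolding transducer_eq_def st by (intro exI[of _ "\<lambda>_. t"]) (auto simp: bij_betw_def)
  qed
qed


section \<open>Homomorphisms of transducers\<close>

text \<open>One notion covers renaming of states, identification of equivalent states, collapse to a
  single state, and the bijection behind \<open>transducer_eq\<close>.\<close>

definition transducer_hom :: "nat \<Rightarrow> ('p \<Rightarrow> 'q) \<Rightarrow> 'p transducer \<Rightarrow> 'q transducer \<Rightarrow> bool" where
  "transducer_hom n h T U \<longleftrightarrow> h ` St T = St U \<and> (\<forall>a<n. \<forall>q\<in>St T.
     step U a (h q) = h (step T a q) \<and> out U a (h q) = out T a q)"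

context
  fixes n :: nat and h :: "'p \<Rightarrow> 'q" and T U
  assumes T: "is_transducer n T" "strongly_synchronizing n T" and hom: "transducer_hom n h T U"
begin

lemma hom_St: "St U = h ` St T"
  using hom by (simp add: transducer_hom_def)

lemma hom_runs:
  assumes "w \<in> lists {..<n}" "q \<in> St T"
  shows "steps U w (h q) = h (steps T w q)" "outs U w (h q) = outs T w q"
proof -
  have "steps U w (h q) = h (steps T w q) \<and> outs U w (h q) = outs T w q"
    using assms
  proof (induction w arbitrary: q)
    case (Cons a w)
    then have "step T a q \<in> St T" using T(1) by (simp add: is_transducer_def)
    then show ?case using Cons hom by (simp add: transducer_hom_def)
  qed simp
  then show "steps U w (h q) = h (steps T w q)" "outs U w (h q) = outs T w q" by blast+
qed

lemma hom_sync_level: "sync_level n T k \<Longrightarrow> sync_level n U k"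
  unfolding sync_level_def hom_St
proof (intro ballI)
  fix w p q assume a: "\<forall>w\<in>words_of_length n k. \<forall>p\<in>St T. \<forall>q\<in>St T. steps T w p = steps T w q"
    "w \<in> words_of_length n k" "p \<in> h ` St T" "q \<in> h ` St T"
  then have w: "w \<in> lists {..<n}" by (simp add: words_of_length_def)
  obtain p' q' where pq: "p = h p'" "q = h q'" "p' \<in> St T" "q' \<in> St T" using a by blast
  then have "steps T w p' = steps T w q'" using a by blast
  then show "steps U w p = steps U w q" using hom_runs(1)[OF w] pq by simp
qed

lemma hom_sync: "strongly_synchronizing n U"
  using T(2) hom_sync_level by (auto simp: strongly_synchronizing_def)

text \<open>A preimage of \<open>q\<close> need not be fixed by \<open>w\<close>. But the state
  fixed by \<open>w\<close> upstairs maps to a state fixed by \<open>w\<close>, and synchronization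
  leaves only one such state.\<close>

lemma hom_loop:
  assumes w: "w \<in> lists {..<n}" "w \<noteq> []" and q: "q \<in> St U" "steps U w q = q"
  shows "h (loop_state T w) = q"
proof -
  obtain k where k: "sync_level n U k" using hom_sync by (auto simp: strongly_synchronizing_def)
  define r where "r = loop_state T w"
  have r: "r \<in> St T" "steps T w r = r" using loop_state_exists[OF T w] by (simp_all add: r_def)
  have hr: "h r \<in> St U" using r hom_St by simp
  have "steps U (wpow w k) (h r) = q" using sync_steps_wpow[OF k w hr q(1) q(2)] .
  moreover have "steps U (wpow w k) (h r) = h r"
    using hom_runs(1)[OF w(1) r(1)] r(2) by (simp add: steps_loop_wpow)
  ultimately show ?thesis by (simp add: r_def)
qed

lemma hom_is_transducer: "is_transducer n U"
  unfolding is_transducer_def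
proof (intro conjI allI ballI impI)
  show "finite (St U)" "St U \<noteq> {}"
    using finite_St[OF T(1)] St_nonempty[OF T(1)] by (auto simp: hom_St)
  fix a q assume a: "a < n" "q \<in> St U"
  then obtain p where p: "q = h p" "p \<in> St T" by (auto simp: hom_St)
  then have "step T a p \<in> St T" "out T a p \<in> lists {..<n}"
    using T(1) a by (simp_all add: is_transducer_def)
  then show "step U a q \<in> St U" "out U a q \<in> lists {..<n}"
    using hom a p by (auto simp: transducer_hom_def)
next
  fix w q assume w: "w \<in> lists {..<n}" "q \<in> St U" "w \<noteq> []" "steps U w q = q"
  then have q: "q = h (loop_state T w)" using hom_loop by simp
  have r: "loop_state T w \<in> St T" "steps T w (loop_state T w) = loop_state T w"
    using loop_state_exists[OF T w(1,3)] by simp_all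
  then have "outs U w q = outs T w (loop_state T w)" using hom_runs(2)[OF w(1)] q by simp
  then show "outs U w q \<noteq> []" using outs_loop_not_Nil[OF T(1) w(1) r(1) w(3) r(2)] by simp
qed

lemma hom_state_map:
  assumes "q \<in> St T" "x \<in> inf_words n"
  shows "state_map U (h q) x = state_map T q x"
  unfolding state_map_def using hom_runs(2)[OF subsequence_in_lists[OF assms(2)] assms(1)] by simp

lemma hom_omega_equiv: "q \<in> St T \<Longrightarrow> omega_equiv n T q U (h q)"
  by (simp add: omega_equiv_def hom_state_map)

lemma hom_incomplete_response:
  assumes "q \<in> St T"
  shows "incomplete_response n U (h q) \<longleftrightarrow> incomplete_response n T q"
proof -
  have "common_prefixes n U [] (h q) = common_prefixes n T [] q"
    unfolding common_prefixes_def using hom_state_map[OF assms] by auto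
  then show ?thesis by (simp add: incomplete_response_def extent_def)
qed

lemma hom_is_core:
  assumes "is_core n T"
  shows "is_core n U"
  unfolding is_core_iff
proof
  show "St (core n U) \<subseteq> St U" by (rule core_subset[OF hom_is_transducer])
  show "St U \<subseteq> St (core n U)"
  proof
    fix q assume "q \<in> St U"
    then obtain p where p: "q = h p" "p \<in> St T" by (auto simp: hom_St)
    obtain k w where w: "w \<in> words_of_length n k" "sync_level n T k" "\<forall>r\<in>St T. steps T w r = p"
      using forcing_word[OF assms p(2)] by blast
    have "w \<in> lists {..<n}" using w(1) by (simp add: words_of_length_def)
    then have "q = steps U w q"
      using hom_runs(1)[of w p] bspec[OF w(3) p(2)] p by simp
    then show "q \<in> St (core n U)"
      using w(1) hom_sync_level[OF w(2)] \<open>q \<in> St U\<close> unfolding St_core by blast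
  qed
qed

lemma hom_is_Z_transducer:
  assumes "is_Z_transducer n x T"
  shows "is_Z_transducer n x U"
proof -
  obtain s where "St T = {s}" "\<forall>a<n. step T a s = s \<and> out T a s = x"
    using assms by (auto simp: is_Z_transducer_def)
  then have "St U = {h s} \<and> (\<forall>a<n. step U a (h s) = h s \<and> out U a (h s) = x)"
    using hom hom_St by (simp add: transducer_hom_def)
  then show ?thesis unfolding is_Z_transducer_def by blast
qed

lemma hom_M_transducer:
  assumes M: "M_transducer n T" and inj: "inj_on h (St T)"
  shows "M_transducer n U" "transducer_eq n T U"
proof -
  have core: "is_core n U" using hom_is_core M by (simp add: M_transducer_def)
  have "weakly_minimal n U" if "weakly_minimal n T"
    unfolding weakly_minimal_def hom_St
  proof (intro ballI impI notI)
    fix p q assume pq: "p \<in> h ` St T" "q \<in> h ` St T" "p \<noteq> q" "omega_equiv n U p U q"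
    then obtain p' q' where p': "p = h p'" "q = h q'" "p' \<in> St T" "q' \<in> St T" by blast
    then have "omega_equiv n T p' T q'"
      using hom_omega_equiv[of p'] hom_omega_equiv[of q'] pq(4) by (simp add: omega_equiv_def)
    then show False using that p' pq(3) by (auto simp: weakly_minimal_def)
  qed
  moreover have "\<forall>q\<in>St U. \<not> incomplete_response n U q" if "\<forall>q\<in>St T. \<not> incomplete_response n T q"
    using that hom_incomplete_response by (auto simp: hom_St)
  ultimately have "minimal_transducer n U"
    using M core_strongly_connected[OF core] hom_is_transducer hom_is_Z_transducer
    unfolding M_transducer_def minimal_transducer_def by blast
  then show "M_transducer n U" using core hom_sync by (simp add: M_transducer_def)
  show "transducer_eq n T U"
    unfolding transducer_eq_def
    by (intro exI[of _ h]) (use inj hom_St hom_omega_equiv in \<open>auto simp: bij_betw_def\<close>)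
qed

end

lemma M_transducerD:
  "M_transducer n T \<Longrightarrow> is_transducer n T \<and> strongly_synchronizing n T \<and> is_core n T"
  by (auto simp: M_transducer_def minimal_transducer_def)

text \<open>Products and reductions have pairs and sets as states, whereas
  \<open>transducer_class\<close> collects transducers over natural numbers. This keeps the classes
  of such constructions nonempty.\<close>

lemma nat_representative_exists:
  assumes M: "M_transducer n T"
  shows "\<exists>V :: nat transducer. M_transducer n V \<and> transducer_eq n T V"
proof -
  have T: "is_transducer n T" "strongly_synchronizing n T" using M_transducerD[OF M] by auto
  obtain f :: "_ \<Rightarrow> nat" where f: "inj_on f (St T)"
    using finite_imp_inj_to_nat_seg[OF finite_St[OF T(1)]] by blast
  define V where "V = \<lparr>St = f ` St T, step = (\<lambda>a i. f (step T a (inv_into (St T) f i))),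
    out = (\<lambda>a i. out T a (inv_into (St T) f i))\<rparr>"
  have "transducer_hom n f T V"
    using f by (simp add: transducer_hom_def V_def)
  then show ?thesis using hom_M_transducer[OF T _ M f] by blast
qed


section \<open>Reduction\<close>

lemma least_rotation_exists:
  fixes S :: "nat list set"
  assumes "finite S" "S \<noteq> {}"
  shows "\<exists>x\<in>S. \<forall>y\<in>S. x = y \<or> (x, y) \<in> lexord less_than"
  using assms
proof (induction S rule: finite_ne_induct)
  case (insert a S)
  then obtain x where x: "x \<in> S" "\<forall>y\<in>S. x = y \<or> (x, y) \<in> lexord less_than" by blast
  have "(a, x) \<in> lexord less_than \<or> a = x \<or> (x, a) \<in> lexord less_than"
    by (rule lexord_linear) auto
  then show ?case
  proof (elim disjE)
    assume "(a, x) \<in> lexord less_than"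
    then have "\<forall>y\<in>S. (a, y) \<in> lexord less_than"
      using x lexord_trans[of a x less_than] trans_less_than by metis
    then show ?thesis by blast
  qed (use x in blast)+
qed simp

lemma Z_transducer_is_transducer:
  assumes "x \<in> lists {..<n}" "x \<noteq> []"
  shows "is_transducer n (Z_transducer s x)"
proof -
  have "outs (Z_transducer s x) w q \<noteq> []" if "w \<noteq> []" for w q
    using that assms(2) by (cases w) (auto simp: Z_transducer_def)
  then show ?thesis using assms by (auto simp: is_transducer_def Z_transducer_def)
qed

lemma Z_transducer_is_Z: "is_Z_transducer n x (Z_transducer s x)"
  by (simp add: is_Z_transducer_def Z_transducer_def)

lemma one_state_sync_core:
  assumes T: "is_transducer n T" and s: "St T = {s}"
  shows "sync_level n T 0" "strongly_synchronizing n T" "is_core n T"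
proof -
  show 0: "sync_level n T 0" by (simp add: sync_level_def words_of_length_def s)
  then show "strongly_synchronizing n T" by (auto simp: strongly_synchronizing_def)
  have "[] \<in> words_of_length n 0" by (simp add: words_of_length_def)
  then have "s \<in> St (core n T)" using 0 unfolding St_core s by force
  then show "is_core n T" using core_subset[OF T] s by (auto simp: is_core_iff)
qed

lemma Z_transducer_M:
  assumes "least_prime_word n x"
  shows "M_transducer n (Z_transducer s x)"
proof -
  have "is_transducer n (Z_transducer s x)"
    using assms Z_transducer_is_transducer[of x n s] prime_word_not_Nil[of x]
    by (simp add: least_prime_word_def)
  moreover have "St (Z_transducer s x) = {s}" by (simp add: Z_transducer_def)
  ultimately show ?thesis
    unfolding M_transducer_def minimal_transducer_def
    using assms Z_transducer_is_Z[of n x s] one_state_sync_core[of n "Z_transducer s x" s] by blast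
qed

lemma common_prefix_of_Lam:
  assumes n: "n \<ge> 1" and fin: "extent n T q \<noteq> \<infinity>" and v: "v \<in> common_prefixes n T [] q"
  shows "\<exists>e. Lam n T [] q = v @ e"
proof -
  note L = finite_extentE[OF n fin]
  obtain y where "state_map T q (\<lambda>_. 0) = v \<frown> y"
    using v inf_words_nonempty[OF n] by (metis conc_empty in_common_prefixes_iff)
  moreover obtain z where "state_map T q (\<lambda>_. 0) = Lam n T [] q \<frown> z"
    using L inf_words_nonempty[OF n] by (metis conc_empty in_common_prefixes_iff)
  ultimately have "v \<frown> y = Lam n T [] q \<frown> z" by simp
  moreover have "length v \<le> length (Lam n T [] q)" using L v by blast
  ultimately show ?thesis using conc_left_cancel by blast
qed

section \<open>Removal of incomplete response\<close>

context
  fixes n :: nat and C :: "'q transducer"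
  assumes n: "n \<ge> 1"
    and C: "is_transducer n C" "strongly_synchronizing n C" "is_core n C"
    and finite_extents: "\<forall>q\<in>St C. extent n C q \<noteq> \<infinity>"
begin

private abbreviation "C' \<equiv> remove_incomplete_response n C"

lemma steps_remove [simp]: "steps C' w q = steps C w q"
  by (induction w arbitrary: q) (auto simp: remove_incomplete_response_def)

lemma St_remove [simp]: "St C' = St C"
  by (simp add: remove_incomplete_response_def)

lemma Lam_state_map:
  assumes "q \<in> St C" "x \<in> inf_words n"
  shows "\<exists>y. state_map C q x = Lam n C [] q \<frown> y"
  using finite_extentE[OF n finite_extents[rule_format, OF assms(1)]] assms(2)
  by (auto simp: in_common_prefixes_iff)

text \<open>\<open>drop\<close> deletes letters blindly, so \<open>Lam n C [] q\<close> has to be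
  shown to be a prefix of \<open>Lam n C [a] q\<close>. If it is longer than
  \<open>out C a q\<close>, the excess is a common prefix of all outputs at the next state, hence a
  prefix of \<open>Lam\<close> there.\<close>

lemma out_remove:
  assumes q: "q \<in> St C" and a: "a < n"
  shows "Lam n C [] q @ out C' a q = out C a q @ Lam n C [] (step C a q)"
proof -
  have aw: "[a] \<in> lists {..<n}" using a by simp
  have q': "step C a q \<in> St C" using C(1) q a by (simp add: is_transducer_def)
  have L: "Lam n C [a] q = out C a q @ Lam n C [] (step C a q)"
    using Lam_append[OF C(1) n q aw] finite_extents[rule_format, OF q'] by simp
  have eq: "\<exists>y. out C a q \<frown> state_map C (step C a q) x = Lam n C [] q \<frown> y"
    if x: "x \<in> inf_words n" for x
    using state_map_conc[OF C(1) q aw x] Lam_state_map[OF q inf_words_conc[OF aw x]] by simp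
  have "\<exists>e. out C a q @ Lam n C [] (step C a q) = Lam n C [] q @ e"
  proof (cases "length (Lam n C [] q) \<le> length (out C a q)")
    case True
    then show ?thesis
      using eq[OF inf_words_nonempty[OF n]] conc_left_cancel by (metis append.assoc)
  next
    case False
    then obtain e where e: "Lam n C [] q = out C a q @ e"
      using eq[OF inf_words_nonempty[OF n]] conc_left_cancel by (metis nat_le_linear)
    have "e \<in> common_prefixes n C [] (step C a q)"
      unfolding in_common_prefixes_iff using eq e by (simp flip: conc_conc)
    then obtain r where "Lam n C [] (step C a q) = e @ r"
      using common_prefix_of_Lam[OF n finite_extents[rule_format, OF q']] by blast
    then show ?thesis using e by simp
  qed
  then obtain e where "Lam n C [a] q = Lam n C [] q @ e" using L by auto
  moreover have "out C' a q = drop (length (Lam n C [] q)) (Lam n C [a] q)"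
    by (simp add: remove_incomplete_response_def)
  ultimately show ?thesis using L by simp
qed

text \<open>The identities for single letters telescope. On a loop both ends carry the same prefix,
  so the output is only conjugated and keeps its length.\<close>

lemma outs_remove:
  assumes "q \<in> St C" "w \<in> lists {..<n}"
  shows "Lam n C [] q @ outs C' w q = outs C w q @ Lam n C [] (steps C w q)"
  using assms
proof (induction w arbitrary: q)
  case (Cons a w)
  have q': "step C a q \<in> St C" using C(1) Cons.prems by (simp add: is_transducer_def)
  have "step C' a q = step C a q" by (simp add: remove_incomplete_response_def)
  then have "Lam n C [] q @ outs C' (a # w) q = (Lam n C [] q @ out C' a q) @ outs C' w (step C a q)"
    by simp
  also have "\<dots> = out C a q @ (Lam n C [] (step C a q) @ outs C' w (step C a q))"
    using out_remove Cons.prems by simp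
  also have "\<dots> = outs C (a # w) q @ Lam n C [] (steps C (a # w) q)"
    using Cons.IH[OF q'] Cons.prems(2) by simp
  finally show ?case .
qed simp

lemma remove_is_transducer: "is_transducer n C'"
  unfolding is_transducer_def St_remove steps_remove
proof (intro conjI allI ballI impI)
  show "finite (St C)" "St C \<noteq> {}" using finite_St[OF C(1)] St_nonempty[OF C(1)] .
  fix a q assume a: "a < n" "q \<in> St C"
  then have q': "step C a q \<in> St C" "out C a q \<in> lists {..<n}" using C(1) by (simp_all add: is_transducer_def)
  then show "step C' a q \<in> St C" by (simp add: remove_incomplete_response_def)
  have "Lam n C [] (step C a q) \<in> lists {..<n}"
    using Lam_state_map[OF q'(1) inf_words_nonempty[OF n]]
      state_map_in_inf_words[OF C(1) q'(1) inf_words_nonempty[OF n]] by (auto simp: inf_words_conc_iff)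
  then have "Lam n C [] q @ out C' a q \<in> lists {..<n}" using out_remove a q' by simp
  then show "out C' a q \<in> lists {..<n}" by simp
next
  fix w q assume w: "w \<in> lists {..<n}" "q \<in> St C" "w \<noteq> []" "steps C w q = q"
  have "Lam n C [] q @ outs C' w q = outs C w q @ Lam n C [] q" using outs_remove w by simp
  then have "length (outs C' w q) = length (outs C w q)" by (metis add.commute add_left_cancel length_append)
  then show "outs C' w q \<noteq> []" using outs_loop_not_Nil[OF C(1) w] by auto
qed

lemma remove_sync: "strongly_synchronizing n C'"
  using C(2) by (simp add: strongly_synchronizing_def sync_level_def)

lemma remove_core: "is_core n C'"
  using C(3) unfolding is_core_iff St_core sync_level_def by simp

lemma state_map_remove:
  assumes q: "q \<in> St C" and x: "x \<in> inf_words n"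
  shows "state_map C q x = Lam n C [] q \<frown> state_map C' q x"
proof -
  define y where "y = suffix (length (Lam n C [] q)) (state_map C q x)"
  have L: "state_map C q x = Lam n C [] q \<frown> y"
    using Lam_state_map[OF q x] by (auto simp: y_def)
  have "state_map C' q x = y"
  proof (rule state_map_cong[OF remove_is_transducer _ x])
    show "q \<in> St C'" using q by simp
    fix m
    have pm: "prefix m x \<in> lists {..<n}" using subsequence_in_lists[OF x] .
    obtain z where "state_map C (steps C (prefix m x) q) (suffix m x) =
        Lam n C [] (steps C (prefix m x) q) \<frown> z"
      using Lam_state_map[OF steps_in_St[OF C(1) pm q] suffix_in_inf_words[OF x]] by blast
    then have "Lam n C [] q \<frown> y = outs C (prefix m x) q \<frown> (Lam n C [] (steps C (prefix m x) q) \<frown> z)"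
      using state_map_suffix[OF C(1) q x, of m] L by simp
    also have "\<dots> = Lam n C [] q \<frown> (outs C' (prefix m x) q \<frown> z)"
      using outs_remove[OF q pm] by simp
    finally have "y = outs C' (prefix m x) q \<frown> z" by (simp only: same_concat_eq)
    then have "prefix (length (outs C' (prefix m x) q)) y = outs C' (prefix m x) q"
      using prefix_conc_length by metis
    then show "\<exists>k\<ge>m. prefix (length (outs C' (prefix k x) q)) y = outs C' (prefix k x) q"
      by blast
  qed
  then show ?thesis using L by simp
qed

lemma remove_complete:
  assumes q: "q \<in> St C"
  shows "\<not> incomplete_response n C' q"
  unfolding complete_response_iff
proof
  fix u assume "u \<in> common_prefixes n C' [] q"
  then have "Lam n C [] q @ u \<in> common_prefixes n C [] q"
    unfolding in_common_prefixes_iff using state_map_remove[OF q] by (simp flip: conc_conc)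
  then show "u = []" using finite_extentE[OF n finite_extents[rule_format, OF q]] by fastforce
qed

text \<open>After one letter both states still have complete response, so equal maps split into
  equal outputs and equivalent successors. Therefore the representative chosen by
  \<open>SOME\<close> in \<open>identify_equiv_states\<close> does not matter.\<close>

lemma remove_equiv_step:
  assumes pq: "p \<in> St C" "q \<in> St C" "omega_equiv n C' p C' q" and a: "a < n"
  shows "out C' a p = out C' a q \<and> omega_equiv n C' (step C' a p) C' (step C' a q)"
proof (rule complete_response_conc_eq[OF _ _ _ n])
  have a': "[a] \<in> lists {..<n}" using a by simp
  have St: "step C' a p \<in> St C" "step C' a q \<in> St C"
    using steps_in_St[OF remove_is_transducer a'] pq by simp_all
  then show "\<not> incomplete_response n C' (step C' a p)" "\<not> incomplete_response n C' (step C' a q)"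
    using remove_complete by blast+
  fix x assume x: "x \<in> inf_words n"
  show "out C' a p \<frown> state_map C' (step C' a p) x = out C' a q \<frown> state_map C' (step C' a q) x"
    using state_map_conc[OF remove_is_transducer _ a' x, of p]
      state_map_conc[OF remove_is_transducer _ a' x, of q] pq inf_words_conc[OF a' x]
    by (simp add: omega_equiv_def del: steps_remove build_cons)
qed

private abbreviation "E \<equiv> identify_equiv_states n C'"

section \<open>Identification of equivalent states\<close>

lemma omega_class_eq:
  assumes "p \<in> St C" "q \<in> St C"
  shows "omega_class n C' p = omega_class n C' q \<longleftrightarrow> omega_equiv n C' p C' q"
  using assms unfolding omega_class_def
  by (auto simp: omega_equiv_def)

lemma identify_hom: "transducer_hom n (omega_class n C') C' E"
  unfolding transducer_hom_def
proof (intro conjI allI ballI impI)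
  show "omega_class n C' ` St C' = St E" by (simp add: identify_equiv_states_def)
  fix a q assume a: "a < n" "q \<in> St C'"
  define r where "r = (SOME r. r \<in> omega_class n C' q)"
  have "r \<in> omega_class n C' q"
    unfolding r_def by (rule someI[of _ q]) (use a in \<open>simp add: omega_class_def omega_equiv_refl\<close>)
  then have r: "r \<in> St C" "omega_equiv n C' r C' q" by (auto simp: omega_class_def)
  have q: "q \<in> St C" using a by simp
  note step = remove_equiv_step[OF r(1) q r(2) a(1)]
  have "[a] \<in> lists {..<n}" using a by simp
  then have "step C' a r \<in> St C" "step C' a q \<in> St C"
    using steps_in_St[OF remove_is_transducer, of "[a]"] q r(1) by simp_all
  then show "step E a (omega_class n C' q) = omega_class n C' (step C' a q)"
    using step omega_class_eq by (simp add: identify_equiv_states_def flip: r_def)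
  show "out E a (omega_class n C' q) = out C' a q"
    using step by (simp add: identify_equiv_states_def flip: r_def)
qed

lemma identify_M: "M_transducer n E"
proof -
  note hom = remove_is_transducer remove_sync identify_hom
  have E: "is_transducer n E" "strongly_synchronizing n E" "is_core n E"
    using hom_is_transducer[OF hom] hom_sync[OF hom] hom_is_core[OF hom remove_core] .
  have "\<forall>q\<in>St E. \<not> incomplete_response n E q"
    using hom_incomplete_response[OF hom] hom_St[OF hom] remove_complete by auto
  moreover have "weakly_minimal n E"
    unfolding weakly_minimal_def hom_St[OF hom]
  proof (intro ballI impI notI)
    fix A B assume AB: "A \<in> omega_class n C' ` St C'" "B \<in> omega_class n C' ` St C'" "A \<noteq> B"
      "omega_equiv n E A E B"
    then obtain p q where pq: "A = omega_class n C' p" "B = omega_class n C' q" "p \<in> St C" "q \<in> St C"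
      by auto
    then have "omega_equiv n C' p C' q"
      using hom_omega_equiv[OF hom, of p] hom_omega_equiv[OF hom, of q] AB(4)
      by (simp add: omega_equiv_def)
    then show False using AB(3) pq omega_class_eq by simp
  qed
  ultimately show ?thesis
    using E core_strongly_connected[OF E(3)] by (simp add: M_transducer_def minimal_transducer_def)
qed

lemma cyclic_image_identify:
  assumes "w \<in> lists {..<n}" "w \<noteq> []"
  shows "cyclic_image E w = cyclic_image C w"
proof -
  note hom = remove_is_transducer remove_sync identify_hom
  obtain q where q: "q \<in> St C" using St_nonempty[OF C(1)] by blast
  have "\<exists>c d. c \<frown> state_map E (omega_class n C' q) x = d \<frown> state_map C q x" if "x \<in> inf_words n" for x
    using state_map_remove[OF q that] hom_state_map[OF hom, of q] q that
    by (intro exI[of _ "Lam n C [] q"] exI[of _ "[]"]) simp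
  moreover have "omega_class n C' q \<in> St E" using q hom_St[OF hom] by simp
  ultimately show ?thesis
    using cyclic_image_cong[OF hom_is_transducer[OF hom] hom_sync[OF hom] C(1,2) assms _ q] by blast
qed

end

text \<open>Common prefixes of unbounded length determine every letter of the output.\<close>

lemma infinite_extent_constant:
  assumes ext: "extent n T q = \<infinity>" and xy: "x \<in> inf_words n" "y \<in> inf_words n"
  shows "state_map T q x = state_map T q y"
proof
  fix i
  have "\<exists>u\<in>common_prefixes n T [] q. i < length u"
  proof (rule ccontr)
    assume "\<not> ?thesis"
    then have "extent n T q \<le> enat i"
      unfolding extent_def by (intro SUP_least) (auto simp: not_less)
    then show False using ext by simp
  qed
  then obtain u where "u \<in> common_prefixes n T [] q" "i < length u" by blast
  then have "state_map T q x i = u ! i" "state_map T q y i = u ! i"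
    using xy unfolding in_common_prefixes_iff by (metis conc_empty conc_fst)+
  then show "state_map T q x i = state_map T q y i" by simp
qed

section \<open>Infinite extent of incomplete response\<close>

context
  fixes n :: nat and C :: "'q transducer" and q
  assumes n: "n \<ge> 1"
    and C: "is_transducer n C" "strongly_synchronizing n C" "is_core n C"
    and q: "q \<in> St C" and ext: "extent n C q = \<infinity>"
begin

text \<open>As the map is constant, its value can be computed at the infinite power of a loop at
  \<open>q\<close>, where the output is an infinite power too.\<close>

lemma infinite_extent_periodic:
  "\<exists>d. d \<in> lists {..<n} \<and> prime_word d \<and> (\<forall>z\<in>inf_words n. state_map C q z = d\<^sup>\<omega>)"
proof -
  obtain v where v: "v \<in> lists {..<n}" "\<forall>p\<in>St C. steps C v p = q"
    using forcing_word[OF C(3) q] by (auto simp: words_of_length_def)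
  define w where "w = [0] @ v"
  have z: "[0] \<in> lists {..<n}" using n by simp
  have w: "w \<in> lists {..<n}" "w \<noteq> []" using v(1) z by (auto simp: w_def)
  have loop: "steps C w q = q" using v(2) steps_in_St[OF C(1) z q] by (simp add: w_def)
  define o1 where "o1 = outs C w q"
  have o1: "o1 \<noteq> []" "o1 \<in> lists {..<n}"
    using outs_loop_not_Nil[OF C(1) w(1) q w(2) loop] outs_in_lists[OF C(1) w(1) q]
    by (simp_all add: o1_def)
  obtain s where s: "prime_word (prime_root o1)" "s \<ge> 1" "o1 = wpow (prime_root o1) s"
    using prime_rootE[OF o1(1)] by metis
  have "state_map C q z = (prime_root o1)\<^sup>\<omega>" if "z \<in> inf_words n" for z
  proof -
    have "state_map C q z = state_map C q (w\<^sup>\<omega>)"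
      by (rule infinite_extent_constant[OF ext that iter_in_inf_words[OF w]])
    also have "\<dots> = o1\<^sup>\<omega>" using state_map_loop[OF C(1) q w loop] by (simp add: o1_def)
    also have "\<dots> = (prime_root o1)\<^sup>\<omega>"
      using iter_wpow[OF prime_word_not_Nil[OF s(1)] s(2)] s(3) by metis
    finally show ?thesis .
  qed
  then show ?thesis using prime_root_in_lists[OF o1] s(1) by blast
qed

lemma reduction_infinite_extent:
  "\<exists>x. least_prime_word n x \<and> reduction n C = Z_transducer (St C) x \<and>
    (\<exists>d\<in>rotations x. \<forall>z\<in>inf_words n. state_map C q z = d\<^sup>\<omega>)"
proof -
  obtain d where d: "d \<in> lists {..<n}" "prime_word d" "\<And>z. z \<in> inf_words n \<Longrightarrow> state_map C q z = d\<^sup>\<omega>"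
    using infinite_extent_periodic by blast
  obtain x where x: "x \<in> rotations d" "\<forall>y\<in>rotations d. x = y \<or> (x, y) \<in> lexord less_than"
    using least_rotation_exists[OF finite_rotations, of d] self_in_rotations by blast
  have rot: "rotations x = rotations d" using rotations_eq x(1) by blast
  have "x \<in> lists {..<n}" using x(1) d(1) rotate_in_lists by (auto simp: rotations_def)
  then have least: "least_prime_word n x"
    using x prime_rotations[OF d(2)] rot by (simp add: least_prime_word_def)
  have Z: "state_map (Z_transducer () y) () z = y\<^sup>\<omega>"
    if "y \<in> lists {..<n}" "y \<noteq> []" "z \<in> inf_words n" for y z
    by (rule state_map_Z_transducer[OF Z_transducer_is_transducer[OF that(1,2)]
          Z_transducer_is_Z n _ that(3)]) (simp add: Z_transducer_def)
  have "(THE x. least_prime_word n x \<and>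
      (\<exists>q\<in>St C. \<exists>y\<in>rotations x. omega_equiv n C q (Z_transducer () y) ())) = x"
  proof (rule the_equality)
    have "d \<in> rotations x" using rot by simp
    moreover have "omega_equiv n C q (Z_transducer () d) ()"
      using d Z by (auto simp: omega_equiv_def)
    ultimately show "least_prime_word n x \<and>
        (\<exists>q\<in>St C. \<exists>y\<in>rotations x. omega_equiv n C q (Z_transducer () y) ())"
      using least q by blast
    fix x' assume "least_prime_word n x' \<and>
        (\<exists>q\<in>St C. \<exists>y\<in>rotations x'. omega_equiv n C q (Z_transducer () y) ())"
    then obtain p y where p: "least_prime_word n x'" "p \<in> St C" "y \<in> rotations x'"
      "omega_equiv n C p (Z_transducer () y) ()" by blast
    have y: "prime_word y" "y \<in> lists {..<n}"
      using p(1,3) prime_rotations rotate_in_lists by (auto simp: least_prime_word_def rotations_def)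
    \<comment> \<open>The description quantifies over all states. By strong connectedness the output
      of \<open>q\<close> ends in the output of any other state \<open>p\<close>, so every state
      leads to the same cyclic word.\<close>
    obtain v where v: "v \<in> lists {..<n}" "steps C v q = p"
      using core_strongly_connected[OF C(3)] p(2) q unfolding strongly_connected_def by blast
    have z: "(\<lambda>_. 0) \<in> inf_words n" by (rule inf_words_nonempty[OF n])
    have "d\<^sup>\<omega> = outs C v q \<frown> y\<^sup>\<omega>"
      using state_map_conc[OF C(1) q v(1) z] v(2) d(3)[OF inf_words_conc[OF v(1) z]] p(4)
        Z[OF y(2) prime_word_not_Nil[OF y(1)] z] z by (simp add: omega_equiv_def)
    then have "[] \<frown> d\<^sup>\<omega> = outs C v q \<frown> y\<^sup>\<omega>" by simp
    then have "rotations (prime_root d) = rotations (prime_root y)"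
      by (rule conc_iter_eq_rotations[OF prime_word_not_Nil[OF d(2)] prime_word_not_Nil[OF y(1)]])
    then have "rotations d = rotations y" using prime_root_prime d(2) y(1) by metis
    then have "rotations x' = rotations x" using rot rotations_eq[OF p(3)] by simp
    then show "x' = x" using least_prime_word_unique[OF p(1) least] by blast
  qed
  then have "reduction n C = Z_transducer (St C) x" using q ext by (auto simp: reduction_def)
  then show ?thesis using least rot d(3) self_in_rotations by blast
qed

lemma reduction_infinite_M: "M_transducer n (reduction n C)"
  using reduction_infinite_extent Z_transducer_M by metis

lemma cyclic_image_reduction_infinite:
  assumes w: "w \<in> lists {..<n}" "w \<noteq> []"
  shows "cyclic_image (reduction n C) w = cyclic_image C w"
proof -
  obtain x d where x: "least_prime_word n x" "reduction n C = Z_transducer (St C) x"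
    "d \<in> rotations x" "\<And>z. z \<in> inf_words n \<Longrightarrow> state_map C q z = d\<^sup>\<omega>"
    using reduction_infinite_extent by blast
  have R: "is_transducer n (reduction n C)" "strongly_synchronizing n (reduction n C)"
    using M_transducerD[OF reduction_infinite_M] by simp_all
  have St: "St C \<in> St (reduction n C)" using x(2) by (simp add: Z_transducer_def)
  obtain s t where st: "x = s @ t" "d = t @ s" using x(3) by (auto simp: rotations_iff)
  have "x \<noteq> []" using x(1) by (auto simp: least_prime_word_def)
  show "cyclic_image (reduction n C) w = cyclic_image C w"
  proof (rule cyclic_image_cong[OF R C(1,2) w St q])
    fix z assume z: "z \<in> inf_words n"
    have "state_map (reduction n C) (St C) z = x\<^sup>\<omega>"
      using state_map_Z_transducer[OF R(1) _ n St z, of x] unfolding x(2)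
      using Z_transducer_is_Z[of n x "St C"] by simp
    then show "\<exists>c e. c \<frown> state_map (reduction n C) (St C) z = e \<frown> state_map C q z"
      using iter_rotate[OF st(1) \<open>x \<noteq> []\<close>] st(2) x(4)[OF z]
      by (intro exI[of _ "[]"] exI[of _ s]) simp
  qed
qed

end

lemma reduction_M:
  assumes n: "n \<ge> 1" and C: "is_transducer n C" "strongly_synchronizing n C" "is_core n C"
  shows "M_transducer n (reduction n C)"
proof (cases "\<exists>q\<in>St C. extent n C q = \<infinity>")
  case True
  then obtain q where q: "q \<in> St C" "extent n C q = \<infinity>" by blast
  then show ?thesis using reduction_infinite_M[OF n C q] by blast
next
  case False
  then have "reduction n C = identify_equiv_states n (remove_incomplete_response n C)"
    unfolding reduction_def by (rule if_not_P)
  moreover have "\<forall>q\<in>St C. extent n C q \<noteq> \<infinity>" using False by simp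
  ultimately show ?thesis using identify_M[OF n C] by simp
qed

lemma cyclic_image_reduction:
  assumes n: "n \<ge> 1" and C: "is_transducer n C" "strongly_synchronizing n C" "is_core n C"
    and w: "w \<in> lists {..<n}" "w \<noteq> []"
  shows "cyclic_image (reduction n C) w = cyclic_image C w"
proof (cases "\<exists>q\<in>St C. extent n C q = \<infinity>")
  case True
  then obtain q where q: "q \<in> St C" "extent n C q = \<infinity>" by blast
  then show ?thesis using cyclic_image_reduction_infinite[OF n C q w] by simp
next
  case False
  then have "reduction n C = identify_equiv_states n (remove_incomplete_response n C)"
    unfolding reduction_def by (rule if_not_P)
  moreover have "\<forall>q\<in>St C. extent n C q \<noteq> \<infinity>" using False by simp
  ultimately show ?thesis using cyclic_image_identify[OF n C _ w] by simp
qed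

text \<open>For finite extents, a loop of the quotient is the image of a loop, whose output is
  merely conjugated when the prefixes are removed. For infinite extents, the loop of the letter 0
  outputs a single letter, so the prime word of the reduction has length one.\<close>

lemma reduction_L:
  assumes n: "n \<ge> 1" and C: "is_transducer n C" "strongly_synchronizing n C" "is_core n C"
    and len: "\<And>w q. w \<in> lists {..<n} \<Longrightarrow> q \<in> St C \<Longrightarrow> steps C w q = q \<Longrightarrow>
      length (outs C w q) = length w"
  shows "L_transducer n (reduction n C)"
  unfolding L_transducer_def
proof (intro conjI ballI impI)
  show M: "M_transducer n (reduction n C)" by (rule reduction_M[OF n C])
  fix w A assume w: "w \<in> lists {..<n}" and A: "A \<in> St (reduction n C)" "steps (reduction n C) w A = A"
  show "length (outs (reduction n C) w A) = length w"
  proof (cases "\<exists>q\<in>St C. extent n C q = \<infinity>")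
    case True
    then obtain q where q: "q \<in> St C" "extent n C q = \<infinity>" by blast
    obtain x where x: "least_prime_word n x" "reduction n C = Z_transducer (St C) x"
      using reduction_infinite_extent[OF n C q] by blast
    have z: "[0] \<in> lists {..<n}" "[0] \<noteq> []" using n by auto
    define r where "r = loop_state C [0]"
    have r: "r \<in> St C" "steps C [0] r = r"
      using loop_state_exists[OF C(1,2) z] by (simp_all add: r_def)
    have "length (outs C [0] r) = 1" using len[OF z(1) r] by simp
    then obtain b where "outs C [0] r = [b]" by (auto simp: length_Suc_conv)
    moreover have "prime_word [b]" by (auto simp: prime_word_def)
    ultimately have "cyclic_image C [0] = rotations [b]"
      using cyclic_image_eq[OF C(1,2) z r] prime_root_prime[of "[b]"] by simp
    moreover have "cyclic_image (reduction n C) [0] = rotations (prime_root x)"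
      using cyclic_image_eq[of n "reduction n C" "[0]" "St C"] M_transducerD[OF M] z x(2)
      by (simp add: Z_transducer_def)
    moreover have "prime_root x = x" using x(1) prime_root_prime by (auto simp: least_prime_word_def)
    ultimately have "rotations x = rotations [b]"
      using cyclic_image_reduction[OF n C z] by simp
    then have "length x = 1" using rotations_length[of x "[b]"] self_in_rotations[of x] by simp
    moreover have "outs (Z_transducer (St C) x) v p = wpow x (length v)" for v p
      by (induction v arbitrary: p) (auto simp: Z_transducer_def)
    ultimately show ?thesis using x(2) by simp
  next
    case False
    then have fin: "\<forall>q\<in>St C. extent n C q \<noteq> \<infinity>" by simp
    let ?C' = "remove_incomplete_response n C"
    note hom = remove_is_transducer[OF n C fin] remove_sync[OF n C fin] identify_hom[OF n C fin]
    have red: "reduction n C = identify_equiv_states n ?C'"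
      unfolding reduction_def using False by (rule if_not_P)
    show ?thesis
    proof (cases "w = []")
      case w': False
      define r where "r = loop_state ?C' w"
      have "r \<in> St ?C'" "steps ?C' w r = r"
        using loop_state_exists[OF hom(1,2) w w'] by (simp_all add: r_def)
      then have r: "r \<in> St C" "steps C w r = r"
        by (simp_all add: St_remove[OF n C fin] steps_remove[OF n C fin])
      have "omega_class n ?C' r = A" using hom_loop[OF hom w w'] A red by (simp add: r_def)
      then have "outs (reduction n C) w A = outs ?C' w r"
        using hom_runs(2)[OF hom w, of r] r(1) red by (simp add: St_remove[OF n C fin])
      moreover have "Lam n C [] r @ outs ?C' w r = outs C w r @ Lam n C [] r"
        using outs_remove[OF n C fin r(1) w] r(2) by simp
      then have "length (outs ?C' w r) = length (outs C w r)"
        by (metis add.commute add_left_cancel length_append)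
      ultimately show ?thesis using len[OF w r] by simp
    qed simp
  qed
qed


section \<open>The monoid of transducers and its action\<close>

definition same_cyclic_images :: "nat \<Rightarrow> 'p transducer \<Rightarrow> 'q transducer \<Rightarrow> bool" where
  "same_cyclic_images n T U \<longleftrightarrow>
     (\<forall>w\<in>lists {..<n}. w \<noteq> [] \<longrightarrow> cyclic_image T w = cyclic_image U w)"

lemma same_cyclic_images_if_eq:
  assumes T: "M_transducer n T" and U: "M_transducer n U" and eq: "transducer_eq n T U"
  shows "same_cyclic_images n T U"
  unfolding same_cyclic_images_def
proof (intro ballI impI)
  fix w assume w: "w \<in> lists {..<n}" "w \<noteq> []"
  have tT: "is_transducer n T" "strongly_synchronizing n T"
    and tU: "is_transducer n U" "strongly_synchronizing n U"
    using M_transducerD[OF T] M_transducerD[OF U] by simp_all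
  obtain f where f: "bij_betw f (St T) (St U)" "\<forall>q\<in>St T. omega_equiv n T q U (f q)"
    using eq by (auto simp: transducer_eq_def)
  obtain p where p: "p \<in> St T" using St_nonempty[OF tT(1)] by blast
  then have fp: "f p \<in> St U" "omega_equiv n T p U (f p)" using f bij_betwE by blast+
  show "cyclic_image T w = cyclic_image U w"
  proof (rule cyclic_image_cong[OF tT tU w p fp(1)])
    fix x assume "x \<in> inf_words n"
    then show "\<exists>c d. c \<frown> state_map T p x = d \<frown> state_map U (f p) x"
      using fp(2) by (intro exI[of _ "[]"]) (simp add: omega_equiv_def)
  qed
qed

text \<open>From here on, classes are compared through cyclic images, so that transitivity and
  changes of the state type need no bijections.\<close>

lemma transducer_class_eq:
  assumes n: "n \<ge> 1" and T: "M_transducer n T"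
  shows "transducer_class n T = {V. M_transducer n V \<and> same_cyclic_images n T V}"
proof -
  have "transducer_eq n T V \<longleftrightarrow> same_cyclic_images n T V" if V: "M_transducer n V" for V :: "nat transducer"
    using same_cyclic_images_if_eq[OF T V] transducer_eq_if_same_cyclic_image[OF n T V]
    by (auto simp: same_cyclic_images_def)
  then show ?thesis unfolding transducer_class_def by blast
qed

lemma transducer_class_nonempty:
  "M_transducer n T \<Longrightarrow> \<exists>V. V \<in> transducer_class n T"
  using nat_representative_exists unfolding transducer_class_def by blast

lemma transducer_class_eq_iff:
  assumes n: "n \<ge> 1" and T: "M_transducer n T" and U: "M_transducer n U"
  shows "transducer_class n T = transducer_class n U \<longleftrightarrow> same_cyclic_images n T U"
proof
  assume eq: "transducer_class n T = transducer_class n U"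
  obtain V where "V \<in> transducer_class n T" using transducer_class_nonempty[OF T] by blast
  then have "same_cyclic_images n T V" "same_cyclic_images n U V"
    using eq transducer_class_eq[OF n T] transducer_class_eq[OF n U] by auto
  then show "same_cyclic_images n T U" by (simp add: same_cyclic_images_def)
next
  assume "same_cyclic_images n T U"
  then show "transducer_class n T = transducer_class n U"
    unfolding transducer_class_eq[OF n T] transducer_class_eq[OF n U]
    by (auto simp: same_cyclic_images_def)
qed

lemma in_own_class: "n \<ge> 1 \<Longrightarrow> M_transducer n T \<Longrightarrow> T \<in> transducer_class n T"
  by (simp add: transducer_class_eq same_cyclic_images_def)

lemma in_class_eq:
  assumes n: "n \<ge> 1" and T: "M_transducer n T" and V: "V \<in> transducer_class n T"
  shows "M_transducer n V" "transducer_class n V = transducer_class n T"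
proof -
  have V': "M_transducer n V" "same_cyclic_images n T V"
    using V unfolding transducer_class_eq[OF n T] by blast+
  then show "M_transducer n V" by blast
  show "transducer_class n V = transducer_class n T"
    using transducer_class_eq_iff[OF n V'(1) T] V'(2) by (simp add: same_cyclic_images_def)
qed

lemma class_in_carrier:
  assumes n: "n \<ge> 1" and T: "M_transducer n T"
  shows "transducer_class n T \<in> carrier (M_monoid n)"
proof -
  obtain V where V: "V \<in> transducer_class n T" using transducer_class_nonempty[OF T] by blast
  show ?thesis using in_class_eq[OF n T V] by (force simp: M_monoid_def)
qed

lemma carrier_M_monoid:
  "A \<in> carrier (M_monoid n) \<longleftrightarrow> (\<exists>T :: nat transducer. M_transducer n T \<and> A = transducer_class n T)"
  by (auto simp: M_monoid_def)

section \<open>Products of classes\<close>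

abbreviation M_product :: "nat \<Rightarrow> 'p transducer \<Rightarrow> 'q transducer \<Rightarrow> ('p \<times> 'q) set transducer" where
  "M_product n T U \<equiv> reduction n (core n (transducer_prod T U))"

lemma M_product_core:
  assumes n: "n \<ge> 1" and T: "M_transducer n T" and U: "M_transducer n U"
  shows "is_transducer n (core n (transducer_prod T U))"
    "strongly_synchronizing n (core n (transducer_prod T U))"
    "is_core n (core n (transducer_prod T U))"
proof -
  have tT: "is_transducer n T" "strongly_synchronizing n T"
    and tU: "is_transducer n U" "strongly_synchronizing n U"
    using M_transducerD[OF T] M_transducerD[OF U] by simp_all
  note P = prod_is_transducer[OF tT(1) tU(1)] prod_sync[OF tT tU]
  show "is_transducer n (core n (transducer_prod T U))"
    "strongly_synchronizing n (core n (transducer_prod T U))"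
    "is_core n (core n (transducer_prod T U))"
    using core_is_transducer[OF P n] core_sync[OF P] core_is_core[OF P n] .
qed

lemma M_product_M:
  assumes "n \<ge> 1" "M_transducer n T" "M_transducer n U"
  shows "M_transducer n (M_product n T U)"
  by (rule reduction_M[OF assms(1) M_product_core[OF assms]])

lemma cyclic_image_M_product:
  assumes n: "n \<ge> 1" and T: "M_transducer n T" and U: "M_transducer n U"
    and w: "w \<in> lists {..<n}" "w \<noteq> []" and v: "v \<in> cyclic_image T w"
  shows "cyclic_image (M_product n T U) w = cyclic_image U v"
proof -
  have tT: "is_transducer n T" "strongly_synchronizing n T"
    and tU: "is_transducer n U" "strongly_synchronizing n U"
    using M_transducerD[OF T] M_transducerD[OF U] by simp_all
  note P = prod_is_transducer[OF tT(1) tU(1)] prod_sync[OF tT tU]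
  show ?thesis
    using cyclic_image_reduction[OF n M_product_core[OF n T U] w]
      cyclic_image_core[OF P n w] cyclic_image_prod[OF tT tU w v] by simp
qed

lemma prime_cyclic_wordsD:
  assumes "c \<in> prime_cyclic_words n" "g \<in> c"
  shows "g \<in> lists {..<n}" "g \<noteq> []" "prime_word g" "c = rotations g"
proof -
  obtain w where w: "c = rotations w" "w \<in> lists {..<n}" "prime_word w"
    using assms by (auto simp: prime_cyclic_words_def)
  show "prime_word g" using prime_rotations w assms by blast
  then show "g \<noteq> []" by simp
  show "c = rotations g" using rotations_eq w(1) assms(2) by blast
  show "g \<in> lists {..<n}" using assms(2) w(1,2) rotate_in_lists by (auto simp: rotations_def)
qed

lemma prime_cyclic_words_nonempty:
  "c \<in> prime_cyclic_words n \<Longrightarrow> \<exists>g. g \<in> c"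
  unfolding prime_cyclic_words_def using self_in_rotations by blast

lemma same_images_M_product:
  assumes n: "n \<ge> 1" and T: "M_transducer n T" "M_transducer n T'" "same_cyclic_images n T T'"
    and U: "M_transducer n U" "M_transducer n U'" "same_cyclic_images n U U'"
  shows "same_cyclic_images n (M_product n T U) (M_product n T' U')"
  unfolding same_cyclic_images_def
proof (intro ballI impI)
  fix w assume w: "w \<in> lists {..<n}" "w \<noteq> []"
  have tT: "is_transducer n T" "strongly_synchronizing n T" using M_transducerD[OF T(1)] by simp_all
  have c: "cyclic_image T w \<in> prime_cyclic_words n"
    by (rule cyclic_image_in_prime_cyclic_words[OF tT w])
  obtain v where v: "v \<in> cyclic_image T w" using prime_cyclic_words_nonempty[OF c] by blast
  then have v': "v \<in> cyclic_image T' w" using T(3) w by (simp add: same_cyclic_images_def)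
  show "cyclic_image (M_product n T U) w = cyclic_image (M_product n T' U') w"
    using cyclic_image_M_product[OF n T(1) U(1) w v] cyclic_image_M_product[OF n T(2) U(2) w v']
      U(3) prime_cyclic_wordsD(1,2)[OF c v] by (simp add: same_cyclic_images_def)
qed

lemma UN_UN_const:
  assumes "a \<in> A" "b \<in> B" "\<And>a b. a \<in> A \<Longrightarrow> b \<in> B \<Longrightarrow> F a b = X"
  shows "(\<Union>a\<in>A. \<Union>b\<in>B. F a b) = X"
  using assms by blast

text \<open>The cyclic images of a product depend only on those of its factors, so all sets in the
  union that defines the multiplication are equal.\<close>

lemma mult_M_monoid:
  fixes T U :: "nat transducer"
  assumes n: "n \<ge> 1" and T: "M_transducer n T" and U: "M_transducer n U"
  shows "transducer_class n T \<otimes>\<^bsub>M_monoid n\<^esub> transducer_class n U = transducer_class n (M_product n T U)"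
proof -
  have "transducer_class n (M_product n T' U') = transducer_class n (M_product n T U)"
    if "T' \<in> transducer_class n T" "U' \<in> transducer_class n U" for T' U'
  proof -
    have T': "M_transducer n T'" "same_cyclic_images n T' T"
      and U': "M_transducer n U'" "same_cyclic_images n U' U"
      using that unfolding transducer_class_eq[OF n T] transducer_class_eq[OF n U]
      by (simp_all add: same_cyclic_images_def)
    show ?thesis
      unfolding transducer_class_eq_iff[OF n M_product_M[OF n T'(1) U'(1)] M_product_M[OF n T U]]
      by (rule same_images_M_product[OF n T'(1) T T'(2) U'(1) U U'(2)])
  qed
  then have "(\<Union>T'\<in>transducer_class n T. \<Union>U'\<in>transducer_class n U.
      transducer_class n (M_product n T' U')) = transducer_class n (M_product n T U)"
    by (rule UN_UN_const[OF in_own_class[OF n T] in_own_class[OF n U]])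
  then show ?thesis by (simp add: M_monoid_def)
qed

section \<open>The action on prime cyclic words\<close>

lemma cyclic_action_eq:
  assumes n: "n \<ge> 1" and T: "M_transducer n T" and c: "c \<in> prime_cyclic_words n" and g: "g \<in> c"
  shows "cyclic_action n (transducer_class n T) c = cyclic_image T g"
proof -
  have "(THE d. \<exists>V\<in>transducer_class n T. \<exists>h\<in>c. d = cyclic_image V h) = cyclic_image T g"
  proof (rule the_equality)
    obtain V where V: "V \<in> transducer_class n T" using transducer_class_nonempty[OF T] by blast
    then have "cyclic_image T g = cyclic_image V g"
      using prime_cyclic_wordsD(1,2)[OF c g]
      unfolding transducer_class_eq[OF n T] by (simp add: same_cyclic_images_def)
    then show "\<exists>V\<in>transducer_class n T. \<exists>h\<in>c. cyclic_image T g = cyclic_image V h"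
      using V g by blast
    fix d assume "\<exists>V\<in>transducer_class n T. \<exists>h\<in>c. d = cyclic_image V h"
    then obtain V h where V: "V \<in> transducer_class n T" and h: "h \<in> c" and d: "d = cyclic_image V h" by blast
    have tT: "is_transducer n T" "strongly_synchronizing n T" using M_transducerD[OF T] by simp_all
    have "d = cyclic_image T h"
      using V d prime_cyclic_wordsD(1,2)[OF c h]
      unfolding transducer_class_eq[OF n T] by (simp add: same_cyclic_images_def)
    also have "\<dots> = cyclic_image T g"
      by (rule cyclic_image_rotations[OF tT prime_cyclic_wordsD(1,2)[OF c g]])
        (use h prime_cyclic_wordsD(4)[OF c g] in simp)
    finally show "d = cyclic_image T g" .
  qed
  then show ?thesis using c by (simp add: cyclic_action_def)
qed

lemma cyclic_action_closed:
  assumes n: "n \<ge> 1" and T: "M_transducer n T"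
  shows "cyclic_action n (transducer_class n T) \<in> prime_cyclic_words n \<rightarrow>\<^sub>E prime_cyclic_words n"
proof (rule PiE_I)
  fix c assume c: "c \<in> prime_cyclic_words n"
  obtain g where g: "g \<in> c" using prime_cyclic_words_nonempty[OF c] by blast
  have tT: "is_transducer n T" "strongly_synchronizing n T" using M_transducerD[OF T] by simp_all
  show "cyclic_action n (transducer_class n T) c \<in> prime_cyclic_words n"
    using cyclic_action_eq[OF n T c g]
      cyclic_image_in_prime_cyclic_words[OF tT prime_cyclic_wordsD(1,2)[OF c g]] by simp
qed (simp add: cyclic_action_def)

lemma cyclic_action_mult:
  fixes T U :: "nat transducer"
  assumes n: "n \<ge> 1" and T: "M_transducer n T" and U: "M_transducer n U"
  shows "cyclic_action n (transducer_class n T \<otimes>\<^bsub>M_monoid n\<^esub> transducer_class n U) =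
    compose (prime_cyclic_words n) (cyclic_action n (transducer_class n U))
      (cyclic_action n (transducer_class n T))"
proof
  fix c
  show "cyclic_action n (transducer_class n T \<otimes>\<^bsub>M_monoid n\<^esub> transducer_class n U) c =
    compose (prime_cyclic_words n) (cyclic_action n (transducer_class n U))
      (cyclic_action n (transducer_class n T)) c"
  proof (cases "c \<in> prime_cyclic_words n")
    case c: True
    obtain g where g: "g \<in> c" using prime_cyclic_words_nonempty[OF c] by blast
    note gw = prime_cyclic_wordsD(1,2)[OF c g]
    have tT: "is_transducer n T" "strongly_synchronizing n T" using M_transducerD[OF T] by simp_all
    have d: "cyclic_image T g \<in> prime_cyclic_words n"
      by (rule cyclic_image_in_prime_cyclic_words[OF tT gw])
    obtain v where v: "v \<in> cyclic_image T g" using prime_cyclic_words_nonempty[OF d] by blast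
    have "cyclic_action n (transducer_class n T \<otimes>\<^bsub>M_monoid n\<^esub> transducer_class n U) c =
        cyclic_image (M_product n T U) g"
      unfolding mult_M_monoid[OF n T U] by (rule cyclic_action_eq[OF n M_product_M[OF n T U] c g])
    also have "\<dots> = cyclic_image U v" by (rule cyclic_image_M_product[OF n T U gw v])
    also have "\<dots> = cyclic_action n (transducer_class n U) (cyclic_image T g)"
      by (rule cyclic_action_eq[OF n U d v, symmetric])
    finally show ?thesis using c cyclic_action_eq[OF n T c g] by (simp add: compose_eq)
  qed (simp add: cyclic_action_def compose_def)
qed

lemma cyclic_action_inj:
  fixes T U :: "nat transducer"
  assumes n: "n \<ge> 1" and T: "M_transducer n T" and U: "M_transducer n U"
    and eq: "cyclic_action n (transducer_class n T) = cyclic_action n (transducer_class n U)"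
  shows "transducer_class n T = transducer_class n U"
  unfolding transducer_class_eq_iff[OF n T U] same_cyclic_images_def
proof (intro ballI impI)
  fix w assume w: "w \<in> lists {..<n}" "w \<noteq> []"
  have tT: "is_transducer n T" "strongly_synchronizing n T"
    and tU: "is_transducer n U" "strongly_synchronizing n U"
    using M_transducerD[OF T] M_transducerD[OF U] by simp_all
  have c: "rotations (prime_root w) \<in> prime_cyclic_words n"
    by (rule rotations_in_prime_cyclic_words[OF w])
  have "cyclic_image T (prime_root w) = cyclic_image U (prime_root w)"
    using cyclic_action_eq[OF n T c self_in_rotations] cyclic_action_eq[OF n U c self_in_rotations] eq
    by simp
  then show "cyclic_image T w = cyclic_image U w"
    using cyclic_image_prime_root[OF tT w] cyclic_image_prime_root[OF tU w] by simp
qed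

section \<open>The identity\<close>

lemma identity_runs: "outs identity_transducer w q = w"
  by (induction w arbitrary: q) (auto simp: identity_transducer_def)

lemma identity_is_transducer: "is_transducer n identity_transducer"
  by (simp add: is_transducer_def identity_runs) (simp add: identity_transducer_def)

lemma identity_M:
  assumes n: "n \<ge> 2"
  shows "M_transducer n identity_transducer"
proof -
  have St: "St identity_transducer = {()}" by (simp add: identity_transducer_def)
  have id: "state_map identity_transducer () x = x" if x: "x \<in> inf_words n" for x
    by (rule state_map_cong[OF identity_is_transducer _ x]) (auto simp: St identity_runs)
  have "u = []" if u: "u \<in> common_prefixes n identity_transducer [] ()" for u
  proof (rule ccontr)
    assume "u \<noteq> []"
    \<comment> \<open>Two constant words with different letters have no common prefix. This is where
      an alphabet of at least two letters is needed.\<close>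
    have c: "(\<lambda>_. 0) \<in> inf_words n" "(\<lambda>_. Suc 0) \<in> inf_words n" using n by (auto simp: inf_words_def)
    obtain y z where "(\<lambda>_. 0) = u \<frown> y" "(\<lambda>_. Suc 0) = u \<frown> z"
      using u c id unfolding in_common_prefixes_iff by (metis conc_empty)
    then have "u ! 0 = 0" "u ! 0 = Suc 0" using \<open>u \<noteq> []\<close> by (metis conc_fst length_greater_0_conv)+
    then show False by simp
  qed
  then have "\<not> incomplete_response n identity_transducer ()" by (simp add: complete_response_iff)
  moreover have "is_core n identity_transducer" "strongly_synchronizing n identity_transducer"
    using one_state_sync_core[OF identity_is_transducer] St by blast+
  ultimately show ?thesis
    using core_strongly_connected[of n identity_transducer] identity_is_transducer[of n]
    by (simp add: M_transducer_def minimal_transducer_def weakly_minimal_def St)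
qed

lemma cyclic_action_one:
  assumes n: "n \<ge> 2"
  shows "cyclic_action n (transducer_class n identity_transducer) = (\<lambda>c\<in>prime_cyclic_words n. c)"
proof
  fix c
  show "cyclic_action n (transducer_class n identity_transducer) c = (\<lambda>c\<in>prime_cyclic_words n. c) c"
  proof (cases "c \<in> prime_cyclic_words n")
    case c: True
    obtain g where g: "g \<in> c" using prime_cyclic_words_nonempty[OF c] by blast
    show ?thesis
      using cyclic_action_eq[OF _ identity_M[OF n] c g] n c prime_cyclic_wordsD[OF c g]
      by (simp add: cyclic_image_def identity_runs prime_root_prime)
  qed (simp add: cyclic_action_def)
qed

section \<open>Monoid laws\<close>

lemma transformation_monoid_is_monoid: "Group.monoid (transformation_monoid W)"
proof (rule Group.monoidI)
  fix f g h :: "'a \<Rightarrow> 'a"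
  assume f: "f \<in> carrier (transformation_monoid W)" and g: "g \<in> carrier (transformation_monoid W)"
    and h: "h \<in> carrier (transformation_monoid W)"
  have "f \<in> W \<rightarrow> W" using f by (auto simp: transformation_monoid_def)
  then show "f \<otimes>\<^bsub>transformation_monoid W\<^esub> g \<otimes>\<^bsub>transformation_monoid W\<^esub> h =
      f \<otimes>\<^bsub>transformation_monoid W\<^esub> (g \<otimes>\<^bsub>transformation_monoid W\<^esub> h)"
    by (auto simp: transformation_monoid_def compose_def Pi_iff intro!: restrict_ext)
next
  fix f assume f: "f \<in> carrier (transformation_monoid W)"
  then have "f \<in> W \<rightarrow> W" "f \<in> extensional W" by (auto simp: transformation_monoid_def PiE_def)
  then show "\<one>\<^bsub>transformation_monoid W\<^esub> \<otimes>\<^bsub>transformation_monoid W\<^esub> f = f"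
    "f \<otimes>\<^bsub>transformation_monoid W\<^esub> \<one>\<^bsub>transformation_monoid W\<^esub> = f"
    by (simp_all add: transformation_monoid_def compose_Id Id_compose)
qed (auto simp: transformation_monoid_def compose_def)

text \<open>Associativity and the unit laws are pulled back from \<open>H\<close>. Applied to the
  action, this avoids comparing iterated reductions of products.\<close>

lemma inj_hom_monoid:
  assumes H: "Group.monoid H" and f: "f \<in> hom G H" "inj_on f (carrier G)"
    and closed: "\<And>x y. x \<in> carrier G \<Longrightarrow> y \<in> carrier G \<Longrightarrow> x \<otimes>\<^bsub>G\<^esub> y \<in> carrier G"
    and one: "\<one>\<^bsub>G\<^esub> \<in> carrier G" "f \<one>\<^bsub>G\<^esub> = \<one>\<^bsub>H\<^esub>"
  shows "Group.monoid G"
proof -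
  interpret H: Group.monoid H by fact
  have fc: "f x \<in> carrier H" if "x \<in> carrier G" for x using f(1) that by (auto simp: hom_def)
  have fm: "f (x \<otimes>\<^bsub>G\<^esub> y) = f x \<otimes>\<^bsub>H\<^esub> f y" if "x \<in> carrier G" "y \<in> carrier G" for x y
    using f(1) that by (auto simp: hom_def)
  show ?thesis
  proof (rule Group.monoidI)
    fix x y z assume x: "x \<in> carrier G" and y: "y \<in> carrier G" and z: "z \<in> carrier G"
    show "x \<otimes>\<^bsub>G\<^esub> y \<otimes>\<^bsub>G\<^esub> z = x \<otimes>\<^bsub>G\<^esub> (y \<otimes>\<^bsub>G\<^esub> z)"
      by (rule inj_onD[OF f(2)]) (use x y z closed fc fm H.m_assoc in simp_all)
  next
    fix x assume x: "x \<in> carrier G"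
    show "\<one>\<^bsub>G\<^esub> \<otimes>\<^bsub>G\<^esub> x = x" by (rule inj_onD[OF f(2)]) (use x one closed fc fm in simp_all)
    show "x \<otimes>\<^bsub>G\<^esub> \<one>\<^bsub>G\<^esub> = x" by (rule inj_onD[OF f(2)]) (use x one closed fc fm in simp_all)
  qed (use closed one in auto)
qed

lemma M_monoid_closed:
  assumes "n \<ge> 1" "A \<in> carrier (M_monoid n)" "B \<in> carrier (M_monoid n)"
  shows "A \<otimes>\<^bsub>M_monoid n\<^esub> B \<in> carrier (M_monoid n)"
  using assms(2,3) mult_M_monoid[OF assms(1)] class_in_carrier[OF assms(1) M_product_M[OF assms(1)]]
  unfolding carrier_M_monoid[of A] carrier_M_monoid[of B] by auto

lemma M_monoid_one:
  assumes "n \<ge> 2"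
  shows "\<one>\<^bsub>M_monoid n\<^esub> \<in> carrier (M_monoid n)"
    "cyclic_action n \<one>\<^bsub>M_monoid n\<^esub> = \<one>\<^bsub>transformation_monoid (prime_cyclic_words n)\<^esub>"
proof -
  have one: "\<one>\<^bsub>M_monoid n\<^esub> = transducer_class n identity_transducer" by (simp add: M_monoid_def)
  show "\<one>\<^bsub>M_monoid n\<^esub> \<in> carrier (M_monoid n)"
    unfolding one by (rule class_in_carrier) (use assms identity_M in auto)
  show "cyclic_action n \<one>\<^bsub>M_monoid n\<^esub> = \<one>\<^bsub>transformation_monoid (prime_cyclic_words n)\<^esub>"
    unfolding one by (simp add: cyclic_action_one[OF assms] transformation_monoid_def)
qed

lemma cyclic_action_mon:
  assumes n: "n \<ge> 1"
  shows "cyclic_action n \<in> mon (M_monoid n) (transformation_monoid (prime_cyclic_words n))"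
  unfolding mon_def
proof (intro CollectI conjI homI)
  fix A B assume A: "A \<in> carrier (M_monoid n)" and B: "B \<in> carrier (M_monoid n)"
  obtain T :: "nat transducer" where T: "M_transducer n T" "A = transducer_class n T"
    using A carrier_M_monoid by blast
  obtain U :: "nat transducer" where U: "M_transducer n U" "B = transducer_class n U"
    using B carrier_M_monoid by blast
  show "cyclic_action n A \<in> carrier (transformation_monoid (prime_cyclic_words n))"
    using cyclic_action_closed[OF n T(1)] T(2) by (simp add: transformation_monoid_def)
  show "cyclic_action n (A \<otimes>\<^bsub>M_monoid n\<^esub> B) =
      cyclic_action n A \<otimes>\<^bsub>transformation_monoid (prime_cyclic_words n)\<^esub> cyclic_action n B"
    using cyclic_action_mult[OF n T(1) U(1)] T(2) U(2) by (simp add: transformation_monoid_def)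
next
  show "inj_on (cyclic_action n) (carrier (M_monoid n))"
  proof (rule inj_onI)
    fix A B assume "A \<in> carrier (M_monoid n)" "B \<in> carrier (M_monoid n)"
      and eq: "cyclic_action n A = cyclic_action n B"
    then obtain T U :: "nat transducer" where "M_transducer n T" "A = transducer_class n T"
      "M_transducer n U" "B = transducer_class n U" unfolding carrier_M_monoid by blast
    then show "A = B" using cyclic_action_inj[OF n] eq by simp
  qed
qed

lemma M_monoid_is_monoid:
  assumes n: "n \<ge> 2"
  shows "Group.monoid (M_monoid n)"
proof (rule inj_hom_monoid[OF transformation_monoid_is_monoid])
  have n1: "n \<ge> 1" using n by simp
  show "cyclic_action n \<in> hom (M_monoid n) (transformation_monoid (prime_cyclic_words n))"
    "inj_on (cyclic_action n) (carrier (M_monoid n))"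
    using cyclic_action_mon[OF n1] by (auto simp: mon_def)
qed (use M_monoid_closed M_monoid_one n in auto)


section \<open>Equal transducers are isomorphic\<close>

text \<open>Complete response makes the outputs on one letter equal and the successors equivalent,
  and weak minimality then identifies the successor. Mixed cases cannot occur, since incomplete
  response depends only on the induced map; two constant outputs agree because prime words with the
  same infinite power are equal.\<close>

lemma transducer_eq_hom:
  assumes n: "n \<ge> 1" and T: "M_transducer n T" and U: "M_transducer n U"
    and f: "bij_betw f (St T) (St U)" "\<And>q. q \<in> St T \<Longrightarrow> omega_equiv n T q U (f q)"
  shows "transducer_hom n f T U"
proof -
  have tT: "is_transducer n T" and tU: "is_transducer n U"
    using M_transducerD[OF T] M_transducerD[OF U] by simp_all
  have fS: "f q \<in> St U" if "q \<in> St T" for q using f(1) that bij_betwE by blast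
  have resp: "incomplete_response n U (f q) \<longleftrightarrow> incomplete_response n T q" if "q \<in> St T" for q
  proof -
    have "common_prefixes n U [] (f q) = common_prefixes n T [] q"
      unfolding common_prefixes_def using f(2)[OF that] by (auto simp: omega_equiv_def)
    then show ?thesis by (simp add: incomplete_response_def extent_def)
  qed
  obtain p where p: "p \<in> St T" using St_nonempty[OF tT] by blast
  have "\<not> ((\<forall>q\<in>St T. \<not> incomplete_response n T q) \<and> is_Z_transducer n x U)" for x
    using Z_transducer_incomplete[OF tU _ n fS[OF p]] resp[OF p] p by blast
  moreover have "\<not> ((\<forall>q\<in>St U. \<not> incomplete_response n U q) \<and> is_Z_transducer n x T)" for x
    using Z_transducer_incomplete[OF tT _ n p] resp[OF p] fS[OF p] by blast
  ultimately consider
    "\<forall>q\<in>St T. \<not> incomplete_response n T q" "weakly_minimal n U" "\<forall>q\<in>St U. \<not> incomplete_response n U q"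
    | x y where "is_Z_transducer n x T" "is_Z_transducer n y U" "prime_word x" "prime_word y"
    using T U unfolding M_transducer_def minimal_transducer_def least_prime_word_def by metis
  then have "step U a (f q) = f (step T a q) \<and> out U a (f q) = out T a q"
    if a: "a < n" and q: "q \<in> St T" for a q
  proof cases
    case 1
    have aw: "[a] \<in> lists {..<n}" using a by simp
    have St: "step T a q \<in> St T" "step U a (f q) \<in> St U"
      using tT tU a q fS[OF q] by (simp_all add: is_transducer_def)
    have "out T a q = out U a (f q) \<and> omega_equiv n T (step T a q) U (step U a (f q))"
    proof (rule complete_response_conc_eq[OF _ _ _ n])
      show "\<not> incomplete_response n T (step T a q)" "\<not> incomplete_response n U (step U a (f q))"
        using 1 St by blast+
      fix x assume x: "x \<in> inf_words n"
      have "state_map T q ([a] \<frown> x) = state_map U (f q) ([a] \<frown> x)"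
        using f(2)[OF q] inf_words_conc[OF aw x] by (simp add: omega_equiv_def del: build_cons)
      then show "out T a q \<frown> state_map T (step T a q) x = out U a (f q) \<frown> state_map U (step U a (f q)) x"
        using state_map_conc[OF tT q aw x] state_map_conc[OF tU fS[OF q] aw x]
        by (simp del: build_cons)
    qed
    moreover have "omega_equiv n T (step T a q) U (f (step T a q))" by (rule f(2)[OF St(1)])
    ultimately have "out T a q = out U a (f q)" "omega_equiv n U (step U a (f q)) U (f (step T a q))"
      by (simp_all add: omega_equiv_def)
    then show ?thesis using 1(2) St(2) fS[OF St(1)] by (auto simp: weakly_minimal_def)
  next
    case 2
    have z: "(\<lambda>_. 0) \<in> inf_words n" by (rule inf_words_nonempty[OF n])
    have "x\<^sup>\<omega> = y\<^sup>\<omega>"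
      using state_map_Z_transducer[OF tT 2(1) n q z] state_map_Z_transducer[OF tU 2(2) n fS[OF q] z]
        f(2)[OF q] z by (simp add: omega_equiv_def)
    then have "x = y"
      using iter_eq_prime_root[of x y] 2(3,4) prime_root_prime[OF 2(3)] prime_root_prime[OF 2(4)]
        prime_word_not_Nil[OF 2(3)] prime_word_not_Nil[OF 2(4)] by simp
    then show ?thesis using 2(1,2) a q fS[OF q] by (auto simp: is_Z_transducer_def)
  qed
  moreover have "f ` St T = St U" using f(1) by (simp add: bij_betw_def)
  ultimately show ?thesis unfolding transducer_hom_def by blast
qed

lemma transducer_eq_L:
  assumes n: "n \<ge> 1" and T: "L_transducer n T" and U: "M_transducer n U" and eq: "transducer_eq n T U"
  shows "L_transducer n U"
  unfolding L_transducer_def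
proof (intro conjI ballI impI)
  show "M_transducer n U" by fact
  have MT: "M_transducer n T" using T by (simp add: L_transducer_def)
  have tT: "is_transducer n T" "strongly_synchronizing n T" using M_transducerD[OF MT] by simp_all
  obtain f where f: "bij_betw f (St T) (St U)" "\<And>q. q \<in> St T \<Longrightarrow> omega_equiv n T q U (f q)"
    using eq by (auto simp: transducer_eq_def)
  note hom = transducer_eq_hom[OF n MT U f]
  fix w q assume w: "w \<in> lists {..<n}" "q \<in> St U" "steps U w q = q"
  then obtain p where p: "p \<in> St T" "q = f p" using f(1) by (auto simp: bij_betw_def)
  have "f (steps T w p) = f p" using hom_runs(1)[OF tT hom w(1) p(1)] w(3) p(2) by simp
  then have "steps T w p = p"
    using inj_onD[OF bij_betw_imp_inj_on[OF f(1)] _ steps_in_St[OF tT(1) w(1) p(1)] p(1)] by blast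
  then have "length (outs T w p) = length w" using T w(1) p(1) by (auto simp: L_transducer_def)
  then show "length (outs U w q) = length w" using hom_runs(2)[OF tT hom w(1) p(1)] p(2) by simp
qed

lemma L_class_in_L_set:
  assumes n: "n \<ge> 1" and R: "L_transducer n R"
  shows "transducer_class n R \<in> L_set n"
proof -
  have M: "M_transducer n R" using R by (simp add: L_transducer_def)
  obtain V :: "nat transducer" where V: "M_transducer n V" "transducer_eq n R V"
    using nat_representative_exists[OF M] by blast
  have "V \<in> transducer_class n R" using V by (simp add: transducer_class_def)
  then have "transducer_class n V = transducer_class n R" using in_class_eq[OF n M] by blast
  moreover have "L_transducer n V" by (rule transducer_eq_L[OF n R V])
  ultimately show ?thesis by (auto simp: L_set_def)
qed

lemma L_set_submonoid:
  assumes n: "n \<ge> 2"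
  shows "submonoid (L_set n) (M_monoid n)"
proof
  have n1: "n \<ge> 1" using n by simp
  show "L_set n \<subseteq> carrier (M_monoid n)"
    by (auto simp: L_set_def M_monoid_def L_transducer_def)
  have "L_transducer n identity_transducer"
    using identity_M[OF n] by (simp add: L_transducer_def identity_runs)
  then show "\<one>\<^bsub>M_monoid n\<^esub> \<in> L_set n"
    using L_class_in_L_set[OF n1] by (simp add: M_monoid_def)
  fix A B assume "A \<in> L_set n" "B \<in> L_set n"
  then obtain T U :: "nat transducer" where T: "L_transducer n T" "A = transducer_class n T"
    and U: "L_transducer n U" "B = transducer_class n U" by (auto simp: L_set_def)
  have M: "M_transducer n T" "M_transducer n U" using T U by (simp_all add: L_transducer_def)
  have "L_transducer n (M_product n T U)"
  proof (rule reduction_L[OF n1 M_product_core[OF n1 M]])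
    fix w r assume w: "w \<in> lists {..<n}" "r \<in> St (core n (transducer_prod T U))"
      "steps (core n (transducer_prod T U)) w r = r"
    have tT: "is_transducer n T" and tU: "is_transducer n U"
      using M_transducerD[OF M(1)] M_transducerD[OF M(2)] by simp_all
    obtain p q where r: "r = (p, q)" by force
    have "r \<in> St T \<times> St U"
      using w(2) core_subset[OF prod_is_transducer[OF tT tU]] by (auto simp: St_transducer_prod)
    then have p: "p \<in> St T" "steps T w p = p" and q: "q \<in> St U" "steps U (outs T w p) q = q"
      using w(3) r by (auto simp: steps_transducer_prod)
    \<comment> \<open>A loop of the product is a loop of \<open>T\<close> whose output is a loop of
      \<open>U\<close>, so the two length conditions compose.\<close>
    have "length (outs T w p) = length w" using T(1) w(1) p by (auto simp: L_transducer_def)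
    moreover have "length (outs U (outs T w p) q) = length (outs T w p)"
      using U(1) outs_in_lists[OF tT w(1) p(1)] q by (auto simp: L_transducer_def)
    ultimately show "length (outs (core n (transducer_prod T U)) w r) = length w"
      by (simp add: r outs_transducer_prod)
  qed
  then show "A \<otimes>\<^bsub>M_monoid n\<^esub> B \<in> L_set n"
    using mult_M_monoid[OF n1 M] L_class_in_L_set[OF n1] T(2) U(2) by simp
qed


section \<open>Endomorphisms of the full shift\<close>

lemma Xz_iff: "x \<in> Xz n \<longleftrightarrow> (\<forall>i. x i < n)"
  by (auto simp: full_shift_def PiE_iff)

lemma shift_power_apply: "x \<in> Xz n \<Longrightarrow> shift_power n k x = (\<lambda>i. x (i - k))"
  by (simp add: shift_power_def)

lemma shift_power_in: "x \<in> Xz n \<Longrightarrow> shift_power n k x \<in> Xz n"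
  by (simp add: shift_power_apply) (simp add: Xz_iff)

lemma shift_power_add: "x \<in> Xz n \<Longrightarrow> shift_power n j (shift_power n k x) = shift_power n (j + k) x"
  using shift_power_in[of x n k] by (simp add: shift_power_apply algebra_simps)

lemma openin_cylinder:
  assumes x: "x \<in> Xz n" and I: "finite I"
  shows "openin (full_shift n) {y \<in> Xz n. \<forall>i\<in>I. y i = x i}"
proof -
  define S where "S i = (if i \<in> I then {x i} else {..<n})" for i
  have eq: "{y \<in> Xz n. \<forall>i\<in>I. y i = x i} = PiE UNIV S"
    using x by (auto simp: Xz_iff PiE_iff S_def split: if_splits)
  have "finite {i \<in> UNIV. S i \<noteq> topspace (discrete_topology {..<n})}"
    by (rule finite_subset[OF _ I]) (auto simp: S_def)
  moreover have "\<forall>i\<in>UNIV. openin (discrete_topology {..<n}) (S i)"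
    using x by (auto simp: S_def Xz_iff)
  ultimately have "openin (full_shift n) (PiE UNIV S)"
    unfolding full_shift_def openin_PiE_gen by blast
  then show ?thesis by (simp only: eq)
qed

text \<open>Continuity into a product is tested on coordinates, and a preimage is open because it
  contains a cylinder around each of its points.\<close>

lemma continuous_map_if_local:
  assumes F: "\<And>x. x \<in> Xz n \<Longrightarrow> F x \<in> Xz n"
    and loc: "\<And>j. \<exists>I. finite I \<and> (\<forall>x\<in>Xz n. \<forall>y\<in>Xz n. (\<forall>i\<in>I. y i = x i) \<longrightarrow> F y j = F x j)"
  shows "continuous_map (full_shift n) (full_shift n) F"
proof -
  have "continuous_map (full_shift n) (discrete_topology {..<n}) (\<lambda>x. F x j)" for j
    unfolding continuous_map_def
  proof (intro conjI allI impI)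
    show "(\<lambda>x. F x j) \<in> Xz n \<rightarrow> topspace (discrete_topology {..<n})"
      using F by (auto simp: Xz_iff)
    fix U :: "nat set"
    obtain I where I: "finite I" "\<And>x y. x \<in> Xz n \<Longrightarrow> y \<in> Xz n \<Longrightarrow> \<forall>i\<in>I. y i = x i \<Longrightarrow> F y j = F x j"
      using loc[of j] by blast
    show "openin (full_shift n) {x \<in> Xz n. F x j \<in> U}"
    proof (subst openin_subopen, intro ballI)
      fix x assume x: "x \<in> {x \<in> Xz n. F x j \<in> U}"
      let ?C = "{y \<in> Xz n. \<forall>i\<in>I. y i = x i}"
      have "openin (full_shift n) ?C" using openin_cylinder x I(1) by blast
      moreover have "?C \<subseteq> {x \<in> Xz n. F x j \<in> U}"
      proof
        fix y assume y: "y \<in> ?C"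
        then have "F y j = F x j" using I(2)[of x y] x by simp
        then show "y \<in> {x \<in> Xz n. F x j \<in> U}" using x y by simp
      qed
      ultimately show "\<exists>C. openin (full_shift n) C \<and> x \<in> C \<and> C \<subseteq> {x \<in> Xz n. F x j \<in> U}"
        using x by (intro exI[of _ ?C]) simp
    qed
  qed
  then show ?thesis
    by (subst (2) full_shift_def) (simp add: continuous_map_componentwise_UNIV)
qed

lemma compact_full_shift: "compact_space (full_shift n)"
proof -
  have "compact_space (discrete_topology {..<n})"
    unfolding compact_space_def by (rule finite_imp_compactin) auto
  then show ?thesis unfolding full_shift_def compact_space_product_topology by blast
qed

text \<open>This is the Curtis--Hedlund--Lyndon theorem.\<close>

lemma local_if_continuous_map:
  assumes F: "continuous_map (full_shift n) (full_shift n) F"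
  shows "\<exists>I. finite I \<and> (\<forall>x\<in>Xz n. \<forall>y\<in>Xz n. (\<forall>i\<in>I. y i = x i) \<longrightarrow> F y j = F x j)"
proof -
  have cont: "continuous_map (full_shift n) (discrete_topology {..<n}) (\<lambda>x. F x j)"
    using F by (subst (asm) (2) full_shift_def) (simp add: continuous_map_componentwise_UNIV)
  have Fj: "F x j < n" if "x \<in> Xz n" for x
    using continuous_map_image_subset_topspace[OF cont] that by auto
  have "\<exists>I. finite I \<and> (\<forall>y\<in>Xz n. (\<forall>i\<in>I. y i = x i) \<longrightarrow> F y j = F x j)" if x: "x \<in> Xz n" for x
  proof -
    have "openin (full_shift n) {y \<in> Xz n. F y j \<in> {F x j}}"
      by (rule openin_continuous_map_preimage[OF cont]) (use Fj[OF x] in simp)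
    then obtain U where U: "finite {i. U i \<noteq> {..<n}}" "x \<in> PiE UNIV U"
      "PiE UNIV U \<subseteq> {y \<in> Xz n. F y j \<in> {F x j}}"
      using x unfolding full_shift_def openin_product_topology_alt by auto
    have "F y j = F x j" if y: "y \<in> Xz n" "\<forall>i\<in>{i. U i \<noteq> {..<n}}. y i = x i" for y
    proof -
      have "y i \<in> U i" for i
        using y U(2) by (cases "U i = {..<n}") (auto simp: Xz_iff PiE_iff)
      then have "y \<in> PiE UNIV U" by (simp add: PiE_iff)
      then show ?thesis using U(3) by blast
    qed
    then show ?thesis using U(1) by blast
  qed
  then obtain I where I: "\<And>x. x \<in> Xz n \<Longrightarrow> finite (I x)"
    "\<And>x y. x \<in> Xz n \<Longrightarrow> y \<in> Xz n \<Longrightarrow> \<forall>i\<in>I x. y i = x i \<Longrightarrow> F y j = F x j"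
    by metis
  \<comment> \<open>The finite set \<open>I x\<close> still depends on \<open>x\<close>. Finitely
    many of these cylinders cover the compact space, and the union of their supports serves all
    points.\<close>
  define C where "C x = {y \<in> Xz n. \<forall>i\<in>I x. y i = x i}" for x
  have "\<forall>U\<in>C ` Xz n. openin (full_shift n) U" using openin_cylinder I(1) by (auto simp: C_def)
  moreover have "Xz n \<subseteq> \<Union>(C ` Xz n)" by (auto simp: C_def)
  ultimately obtain \<F> where \<F>: "finite \<F>" "\<F> \<subseteq> C ` Xz n" "Xz n \<subseteq> \<Union>\<F>"
    using compact_full_shift[of n] unfolding compact_space_alt by meson
  then obtain D where D: "D \<subseteq> Xz n" "finite D" "\<F> = C ` D" using finite_subset_image by metis
  have "F y j = F x j" if x: "x \<in> Xz n" and y: "y \<in> Xz n" and xy: "\<forall>i\<in>\<Union>(I ` D). y i = x i" for x y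
  proof -
    obtain z where z: "z \<in> D" "x \<in> C z" using \<F>(3) D(3) x by blast
    then have zX: "z \<in> Xz n" using D(1) by blast
    have xz: "\<forall>i\<in>I z. x i = z i" using z(2) by (simp add: C_def)
    then have "\<forall>i\<in>I z. y i = z i" using xy z(1) by simp
    then show ?thesis using I(2)[OF zX y] I(2)[OF zX x xz] by simp
  qed
  moreover have "finite (\<Union>(I ` D))" using D I(1) by blast
  ultimately show ?thesis by blast
qed

section \<open>Endomorphisms and the congruence generated by the shift\<close>

lemma shift_EndD:
  assumes "\<phi> \<in> shift_End n"
  shows "\<phi> \<in> extensional (Xz n)" "continuous_map (full_shift n) (full_shift n) \<phi>"
    "\<And>x. x \<in> Xz n \<Longrightarrow> \<phi> x \<in> Xz n"
  using assms continuous_map_image_subset_topspace[of "full_shift n" "full_shift n" \<phi>]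
  by (auto simp: shift_End_def)

lemma shift_End_commutes:
  assumes \<phi>: "\<phi> \<in> shift_End n" and x: "x \<in> Xz n"
  shows "\<phi> (shift_power n k x) = shift_power n k (\<phi> x)"
proof -
  have nat: "\<phi> (shift_power n (int m) x) = shift_power n (int m) (\<phi> x)" if x: "x \<in> Xz n" for m x
  proof (induction m)
    case 0
    then show ?case using x shift_EndD(3)[OF \<phi> x] by (simp add: shift_power_apply)
  next
    case (Suc m)
    have "\<phi> (shift_power n (int (Suc m)) x) = \<phi> (shift_power n 1 (shift_power n (int m) x))"
      using shift_power_add[OF x] by simp
    also have "\<dots> = shift_power n 1 (\<phi> (shift_power n (int m) x))"
      using \<phi> shift_power_in[OF x] by (simp add: shift_End_def)
    also have "\<dots> = shift_power n (int (Suc m)) (\<phi> x)"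
      using Suc shift_power_add[OF shift_EndD(3)[OF \<phi> x]] by simp
    finally show ?case .
  qed
  show ?thesis
  proof (cases "k \<ge> 0")
    case True
    then show ?thesis using nat[OF x, of "nat k"] by simp
  next
    case False
    define y where "y = shift_power n k x"
    have y: "y \<in> Xz n" using shift_power_in[OF x] by (simp add: y_def)
    have "x = shift_power n (- k) y"
      using shift_power_add[OF x, of "- k" k] x by (simp add: y_def shift_power_apply)
    then have "\<phi> x = shift_power n (- k) (\<phi> y)" using nat[OF y, of "nat (- k)"] False by simp
    then have "shift_power n k (\<phi> x) = \<phi> y"
      using shift_power_add[OF shift_EndD(3)[OF \<phi> y], of k "- k"] shift_EndD(3)[OF \<phi> y]
      by (simp add: shift_power_apply)
    then show ?thesis by (simp add: y_def)
  qed
qed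

lemma shift_End_compose:
  assumes \<phi>: "\<phi> \<in> shift_End n" and \<psi>: "\<psi> \<in> shift_End n"
  shows "compose (Xz n) \<psi> \<phi> \<in> shift_End n"
proof -
  have "continuous_map (full_shift n) (full_shift n) (\<psi> \<circ> \<phi>)"
    using shift_EndD(2)[OF \<phi>] shift_EndD(2)[OF \<psi>] continuous_map_compose by blast
  then have "continuous_map (full_shift n) (full_shift n) (compose (Xz n) \<psi> \<phi>)"
    by (rule continuous_map_eq) (simp add: compose_def)
  moreover have "compose (Xz n) \<psi> \<phi> (shift_power n 1 x) = shift_power n 1 (compose (Xz n) \<psi> \<phi> x)"
    if "x \<in> Xz n" for x
    using that shift_power_in[OF that] shift_End_commutes[OF \<phi> that]
      shift_End_commutes[OF \<psi> shift_EndD(3)[OF \<phi> that]] by (simp add: compose_eq)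
  ultimately show ?thesis by (simp add: shift_End_def compose_extensional)
qed

lemma shift_power_End: "shift_power n k \<in> shift_End n"
proof -
  have "continuous_map (full_shift n) (full_shift n) (shift_power n k)"
  proof (rule continuous_map_if_local)
    fix j
    show "\<exists>I. finite I \<and> (\<forall>x\<in>Xz n. \<forall>y\<in>Xz n. (\<forall>i\<in>I. y i = x i) \<longrightarrow>
        shift_power n k y j = shift_power n k x j)"
      by (intro exI[of _ "{j - k}"]) (simp add: shift_power_apply)
  qed (rule shift_power_in)
  then show ?thesis
    by (auto simp: shift_End_def shift_power_add add.commute) (simp add: shift_power_def)
qed

lemma shift_power_0: "shift_power n 0 = (\<lambda>x\<in>Xz n. x)"
  by (auto simp: shift_power_def)

lemma identity_End: "(\<lambda>x\<in>Xz n. x) \<in> shift_End n"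
  using shift_power_End[of n 0] by (simp add: shift_power_0)

lemma shift_congruence_iff:
  assumes \<phi>: "\<phi> \<in> shift_End n" and \<psi>: "\<psi> \<in> shift_End n"
  shows "(\<phi>, \<psi>) \<in> shift_congruence n \<longleftrightarrow> (\<exists>i. \<forall>x\<in>Xz n. \<phi> x = shift_power n i (\<psi> x))"
proof -
  have "\<phi> = compose (Xz n) \<psi> (shift_power n i) \<longleftrightarrow> (\<forall>x\<in>Xz n. \<phi> x = shift_power n i (\<psi> x))" for i
  proof
    assume "\<phi> = compose (Xz n) \<psi> (shift_power n i)"
    then show "\<forall>x\<in>Xz n. \<phi> x = shift_power n i (\<psi> x)"
      using shift_End_commutes[OF \<psi>] by (simp add: compose_eq)
  next
    assume "\<forall>x\<in>Xz n. \<phi> x = shift_power n i (\<psi> x)"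
    then show "\<phi> = compose (Xz n) \<psi> (shift_power n i)"
      using shift_EndD(1)[OF \<phi>] shift_End_commutes[OF \<psi>]
      by (intro extensionalityI[of _ "Xz n"]) (auto simp: compose_eq compose_extensional)
  qed
  then show ?thesis using assms by (simp add: shift_congruence_def)
qed

lemma equiv_shift_congruence: "equiv (shift_End n) (shift_congruence n)"
proof (rule equivI)
  show "shift_congruence n \<subseteq> shift_End n \<times> shift_End n" by (auto simp: shift_congruence_def)
  show "refl_on (shift_End n) (shift_congruence n)"
  proof (rule refl_onI)
    fix \<phi> assume \<phi>: "\<phi> \<in> shift_End n"
    show "(\<phi>, \<phi>) \<in> shift_congruence n"
      unfolding shift_congruence_iff[OF \<phi> \<phi>]
      by (intro exI[of _ 0]) (simp add: shift_power_0 shift_EndD(3)[OF \<phi>])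
  qed
  show "sym (shift_congruence n)"
  proof (rule symI)
    fix \<phi> \<psi> assume c: "(\<phi>, \<psi>) \<in> shift_congruence n"
    then have E: "\<phi> \<in> shift_End n" "\<psi> \<in> shift_End n" by (auto simp: shift_congruence_def)
    then obtain i where i: "\<forall>x\<in>Xz n. \<phi> x = shift_power n i (\<psi> x)" using c shift_congruence_iff by blast
    have "\<psi> x = shift_power n (- i) (\<phi> x)" if "x \<in> Xz n" for x
      using i that shift_power_add[OF shift_EndD(3)[OF E(2) that], of "- i" i] shift_EndD(3)[OF E(2) that]
      by (simp add: shift_power_0)
    then show "(\<psi>, \<phi>) \<in> shift_congruence n" using shift_congruence_iff[OF E(2,1)] by blast
  qed
  show "trans (shift_congruence n)"
  proof (rule transI)
    fix \<phi> \<psi> \<chi> assume c: "(\<phi>, \<psi>) \<in> shift_congruence n" "(\<psi>, \<chi>) \<in> shift_congruence n"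
    then have E: "\<phi> \<in> shift_End n" "\<psi> \<in> shift_End n" "\<chi> \<in> shift_End n" by (auto simp: shift_congruence_def)
    obtain i where i: "\<forall>x\<in>Xz n. \<phi> x = shift_power n i (\<psi> x)" using c(1) shift_congruence_iff E by blast
    obtain j where j: "\<forall>x\<in>Xz n. \<psi> x = shift_power n j (\<chi> x)" using c(2) shift_congruence_iff E by blast
    have "\<forall>x\<in>Xz n. \<phi> x = shift_power n (i + j) (\<chi> x)"
      using i j shift_power_add[OF shift_EndD(3)[OF E(3)]] by simp
    then show "(\<phi>, \<chi>) \<in> shift_congruence n" using shift_congruence_iff[OF E(1,3)] by blast
  qed
qed

lemma shift_class_eq_iff:
  assumes "\<phi> \<in> shift_End n" "\<psi> \<in> shift_End n"
  shows "shift_class n \<phi> = shift_class n \<psi> \<longleftrightarrow> (\<exists>i. \<forall>x\<in>Xz n. \<phi> x = shift_power n i (\<psi> x))"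
  using eq_equiv_class_iff[OF equiv_shift_congruence assms] shift_congruence_iff[OF assms] by simp

lemma in_shift_class_iff:
  assumes "\<phi> \<in> shift_End n"
  shows "\<psi> \<in> shift_class n \<phi> \<longleftrightarrow> \<psi> \<in> shift_End n \<and> (\<exists>i. \<forall>x\<in>Xz n. \<phi> x = shift_power n i (\<psi> x))"
proof (cases "\<psi> \<in> shift_End n")
  case True
  then show ?thesis using shift_congruence_iff[OF assms True] by simp
qed (auto simp: shift_congruence_def)

lemma self_in_shift_class: "\<phi> \<in> shift_End n \<Longrightarrow> \<phi> \<in> shift_class n \<phi>"
  by (rule equiv_class_self[OF equiv_shift_congruence])

lemma shift_class_compose_cong:
  assumes E: "\<phi> \<in> shift_End n" "\<phi>' \<in> shift_End n" "\<psi> \<in> shift_End n" "\<psi>' \<in> shift_End n"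
    and eq: "shift_class n \<phi> = shift_class n \<phi>'" "shift_class n \<psi> = shift_class n \<psi>'"
  shows "shift_class n (compose (Xz n) \<psi> \<phi>) = shift_class n (compose (Xz n) \<psi>' \<phi>')"
proof -
  obtain i where i: "\<forall>x\<in>Xz n. \<phi> x = shift_power n i (\<phi>' x)" using eq(1) shift_class_eq_iff[OF E(1,2)] by blast
  obtain j where j: "\<forall>x\<in>Xz n. \<psi> x = shift_power n j (\<psi>' x)" using eq(2) shift_class_eq_iff[OF E(3,4)] by blast
  have "compose (Xz n) \<psi> \<phi> x = shift_power n (i + j) (compose (Xz n) \<psi>' \<phi>' x)" if x: "x \<in> Xz n" for x
  proof -
    note p = shift_EndD(3)[OF E(2) x]
    have "compose (Xz n) \<psi> \<phi> x = \<psi> (shift_power n i (\<phi>' x))" using x i by (simp add: compose_eq)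
    also have "\<dots> = shift_power n i (shift_power n j (\<psi>' (\<phi>' x)))"
      using shift_End_commutes[OF E(3) p] j p by simp
    finally show ?thesis
      using shift_power_add[OF shift_EndD(3)[OF E(4) p]] x by (simp add: compose_eq)
  qed
  then show ?thesis
    using shift_class_eq_iff[OF shift_End_compose[OF E(1,3)] shift_End_compose[OF E(2,4)]] by blast
qed

lemma mult_End_quotient:
  assumes \<phi>: "\<phi> \<in> shift_End n" and \<psi>: "\<psi> \<in> shift_End n"
  shows "shift_class n \<phi> \<otimes>\<^bsub>End_quotient n\<^esub> shift_class n \<psi> = shift_class n (compose (Xz n) \<psi> \<phi>)"
proof -
  have "shift_class n (compose (Xz n) \<psi>' \<phi>') = shift_class n (compose (Xz n) \<psi> \<phi>)"
    if "\<phi>' \<in> shift_class n \<phi>" "\<psi>' \<in> shift_class n \<psi>" for \<phi>' \<psi>'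
  proof (rule shift_class_compose_cong)
    show "\<phi>' \<in> shift_End n" "\<psi>' \<in> shift_End n" "\<phi> \<in> shift_End n" "\<psi> \<in> shift_End n"
      using that assms by (auto simp: shift_congruence_def)
    show "shift_class n \<phi>' = shift_class n \<phi>" "shift_class n \<psi>' = shift_class n \<psi>"
      using equiv_class_eq[OF equiv_shift_congruence] that by blast+
  qed
  then have "(\<Union>\<phi>'\<in>shift_class n \<phi>. \<Union>\<psi>'\<in>shift_class n \<psi>. shift_class n (compose (Xz n) \<psi>' \<phi>')) =
      shift_class n (compose (Xz n) \<psi> \<phi>)"
    by (rule UN_UN_const[OF self_in_shift_class[OF \<phi>] self_in_shift_class[OF \<psi>]])
  then show ?thesis by (simp add: End_quotient_def)
qed

lemma carrier_End_quotient: "A \<in> carrier (End_quotient n) \<longleftrightarrow> (\<exists>\<phi>\<in>shift_End n. A = shift_class n \<phi>)"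
  by (auto simp: End_quotient_def quotient_def)

lemma End_quotient_monoid: "Group.monoid (End_quotient n)"
proof (rule Group.monoidI)
  have one: "\<one>\<^bsub>End_quotient n\<^esub> = shift_class n (\<lambda>x\<in>Xz n. x)" by (simp add: End_quotient_def)
  show "\<one>\<^bsub>End_quotient n\<^esub> \<in> carrier (End_quotient n)"
    unfolding one carrier_End_quotient using identity_End by blast
  fix A assume A: "A \<in> carrier (End_quotient n)"
  then obtain \<phi> where \<phi>: "\<phi> \<in> shift_End n" "A = shift_class n \<phi>" using carrier_End_quotient by blast
  have "\<phi> \<in> Xz n \<rightarrow> Xz n" using shift_EndD(3)[OF \<phi>(1)] by blast
  then have "compose (Xz n) \<phi> (\<lambda>x\<in>Xz n. x) = \<phi>" "compose (Xz n) (\<lambda>x\<in>Xz n. x) \<phi> = \<phi>"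
    using shift_EndD(1)[OF \<phi>(1)] by (simp_all add: compose_Id Id_compose)
  then show "\<one>\<^bsub>End_quotient n\<^esub> \<otimes>\<^bsub>End_quotient n\<^esub> A = A" "A \<otimes>\<^bsub>End_quotient n\<^esub> \<one>\<^bsub>End_quotient n\<^esub> = A"
    unfolding one \<phi>(2) using mult_End_quotient[OF identity_End \<phi>(1)] mult_End_quotient[OF \<phi>(1) identity_End]
    by simp_all
  fix B assume B: "B \<in> carrier (End_quotient n)"
  then obtain \<psi> where \<psi>: "\<psi> \<in> shift_End n" "B = shift_class n \<psi>" using carrier_End_quotient by blast
  show "A \<otimes>\<^bsub>End_quotient n\<^esub> B \<in> carrier (End_quotient n)"
    unfolding \<phi>(2) \<psi>(2) mult_End_quotient[OF \<phi>(1) \<psi>(1)] carrier_End_quotient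
    using shift_End_compose[OF \<phi>(1) \<psi>(1)] by blast
  fix C assume "C \<in> carrier (End_quotient n)"
  then obtain \<chi> where \<chi>: "\<chi> \<in> shift_End n" "C = shift_class n \<chi>" using carrier_End_quotient by blast
  have "compose (Xz n) \<chi> (compose (Xz n) \<psi> \<phi>) = compose (Xz n) (compose (Xz n) \<chi> \<psi>) \<phi>"
    by (rule compose_assoc) (use shift_EndD(3)[OF \<phi>(1)] in blast)
  then show "A \<otimes>\<^bsub>End_quotient n\<^esub> B \<otimes>\<^bsub>End_quotient n\<^esub> C = A \<otimes>\<^bsub>End_quotient n\<^esub> (B \<otimes>\<^bsub>End_quotient n\<^esub> C)"
    unfolding \<phi>(2) \<psi>(2) \<chi>(2) mult_End_quotient[OF \<phi>(1) \<psi>(1)] mult_End_quotient[OF \<psi>(1) \<chi>(1)]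
      mult_End_quotient[OF shift_End_compose[OF \<phi>(1) \<psi>(1)] \<chi>(1)]
      mult_End_quotient[OF \<phi>(1) shift_End_compose[OF \<psi>(1) \<chi>(1)]]
    by simp
qed


section \<open>Windows and periodic points\<close>

definition window :: "(int \<Rightarrow> nat) \<Rightarrow> int \<Rightarrow> nat \<Rightarrow> nat list" where
  "window x i m = map (\<lambda>j. x (i + int j)) [0..<m]"

lemma length_window [simp]: "length (window x i m) = m"
  by (simp add: window_def)

lemma nth_window [simp]: "j < m \<Longrightarrow> window x i m ! j = x (i + int j)"
  by (simp add: window_def)

lemma map_upto_window: "map x [i..i + int m - 1] = window x i m"
  by (rule nth_equalityI) auto

lemma window_in_lists: "x \<in> Xz n \<Longrightarrow> window x i m \<in> lists {..<n}"
  by (auto simp: window_def Xz_iff)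

lemma window_append: "window x i (m + k) = window x i m @ window x (i + int m) k"
  by (rule nth_equalityI) (auto simp: nth_append algebra_simps of_nat_diff)

lemma window_Suc: "window x i (Suc m) = x i # window x (i + 1) m"
  using window_append[of x i 1 m] by (simp add: window_def)

lemma window_shift: "x \<in> Xz n \<Longrightarrow> window (shift_power n k x) i m = window x (i - k) m"
  by (simp add: shift_power_apply window_def algebra_simps)

lemma window_cong: "(\<And>j. i \<le> j \<Longrightarrow> j < i + int m \<Longrightarrow> x j = y j) \<Longrightarrow> window x i m = window y i m"
  by (simp add: window_def)

section \<open>Periods and orbit words\<close>

lemma shift_power_fixed_iff:
  assumes "x \<in> Xz n"
  shows "shift_power n k x = x \<longleftrightarrow> (\<forall>i. x (i + k) = x i)"
proof -
  have "(\<forall>i. x (i - k) = x i) \<longleftrightarrow> (\<forall>i. x (i + k) = x i)"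
    by (metis add_diff_cancel_right' diff_add_cancel)
  then show ?thesis using assms by (simp add: shift_power_apply fun_eq_iff)
qed

lemma period_multiple:
  assumes "\<forall>i. x (i + int k) = x i"
  shows "x (i + int (m * k)) = x i"
proof (induction m)
  case (Suc m)
  have "x (i + int (Suc m * k)) = x ((i + int (m * k)) + int k)" by (simp add: algebra_simps)
  then show ?case using assms Suc by simp
qed simp

lemma periodic_iter:
  assumes k: "k > 0" and per: "\<forall>i. x (i + int k) = x i"
  shows "(\<lambda>j. x (i + int j)) = (window x i k)\<^sup>\<omega>"
proof
  fix j
  have "x (i + int j) = x ((i + int (j mod k)) + int (j div k * k))"
    by (metis add.assoc mod_div_mult_eq of_nat_add)
  also have "\<dots> = x (i + int (j mod k))" using period_multiple[OF per] by blast
  finally show "x (i + int j) = (window x i k)\<^sup>\<omega> j" using k by simp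
qed

text \<open>Translation by a multiple of the known period \<open>k\<close> moves any position into
  the right half.\<close>

lemma period_from_right_half:
  assumes k: "k > 0" and per: "\<forall>i. x (i + int k) = x i" and nonneg: "\<And>j::nat. x (int (j + p)) = x (int j)"
  shows "\<forall>i. x (i + int p) = x i"
proof
  fix i :: int
  define m where "m = nat \<bar>i\<bar>"
  have "i + int (m * k) \<ge> 0"
  proof -
    have "int m * 1 \<le> int m * int k" using k by (intro mult_left_mono) auto
    then show ?thesis by (simp add: m_def)
  qed
  then obtain j where j: "i + int (m * k) = int j" using nonneg_int_cases by blast
  have "x (i + int p) = x (i + int p + int (m * k))" using period_multiple[OF per] by simp
  also have "\<dots> = x (int (j + p))"
  proof -
    have "i + int p + int (m * k) = int (j + p)" using j by simp
    then show ?thesis by (simp only:)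
  qed
  also have "\<dots> = x (i + int (m * k))" using nonneg[of j] j by simp
  also have "\<dots> = x i" using period_multiple[OF per] by simp
  finally show "x (i + int p) = x i" .
qed

text \<open>The word over the least period is prime, since a shorter root would give a shorter
  period. A window over any period starting anywhere generates a tail of the same right-infinite
  word, so its root is a rotation of that word.\<close>

lemma orbit_word_window:
  assumes x: "x \<in> Xz n" and k: "k > 0" and per: "\<forall>i. x (i + int k) = x i"
  shows "orbit_word n x = rotations (prime_root (window x c k))"
proof -
  define p where "p = least_period n x"
  have p: "p > 0" "\<forall>i. x (i + int p) = x i"
    and least: "\<And>l. l > 0 \<Longrightarrow> \<forall>i. x (i + int l) = x i \<Longrightarrow> p \<le> l"
  proof -
    have ex: "0 < k \<and> shift_power n (int k) x = x" using k per shift_power_fixed_iff[OF x] by blast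
    have "0 < p \<and> shift_power n (int p) x = x"
      unfolding p_def least_period_def
      using LeastI[of "\<lambda>k. 0 < k \<and> shift_power n (int k) x = x" k] ex by blast
    then show "p > 0" "\<forall>i. x (i + int p) = x i" using shift_power_fixed_iff[OF x] by blast+
    fix l :: nat assume "l > 0" "\<forall>i. x (i + int l) = x i"
    then show "p \<le> l"
      unfolding p_def least_period_def using shift_power_fixed_iff[OF x] by (intro Least_le) blast
  qed
  define w where "w = window x 0 p"
  have w_iter: "(\<lambda>j. x (0 + int j)) = w\<^sup>\<omega>" unfolding w_def by (rule periodic_iter[OF p])
  have w0: "w \<noteq> []" using p(1) by (auto simp: w_def window_def)
  have "prime_word w"
    unfolding prime_word_def
  proof (intro conjI notI)
    assume "\<exists>u m. length u < length w \<and> w = wpow u m"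
    then obtain u m where u: "length u < length w" "w = wpow u m" by blast
    then have u0: "u \<noteq> []" "m \<ge> 1" using w0 by (auto simp: wpow_eq_Nil_iff Suc_le_eq)
    then have "(\<lambda>j. x (0 + int j)) = u\<^sup>\<omega>" using w_iter iter_wpow[OF u0] u(2) by simp
    then have xu: "x (int j) = u ! (j mod length u)" for j
      using u0 fun_cong[of "\<lambda>j. x (0 + int j)" "u\<^sup>\<omega>" j] by simp
    \<comment> \<open>The infinite word only shows the period on nonnegative positions; the known
      period \<open>k\<close> carries it to all integers.\<close>
    have "\<forall>i. x (i + int (length u)) = x i"
      by (rule period_from_right_half[OF k per]) (simp only: xu mod_add_self2)
    then have "p \<le> length u" using least u0 by blast
    then show False using u(1) by (simp add: w_def)
  qed (use w0 in simp)
  moreover have "orbit_word n x = rotations w"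
    using map_upto_window[of x 0 p] by (simp add: orbit_word_def w_def p_def)
  moreover have "rotations (prime_root w) = rotations (prime_root (window x c k))"
  proof -
    \<comment> \<open>\<open>c\<close> may be negative; adding \<open>m\<close> periods gives the
      same window at a natural position.\<close>
    define m where "m = nat \<bar>c\<bar>"
    have "c + int (m * k) \<ge> 0"
    proof -
      have "int m * 1 \<le> int m * int k" using k by (intro mult_left_mono) auto
      then show ?thesis by (simp add: m_def)
    qed
    then obtain d where d: "c + int (m * k) = int d" using nonneg_int_cases by blast
    have "x (c + int (m * k) + int j) = x (c + int j)" for j
      using period_multiple[OF per, of "c + int j" m] by (simp add: algebra_simps)
    then have "window x c k = window x (int d) k"
      unfolding d[symmetric] window_def by simp
    moreover have "w\<^sup>\<omega> = window x 0 d \<frown> (window x (int d) k)\<^sup>\<omega>"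
      unfolding w_iter[symmetric] periodic_iter[OF k per, symmetric]
      by (auto simp: conc_def fun_eq_iff of_nat_diff)
    then have "[] \<frown> w\<^sup>\<omega> = window x 0 d \<frown> (window x (int d) k)\<^sup>\<omega>" by simp
    moreover have "window x (int d) k \<noteq> []" using k by (auto simp: window_def)
    ultimately show ?thesis using conc_iter_eq_rotations[OF w0] by metis
  qed
  ultimately show ?thesis using prime_root_prime by metis
qed

lemma periodic_pointE:
  assumes "periodic_point n x"
  obtains k :: nat where "k > 0" "\<forall>i. x (i + int k) = x i" "x \<in> Xz n"
  using assms shift_power_fixed_iff unfolding periodic_point_def by blast

lemma orbit_word_shift:
  assumes "periodic_point n x"
  shows "periodic_point n (shift_power n c x)" "orbit_word n (shift_power n c x) = orbit_word n x"
proof -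
  obtain k :: nat where k: "k > 0" "\<forall>i. x (i + int k) = x i" and x: "x \<in> Xz n"
    using periodic_pointE[OF assms] by blast
  have y: "shift_power n c x \<in> Xz n" using shift_power_in[OF x] .
  have per: "\<forall>i. shift_power n c x (i + int k) = shift_power n c x i"
    using k(2) x by (simp add: shift_power_apply) (metis add_diff_eq diff_add_eq)
  then show "periodic_point n (shift_power n c x)"
    unfolding periodic_point_def using y k(1) shift_power_fixed_iff[OF y] by blast
  show "orbit_word n (shift_power n c x) = orbit_word n x"
    using orbit_word_window[OF y k(1) per, of c] orbit_word_window[OF x k, of 0] window_shift[OF x]
    by simp
qed

lemma periodic_point_exists:
  assumes g: "g \<in> lists {..<n}" "prime_word g"
  shows "\<exists>x. periodic_point n x \<and> orbit_word n x = rotations g"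
proof -
  define k where "k = length g"
  have k: "k > 0" using g(2) by (auto simp: k_def)
  define x where "x i = g ! nat (i mod int k)" for i
  have "nat (i mod int k) < k" for i using k by (simp add: nat_less_iff)
  then have x: "x \<in> Xz n" using g(1) by (auto simp: Xz_iff x_def k_def)
  have per: "\<forall>i. x (i + int k) = x i" by (simp add: x_def)
  have "window x 0 k = g" by (rule nth_equalityI) (auto simp: k_def x_def nat_mod_as_int)
  then have "orbit_word n x = rotations g"
    using orbit_word_window[OF x k per, of 0] prime_root_prime[OF g(2)] by simp
  moreover have "periodic_point n x"
    unfolding periodic_point_def using x k per shift_power_fixed_iff[OF x] by blast
  ultimately show ?thesis by blast
qed

lemma shift_End_periodic:
  assumes "\<phi> \<in> shift_End n" "periodic_point n x"
  shows "periodic_point n (\<phi> x)"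
  using assms shift_EndD(3)[OF assms(1)] shift_End_commutes[OF assms(1)]
  unfolding periodic_point_def by metis


section \<open>Annotated transducers\<close>

definition forced_state :: "nat \<Rightarrow> 'q transducer \<Rightarrow> (int \<Rightarrow> nat) \<Rightarrow> int \<Rightarrow> 'q" where
  "forced_state n T x i = (THE q. \<exists>k p. sync_level n T k \<and> p \<in> St T \<and>
     q = steps T (window x (i - int k) k) p)"

definition annotated_image ::
  "nat \<Rightarrow> 'q transducer \<Rightarrow> ('q \<Rightarrow> int) \<Rightarrow> (int \<Rightarrow> nat) \<Rightarrow> (int \<Rightarrow> nat) \<Rightarrow> bool" where
  "annotated_image n T \<alpha> x y \<longleftrightarrow> y \<in> Xz n \<and> (\<forall>i. \<forall>l < length (out T (x i) (forced_state n T x i)).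
     y (i + \<alpha> (forced_state n T x i) + int l) = out T (x i) (forced_state n T x i) ! l)"

text \<open>The search for the last \<open>i\<close> with \<open>P i \<le> j\<close> starts at
  \<open>j - B\<close>, where the bound ensures that inequality, and it ends by the same bound.
  Applied to the positions at which the output blocks start, it shows that they leave no
  gap.\<close>

lemma int_interval_cover:
  fixes P :: "int \<Rightarrow> int"
  assumes bound: "\<And>i. \<bar>P i - i\<bar> \<le> B"
  shows "\<exists>i. P i \<le> j \<and> j < P (i + 1)"
proof -
  let ?Q = "\<lambda>m::nat. P (j - B + int m) \<le> j"
  have "B \<ge> 0" using bound[of 0] by simp
  have "?Q 0" using bound[of "j - B"] by simp
  moreover have bd: "\<forall>m. ?Q m \<longrightarrow> m \<le> nat (2 * B)"
  proof (intro allI impI)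
    fix m assume "?Q m"
    then show "m \<le> nat (2 * B)" using bound[of "j - B + int m"] by linarith
  qed
  ultimately have Q: "?Q (Greatest ?Q)" "\<And>m. ?Q m \<Longrightarrow> m \<le> Greatest ?Q"
    using GreatestI_nat[of ?Q 0 "nat (2 * B)"] Greatest_le_nat[of ?Q _ "nat (2 * B)"] by blast+
  have "\<not> ?Q (Suc (Greatest ?Q))" using Q(2) by fastforce
  then have "j < P (j - B + int (Greatest ?Q) + 1)" by (simp add: algebra_simps)
  then show ?thesis using Q(1) by blast
qed

lemma int_interval_unique:
  fixes P :: "int \<Rightarrow> int"
  assumes mono: "\<And>i. P i \<le> P (i + 1)"
    and i: "P i \<le> j" "j < P (i + 1)" and i': "P i' \<le> j" "j < P (i' + 1)"
  shows "i = i'"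
proof -
  have P: "P a \<le> P b" if "a \<le> b" for a b
    using that by (induction rule: int_ge_induct) (use mono order_trans in blast)+
  show ?thesis
  proof (rule ccontr)
    assume "i \<noteq> i'"
    then consider "i + 1 \<le> i'" | "i' + 1 \<le> i" by linarith
    then show False using P[of "i + 1" i'] P[of "i' + 1" i] i i' by cases linarith+
  qed
qed

context
  fixes n :: nat and T :: "'q transducer"
  assumes T: "is_transducer n T" "strongly_synchronizing n T"
begin

lemma forced_state_eq:
  assumes x: "x \<in> Xz n" and k: "sync_level n T k" and p: "p \<in> St T"
  shows "forced_state n T x i = steps T (window x (i - int k) k) p"
proof -
  have le: "steps T (window x (i - int l) l) r = steps T (window x (i - int k) k) p"
    if "k \<le> l" "sync_level n T k" "p \<in> St T" "r \<in> St T" for k l p r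
  proof -
    have "window x (i - int l) l = window x (i - int l) (l - k) @ window x (i - int k) k"
      using window_append[of x "i - int l" "l - k" k] that(1) by (simp add: of_nat_diff)
    then have "steps T (window x (i - int l) l) r =
        steps T (window x (i - int k) k) (steps T (window x (i - int l) (l - k)) r)" by simp
    also have "\<dots> = steps T (window x (i - int k) k) p"
      by (rule sync_levelD[OF that(2) window_in_lists[OF x] _
            steps_in_St[OF T(1) window_in_lists[OF x] that(4)] that(3)]) simp
    finally show ?thesis .
  qed
  show ?thesis
    unfolding forced_state_def
  proof (rule the_equality)
    show "\<exists>l r. sync_level n T l \<and> r \<in> St T \<and>
        steps T (window x (i - int k) k) p = steps T (window x (i - int l) l) r"
      using k p by blast
    fix q assume "\<exists>l r. sync_level n T l \<and> r \<in> St T \<and> q = steps T (window x (i - int l) l) r"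
    then obtain l r where l: "sync_level n T l" "r \<in> St T" "q = steps T (window x (i - int l) l) r" by blast
    show "q = steps T (window x (i - int k) k) p"
      using le[of k l p r] le[of l k r p] k p l by (metis nat_le_linear)
  qed
qed

lemma forced_state_in:
  assumes x: "x \<in> Xz n"
  shows "forced_state n T x i \<in> St T"
proof -
  obtain k where k: "sync_level n T k" using T(2) by (auto simp: strongly_synchronizing_def)
  obtain p where p: "p \<in> St T" using St_nonempty[OF T(1)] by blast
  show ?thesis
    unfolding forced_state_eq[OF x k p] by (rule steps_in_St[OF T(1) window_in_lists[OF x] p])
qed

lemma forced_state_run:
  assumes x: "x \<in> Xz n"
  shows "steps T (window x i m) (forced_state n T x i) = forced_state n T x (i + int m)"
proof -
  obtain k where k: "sync_level n T k" using T(2) by (auto simp: strongly_synchronizing_def)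
  obtain p where p: "p \<in> St T" using St_nonempty[OF T(1)] by blast
  have km: "sync_level n T (k + m)" using sync_level_mono[OF k] by simp
  have "steps T (window x i m) (forced_state n T x i) = steps T (window x (i - int k) (k + m)) p"
    unfolding forced_state_eq[OF x k p] window_append by simp
  also have "\<dots> = forced_state n T x (i + int m)"
    using forced_state_eq[OF x km p, of "i + int m"] by simp
  finally show ?thesis .
qed

lemma forced_state_step:
  assumes x: "x \<in> Xz n"
  shows "step T (x i) (forced_state n T x i) = forced_state n T x (i + 1)"
  using forced_state_run[OF x, of i 1] by (simp add: window_def)

lemma forced_state_cong:
  assumes x: "x \<in> Xz n" and y: "y \<in> Xz n" and k: "sync_level n T k"
    and eq: "\<And>j. i - int k \<le> j \<Longrightarrow> j < i \<Longrightarrow> x j = y j"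
  shows "forced_state n T x i = forced_state n T y i"
proof -
  obtain p where p: "p \<in> St T" using St_nonempty[OF T(1)] by blast
  have "window x (i - int k) k = window y (i - int k) k" by (rule window_cong) (use eq in auto)
  then show ?thesis using forced_state_eq[OF x k p] forced_state_eq[OF y k p] by simp
qed

lemma forced_state_shift:
  assumes x: "x \<in> Xz n"
  shows "forced_state n T (shift_power n c x) i = forced_state n T x (i - c)"
proof -
  obtain k where k: "sync_level n T k" using T(2) by (auto simp: strongly_synchronizing_def)
  obtain p where p: "p \<in> St T" using St_nonempty[OF T(1)] by blast
  show ?thesis
    unfolding forced_state_eq[OF x k p] forced_state_eq[OF shift_power_in[OF x] k p] window_shift[OF x]
    by (simp add: algebra_simps)
qed

lemma annotated_map_The:
  assumes x: "x \<in> Xz n"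
  shows "annotated_map n T \<alpha> x = (THE y. annotated_image n T \<alpha> x y)"
proof -
  obtain k0 where k0: "sync_level n T k0" using T(2) by (auto simp: strongly_synchronizing_def)
  obtain p0 where p0: "p0 \<in> St T" using St_nonempty[OF T(1)] by blast
  have win: "map x [i - int k..i - 1] = window x (i - int k) k" for i k
    using map_upto_window[of x "i - int k" k] by simp
  have "(\<forall>i k p q. sync_level n T k \<and> p \<in> St T \<and> q = steps T (map x [i - int k..i - 1]) p \<longrightarrow>
      (\<forall>j < length (out T (x i) q). y (i + \<alpha> q + int j) = out T (x i) q ! j)) \<longleftrightarrow>
    (\<forall>i. \<forall>l < length (out T (x i) (forced_state n T x i)).
     y (i + \<alpha> (forced_state n T x i) + int l) = out T (x i) (forced_state n T x i) ! l)"
    (is "?L \<longleftrightarrow> ?R") for y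
  proof
    assume L: ?L
    show ?R
      using L[rule_format, OF conjI[OF k0 conjI[OF p0]]] forced_state_eq[OF x k0 p0] win by metis
  next
    assume R: ?R
    show ?L
    proof (intro allI impI, elim conjE)
      fix i k p q j
      assume a: "sync_level n T k" "p \<in> St T" "q = steps T (map x [i - int k..i - 1]) p"
        "j < length (out T (x i) q)"
      then have "q = forced_state n T x i" using forced_state_eq[OF x a(1,2), of i] win by simp
      then show "y (i + \<alpha> q + int j) = out T (x i) q ! j" using R a(4) by simp
    qed
  qed
  then show ?thesis
    using x by (simp add: annotated_map_def annotated_image_def)
qed

context
  fixes \<alpha> :: "'q \<Rightarrow> int"
  assumes \<alpha>: "annotation n T \<alpha>"
begin

text \<open>The block written by the next letter starts right where the block of the present letter
  ends. The defining equation of annotations expresses exactly this.\<close>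

lemma annotation_step:
  assumes x: "x \<in> Xz n"
  shows "i + 1 + \<alpha> (forced_state n T x (i + 1)) =
    i + \<alpha> (forced_state n T x i) + int (length (out T (x i) (forced_state n T x i)))"
proof -
  have "[x i] \<in> lists {..<n}" using x by (simp add: Xz_iff)
  then have "\<alpha> (steps T [x i] (forced_state n T x i)) = \<alpha> (forced_state n T x i) +
      int (length (outs T [x i] (forced_state n T x i))) - int (length [x i])"
    using \<alpha> forced_state_in[OF x] unfolding annotation_def by blast
  then show ?thesis using forced_state_step[OF x, of i] by simp
qed

lemma annotation_bounded: "\<exists>B. \<forall>q\<in>St T. \<bar>\<alpha> q\<bar> \<le> B"
proof -
  have "finite ((\<lambda>q. \<bar>\<alpha> q\<bar>) ` St T)" using finite_St[OF T(1)] by simp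
  then show ?thesis by (intro exI[of _ "Max ((\<lambda>q. \<bar>\<alpha> q\<bar>) ` St T)"]) simp
qed

text \<open>The blocks are consecutive, and their starting points stay within \<open>B\<close> of
  the input positions. The bounds on \<open>i\<close> are what makes the annotated map
  local.\<close>

lemma position_covered:
  assumes x: "x \<in> Xz n" and B: "\<And>q. q \<in> St T \<Longrightarrow> \<bar>\<alpha> q\<bar> \<le> B"
  shows "\<exists>i l. l < length (out T (x i) (forced_state n T x i)) \<and>
    j = i + \<alpha> (forced_state n T x i) + int l \<and> j - B - 1 \<le> i \<and> i \<le> j + B"
proof -
  define P where "P i = i + \<alpha> (forced_state n T x i)" for i
  have "\<bar>P i - i\<bar> \<le> B" for i using B[OF forced_state_in[OF x, of i]] by (simp add: P_def)
  then obtain i where i: "P i \<le> j" "j < P (i + 1)" "\<bar>P i - i\<bar> \<le> B" "\<bar>P (i + 1) - (i + 1)\<bar> \<le> B"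
    using int_interval_cover[of P B j] by blast
  have "P (i + 1) = P i + int (length (out T (x i) (forced_state n T x i)))"
    unfolding P_def by (rule annotation_step[OF x])
  then show ?thesis
    using i by (intro exI[of _ i] exI[of _ "nat (j - P i)"]) (auto simp: P_def)
qed

lemma annotated_image_unique:
  assumes x: "x \<in> Xz n" and y: "annotated_image n T \<alpha> x y" and z: "annotated_image n T \<alpha> x z"
  shows "y = z"
proof
  fix j
  obtain B where B: "\<forall>q\<in>St T. \<bar>\<alpha> q\<bar> \<le> B" using annotation_bounded by blast
  obtain i l where il: "l < length (out T (x i) (forced_state n T x i))"
    "j = i + \<alpha> (forced_state n T x i) + int l"
    using position_covered[OF x, of B j] B by blast
  then show "y j = z j" using y z by (simp add: annotated_image_def)
qed

text \<open>Each position lies in exactly one of the consecutive nonempty blocks, so the letter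
  prescribed there is unique and can be chosen by \<open>THE\<close>.\<close>

lemma annotated_image_exists:
  assumes x: "x \<in> Xz n"
  shows "\<exists>y. annotated_image n T \<alpha> x y"
proof -
  define P where "P i = i + \<alpha> (forced_state n T x i)" for i
  define o1 where "o1 i = out T (x i) (forced_state n T x i)" for i
  have P: "P (i + 1) = P i + int (length (o1 i))" for i
    unfolding P_def o1_def by (rule annotation_step[OF x])
  obtain B where B: "\<forall>q\<in>St T. \<bar>\<alpha> q\<bar> \<le> B" using annotation_bounded by blast
  have cov: "\<exists>i. \<exists>l<length (o1 i). j = P i + int l" for j
    using position_covered[OF x, of B j] B unfolding P_def o1_def by blast
  define y where "y j = (THE a. \<exists>i. \<exists>l<length (o1 i). j = P i + int l \<and> a = o1 i ! l)" for j
  have y: "y (P i + int l) = o1 i ! l" if l: "l < length (o1 i)" for i l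
    unfolding y_def
  proof (rule the_equality)
    show "\<exists>i'. \<exists>l'<length (o1 i'). P i + int l = P i' + int l' \<and> o1 i ! l = o1 i' ! l'"
      using l by blast
    fix a assume "\<exists>i'. \<exists>l'<length (o1 i'). P i + int l = P i' + int l' \<and> a = o1 i' ! l'"
    then obtain i' l' where i': "l' < length (o1 i')" "P i + int l = P i' + int l'" "a = o1 i' ! l'" by blast
    have "i = i'"
      by (rule int_interval_unique[of P i "P i + int l" i']) (use P l i' in auto)
    then show "a = o1 i ! l" using i' by simp
  qed
  have "y j < n" for j
  proof -
    obtain i l where il: "l < length (o1 i)" "j = P i + int l" using cov by blast
    have "o1 i \<in> lists {..<n}"
      using T(1) forced_state_in[OF x, of i] x by (simp add: o1_def is_transducer_def Xz_iff)
    then have "o1 i ! l < n" using il(1) by (metis in_listsD lessThan_iff nth_mem)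
    then show ?thesis using y[OF il(1)] il(2) by simp
  qed
  then have "annotated_image n T \<alpha> x y"
    using y by (simp add: annotated_image_def Xz_iff P_def o1_def)
  then show ?thesis by blast
qed

lemma annotated_map_image:
  assumes x: "x \<in> Xz n"
  shows "annotated_image n T \<alpha> x (annotated_map n T \<alpha> x)"
proof -
  obtain y where y: "annotated_image n T \<alpha> x y" using annotated_image_exists[OF x] by blast
  have "(THE y. annotated_image n T \<alpha> x y) = y"
    by (rule the_equality[of "annotated_image n T \<alpha> x", OF y]) (rule annotated_image_unique[OF x _ y])
  then show ?thesis using y annotated_map_The[OF x] by simp
qed

lemma annotated_map_eqI:
  assumes x: "x \<in> Xz n" and "annotated_image n T \<alpha> x y"
  shows "annotated_map n T \<alpha> x = y"
  by (rule annotated_image_unique[OF x annotated_map_image[OF x] assms(2)])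

lemma annotated_map_in: "x \<in> Xz n \<Longrightarrow> annotated_map n T \<alpha> x \<in> Xz n"
  using annotated_map_image by (simp add: annotated_image_def)

lemma annotated_map_shift:
  assumes x: "x \<in> Xz n"
  shows "annotated_map n T \<alpha> (shift_power n c x) = shift_power n c (annotated_map n T \<alpha> x)"
proof (rule annotated_map_eqI[OF shift_power_in[OF x]])
  let ?y = "annotated_map n T \<alpha> x"
  have y: "?y \<in> Xz n" by (rule annotated_map_in[OF x])
  have spec: "\<forall>i. \<forall>l < length (out T (x i) (forced_state n T x i)).
     ?y (i + \<alpha> (forced_state n T x i) + int l) = out T (x i) (forced_state n T x i) ! l"
    using annotated_map_image[OF x] by (simp add: annotated_image_def)
  show "annotated_image n T \<alpha> (shift_power n c x) (shift_power n c ?y)"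
    unfolding annotated_image_def forced_state_shift[OF x]
  proof (intro conjI allI impI)
    show "shift_power n c ?y \<in> Xz n" by (rule shift_power_in[OF y])
    fix i l
    assume l: "l < length (out T (shift_power n c x i) (forced_state n T x (i - c)))"
    have "shift_power n c ?y (i + \<alpha> (forced_state n T x (i - c)) + int l) =
        ?y ((i - c) + \<alpha> (forced_state n T x (i - c)) + int l)"
      using y by (simp add: shift_power_apply algebra_simps)
    also have "\<dots> = out T (x (i - c)) (forced_state n T x (i - c)) ! l"
      using spec[rule_format, of l "i - c"] l x by (simp add: shift_power_apply)
    finally show "shift_power n c ?y (i + \<alpha> (forced_state n T x (i - c)) + int l) =
        out T (shift_power n c x i) (forced_state n T x (i - c)) ! l"
      using x by (simp add: shift_power_apply)
  qed
qed

lemma annotated_map_End: "annotated_map n T \<alpha> \<in> shift_End n"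
proof -
  have "continuous_map (full_shift n) (full_shift n) (annotated_map n T \<alpha>)"
  proof (rule continuous_map_if_local[OF annotated_map_in])
    fix j
    obtain k where k: "sync_level n T k" using T(2) by (auto simp: strongly_synchronizing_def)
    obtain B where B: "\<forall>q\<in>St T. \<bar>\<alpha> q\<bar> \<le> B" using annotation_bounded by blast
    \<comment> \<open>Position \<open>j\<close> is written by a letter at distance at most
      \<open>B + 1\<close>, in a state forced by the \<open>k\<close> letters before that
      one.\<close>
    let ?I = "{j - B - 1 - int k..j + B}"
    have loc: "annotated_map n T \<alpha> y j = annotated_map n T \<alpha> x j"
      if x: "x \<in> Xz n" and y: "y \<in> Xz n" and eq: "\<forall>i\<in>?I. y i = x i" for x y
    proof -
      obtain i l where il: "l < length (out T (x i) (forced_state n T x i))"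
        "j = i + \<alpha> (forced_state n T x i) + int l" "j - B - 1 \<le> i" "i \<le> j + B"
        using position_covered[OF x, of B j] B by blast
      have fs: "forced_state n T y i = forced_state n T x i"
        by (rule forced_state_cong[OF y x k]) (use eq il in auto)
      moreover have "y i = x i" using eq il by auto
      ultimately have "l < length (out T (y i) (forced_state n T y i))"
        "j = i + \<alpha> (forced_state n T y i) + int l" using il by simp_all
      then have "annotated_map n T \<alpha> y j = out T (y i) (forced_state n T y i) ! l"
        using annotated_map_image[OF y] by (simp add: annotated_image_def)
      moreover have "annotated_map n T \<alpha> x j = out T (x i) (forced_state n T x i) ! l"
        using annotated_map_image[OF x] il by (simp add: annotated_image_def)
      ultimately show ?thesis using fs \<open>y i = x i\<close> by simp
    qed
    show "\<exists>I. finite I \<and> (\<forall>x\<in>Xz n. \<forall>y\<in>Xz n. (\<forall>i\<in>I. y i = x i) \<longrightarrow>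
        annotated_map n T \<alpha> y j = annotated_map n T \<alpha> x j)"
      by (rule exI[of _ ?I], intro conjI ballI impI finite_atLeastAtMost_int, rule loc)
  qed
  then show ?thesis
    using annotated_map_shift by (simp add: shift_End_def) (simp add: annotated_map_def)
qed

lemma annotated_map_run:
  assumes x: "x \<in> Xz n" and l: "l < length (outs T (window x i m) (forced_state n T x i))"
  shows "annotated_map n T \<alpha> x (i + \<alpha> (forced_state n T x i) + int l) =
    outs T (window x i m) (forced_state n T x i) ! l"
  using l
proof (induction m arbitrary: i l)
  case (Suc m)
  let ?q = "forced_state n T x i"
  show ?case
  proof (cases "l < length (out T (x i) ?q)")
    case True
    then have "annotated_map n T \<alpha> x (i + \<alpha> ?q + int l) = out T (x i) ?q ! l"
      using annotated_map_image[OF x] by (simp add: annotated_image_def)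
    then show ?thesis using True by (simp add: window_Suc nth_append)
  next
    case False
    define l' where "l' = l - length (out T (x i) ?q)"
    have l: "l = length (out T (x i) ?q) + l'" using False by (simp add: l'_def)
    have o1: "outs T (window x i (Suc m)) ?q =
        out T (x i) ?q @ outs T (window x (i + 1) m) (forced_state n T x (i + 1))"
      using forced_state_step[OF x, of i] by (simp add: window_Suc)
    then have "l' < length (outs T (window x (i + 1) m) (forced_state n T x (i + 1)))"
      using Suc.prems l by simp
    from Suc.IH[OF this] have "annotated_map n T \<alpha> x (i + 1 + \<alpha> (forced_state n T x (i + 1)) + int l') =
        outs T (window x (i + 1) m) (forced_state n T x (i + 1)) ! l'" .
    moreover have "i + 1 + \<alpha> (forced_state n T x (i + 1)) + int l' = i + \<alpha> ?q + int l"
      using annotation_step[OF x, of i] l by simp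
    ultimately show ?thesis using o1 l by (simp add: nth_append)
  qed
qed (simp add: window_def)

text \<open>Over a period of \<open>x\<close> the forced state returns to itself. The annotation
  then forces the output of that loop to be as long as the period, so it fills exactly one period of
  the image.\<close>

lemma orbit_word_annotated_map:
  assumes x: "periodic_point n x" and g: "g \<in> orbit_word n x"
  shows "orbit_word n (annotated_map n T \<alpha> x) = cyclic_image T g"
proof -
  obtain k :: nat where k: "k > 0" "\<forall>i. x (i + int k) = x i" and xz: "x \<in> Xz n"
    using periodic_pointE[OF x] by blast
  define w where "w = window x 0 k"
  have w: "w \<in> lists {..<n}" "w \<noteq> []"
    using window_in_lists[OF xz] k(1) unfolding w_def by (blast, simp add: window_def)
  have shift: "shift_power n (int k) x = x" using k(2) shift_power_fixed_iff[OF xz] by simp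
  define q where "q = forced_state n T x 0"
  have "forced_state n T x (int k) = q"
    using forced_state_shift[OF xz, of "int k" "int k"] shift by (simp add: q_def)
  then have q: "q \<in> St T" "steps T w q = q"
    using forced_state_in[OF xz] forced_state_run[OF xz, of 0 k] by (simp_all add: q_def w_def)
  let ?y = "annotated_map n T \<alpha> x"
  have y: "?y \<in> Xz n" by (rule annotated_map_in[OF xz])
  have "shift_power n (int k) ?y = ?y" using annotated_map_shift[OF xz, of "int k"] shift by simp
  then have per: "\<forall>i. ?y (i + int k) = ?y i" using shift_power_fixed_iff[OF y] by simp
  have "\<alpha> (steps T w q) = \<alpha> q + int (length (outs T w q)) - int (length w)"
    using \<alpha> q(1) w(1) unfolding annotation_def by blast
  then have len: "length (outs T w q) = k" using q(2) by (simp add: w_def)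
  have "window ?y (\<alpha> q) k = outs T w q"
    by (rule nth_equalityI) (use annotated_map_run[OF xz, of _ 0 k] len in \<open>auto simp: q_def w_def\<close>)
  then have "orbit_word n ?y = rotations (prime_root (outs T w q))"
    using orbit_word_window[OF y k(1) per, of "\<alpha> q"] by simp
  also have "\<dots> = cyclic_image T w" using cyclic_image_eq[OF T w q] by simp
  also have "\<dots> = cyclic_image T (prime_root w)" using cyclic_image_prime_root[OF T w] by simp
  also have "\<dots> = cyclic_image T g"
  proof (rule cyclic_image_rotations[OF T, symmetric])
    show "prime_root w \<in> lists {..<n}" by (rule prime_root_in_lists[OF w(2,1)])
    show "prime_root w \<noteq> []" using prime_rootE[OF w(2)] prime_word_not_Nil by metis
    show "g \<in> rotations (prime_root w)" using g orbit_word_window[OF xz k, of 0] by (simp add: w_def)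
  qed
  finally show ?thesis .
qed

end

end

text \<open>Along the homomorphism both annotations satisfy the same equation. On a strongly
  connected transducer they therefore differ by a constant, which becomes the power of the
  shift.\<close>

lemma annotated_map_hom:
  assumes T: "is_transducer n T" "strongly_synchronizing n T" "strongly_connected n T"
    and hom: "transducer_hom n h T U" and \<alpha>: "annotation n T \<alpha>" and \<beta>: "annotation n U \<beta>"
  shows "\<exists>c. \<forall>x\<in>Xz n. annotated_map n T \<alpha> x = shift_power n c (annotated_map n U \<beta> x)"
proof -
  note U = hom_is_transducer[OF T(1,2) hom] hom_sync[OF T(1,2) hom]
  obtain q0 where q0: "q0 \<in> St T" using St_nonempty[OF T(1)] by blast
  define c where "c = \<alpha> q0 - \<beta> (h q0)"
  have c: "\<alpha> q = \<beta> (h q) + c" if q: "q \<in> St T" for q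
  proof -
    obtain w where w: "w \<in> lists {..<n}" "steps T w q0 = q"
      using T(3) q0 q unfolding strongly_connected_def by blast
    have "\<alpha> (steps T w q0) = \<alpha> q0 + int (length (outs T w q0)) - int (length w)"
      using \<alpha> q0 w(1) unfolding annotation_def by blast
    moreover have "h q0 \<in> St U" using q0 hom_St[OF T(1,2) hom] by simp
    then have "\<beta> (steps U w (h q0)) = \<beta> (h q0) + int (length (outs U w (h q0))) - int (length w)"
      using \<beta> w(1) unfolding annotation_def by blast
    ultimately show ?thesis using hom_runs[OF T(1,2) hom w(1) q0] w(2) by (simp add: c_def)
  qed
  have "annotated_map n T \<alpha> x = shift_power n c (annotated_map n U \<beta> x)" if x: "x \<in> Xz n" for x
  proof (rule annotated_map_eqI[OF T(1,2) \<alpha> x])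
    obtain k where k: "sync_level n T k" using T(2) by (auto simp: strongly_synchronizing_def)
    let ?y = "annotated_map n U \<beta> x"
    have y: "?y \<in> Xz n" by (rule annotated_map_in[OF U \<beta> x])
    have fs: "forced_state n U x i = h (forced_state n T x i)" for i
    proof -
      have "h q0 \<in> St U" using q0 hom_St[OF T(1,2) hom] by simp
      then show ?thesis
        using forced_state_eq[OF T(1,2) x k q0, of i] hom_runs(1)[OF T(1,2) hom window_in_lists[OF x] q0]
          forced_state_eq[OF U x hom_sync_level[OF T(1,2) hom k], of "h q0" i] by simp
    qed
    have "out U (x i) (h (forced_state n T x i)) = out T (x i) (forced_state n T x i)" for i
      using hom forced_state_in[OF T(1,2) x] x by (simp add: transducer_hom_def Xz_iff)
    then show "annotated_image n T \<alpha> x (shift_power n c ?y)"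
      using annotated_map_image[OF U \<beta> x] shift_power_in[OF y] c[OF forced_state_in[OF T(1,2) x]] y
      unfolding annotated_image_def fs by (simp add: shift_power_apply algebra_simps)
  qed
  then show ?thesis by blast
qed

text \<open>The excess of output over input along a path from \<open>q0\<close> is taken as
  potential. It depends only on the end of the path: closing two such paths by the same return path
  gives loops, and these have excess zero.\<close>

lemma annotation_exists:
  assumes L: "L_transducer n T"
  shows "\<exists>\<alpha>. annotation n T \<alpha>"
proof -
  have M: "M_transducer n T" using L by (simp add: L_transducer_def)
  have T: "is_transducer n T" "is_core n T" using M_transducerD[OF M] by simp_all
  have conn: "\<exists>w\<in>lists {..<n}. steps T w p = q" if "p \<in> St T" "q \<in> St T" for p q
    using core_strongly_connected[OF T(2)] that unfolding strongly_connected_def by blast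
  obtain q0 where q0: "q0 \<in> St T" using St_nonempty[OF T(1)] by blast
  define d where "d w = int (length (outs T w q0)) - int (length w)" for w
  have d: "d v = d w" if v: "v \<in> lists {..<n}" "w \<in> lists {..<n}" "steps T v q0 = steps T w q0" for v w
  proof -
    obtain u where u: "u \<in> lists {..<n}" "steps T u (steps T w q0) = q0"
      using conn[OF steps_in_St[OF T(1) v(2) q0] q0] by blast
    have loop: "length (outs T (z @ u) q0) = length (z @ u)"
      if "z \<in> lists {..<n}" "steps T z q0 = steps T w q0" for z
    proof -
      have "z @ u \<in> lists {..<n}" "steps T (z @ u) q0 = q0" using that u by simp_all
      then show ?thesis using L q0 unfolding L_transducer_def by blast
    qed
    show ?thesis
      using loop[OF v(1,3)] loop[OF v(2) refl] v(3) by (simp add: d_def)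
  qed
  define \<alpha> where "\<alpha> q = d (SOME w. w \<in> lists {..<n} \<and> steps T w q0 = q)" for q
  have \<alpha>: "\<alpha> (steps T w q0) = d w" if w: "w \<in> lists {..<n}" for w
  proof -
    have "(SOME v. v \<in> lists {..<n} \<and> steps T v q0 = steps T w q0) \<in> lists {..<n} \<and>
        steps T (SOME v. v \<in> lists {..<n} \<and> steps T v q0 = steps T w q0) q0 = steps T w q0"
      by (rule someI[of "\<lambda>v. v \<in> lists {..<n} \<and> steps T v q0 = steps T w q0" w]) (use w in simp)
    then show ?thesis using d w unfolding \<alpha>_def by blast
  qed
  have "annotation n T \<alpha>"
    unfolding annotation_def
  proof (intro ballI)
    fix q w assume q: "q \<in> St T" and w: "w \<in> lists {..<n}"
    obtain v where v: "v \<in> lists {..<n}" "steps T v q0 = q" using conn[OF q0 q] by blast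
    have "\<alpha> (steps T w q) = d (v @ w)" using \<alpha>[of "v @ w"] v w by simp
    moreover have "\<alpha> q = d v" using \<alpha>[OF v(1)] v(2) by simp
    ultimately show "\<alpha> (steps T w q) = \<alpha> q + int (length (outs T w q)) - int (length w)"
      using v(2) by (simp add: d_def)
  qed
  then show ?thesis by blast
qed

text \<open>Equal transducers are isomorphic and annotations are unique up to a constant, so all
  members of the union in \<open>L_to_End\<close> coincide.\<close>

lemma L_to_End_class:
  fixes T :: "nat transducer"
  assumes n: "n \<ge> 1" and M: "M_transducer n T" and \<alpha>: "annotation n T \<alpha>"
  shows "L_to_End n (transducer_class n T) = shift_class n (annotated_map n T \<alpha>)"
proof -
  have T: "is_transducer n T" "strongly_synchronizing n T" "is_core n T" using M_transducerD[OF M] by simp_all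
  have "shift_class n (annotated_map n U \<beta>) = shift_class n (annotated_map n T \<alpha>)"
    if U: "U \<in> transducer_class n T" and \<beta>: "annotation n U \<beta>" for U \<beta>
  proof -
    have MU: "M_transducer n U" "transducer_eq n T U" using U by (simp_all add: transducer_class_def)
    have tU: "is_transducer n U" "strongly_synchronizing n U" using M_transducerD[OF MU(1)] by simp_all
    obtain f where f: "bij_betw f (St T) (St U)" "\<And>q. q \<in> St T \<Longrightarrow> omega_equiv n T q U (f q)"
      using MU(2) by (auto simp: transducer_eq_def)
    have "\<exists>c. \<forall>x\<in>Xz n. annotated_map n T \<alpha> x = shift_power n c (annotated_map n U \<beta> x)"
      by (rule annotated_map_hom[OF T(1,2) core_strongly_connected[OF T(3)]
            transducer_eq_hom[OF n M MU(1) f] \<alpha> \<beta>])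
    then show ?thesis
      using shift_class_eq_iff[OF annotated_map_End[OF T(1,2) \<alpha>] annotated_map_End[OF tU \<beta>]] by simp
  qed
  moreover have "T \<in> transducer_class n T" by (rule in_own_class[OF n M])
  ultimately show ?thesis using \<alpha> unfolding L_to_End_def by blast
qed


section \<open>Sliding block codes as transducers\<close>

text \<open>The states are the vertices of the de Bruijn graph: the last \<open>N\<close> letters
  are remembered, and \<open>g\<close> is applied to them together with the letter being
  read.\<close>

definition block_transducer :: "nat \<Rightarrow> nat \<Rightarrow> (nat list \<Rightarrow> nat) \<Rightarrow> nat list transducer" where
  "block_transducer n N g = \<lparr>St = words_of_length n N, step = (\<lambda>a w. tl (w @ [a])),
     out = (\<lambda>a w. [g (w @ [a])])\<rparr>"

context
  fixes n N :: nat and g and T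
  assumes n: "n \<ge> 1" and g: "\<forall>w\<in>words_of_length n (Suc N). g w < n"
    and T_def: "T = block_transducer n N g"
begin

lemma block_steps: "steps T v w = drop (length v) (w @ v)"
proof (induction v arbitrary: w)
  case (Cons a v)
  have "steps T (a # v) w = drop (length v) (tl (w @ [a]) @ v)"
    using Cons by (simp add: T_def block_transducer_def)
  also have "\<dots> = drop (length v) (tl (w @ a # v))" by (cases w) auto
  finally show ?case by (metis drop_Suc length_Cons)
qed simp

lemma block_length_outs: "length (outs T v w) = length v"
  by (induction v arbitrary: w) (auto simp: T_def block_transducer_def)

lemma block_is_transducer: "is_transducer n T"
  unfolding is_transducer_def
proof (intro conjI allI ballI impI)
  have St: "St T = words_of_length n N" by (simp add: T_def block_transducer_def)
  have "words_of_length n N = {w. set w \<subseteq> {..<n} \<and> length w = N}"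
    by (auto simp: words_of_length_def)
  then show "finite (St T)" using St finite_lists_length_eq[of "{..<n}" N] by simp
  show "St T \<noteq> {}" using words_of_length_nonempty[OF n, of N] St by blast
  fix a q assume a: "a < n" "q \<in> St T"
  then have "q @ [a] \<in> words_of_length n (Suc N)" using St by (simp add: words_of_length_def)
  moreover from this have "drop 1 (q @ [a]) \<in> words_of_length n N"
    using drop_in_lists[of "q @ [a]" "{..<n}" 1]
    unfolding words_of_length_def by (simp del: drop_append)
  ultimately show "step T a q \<in> St T" "out T a q \<in> lists {..<n}"
    using g unfolding St by (simp_all add: T_def block_transducer_def drop_Suc del: drop_append)
next
  fix w :: "nat list" and q assume "w \<noteq> []"
  then show "outs T w q \<noteq> []" using block_length_outs[of w q] by auto
qed

lemma block_sync_level: "sync_level n T N"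
proof -
  have "St T = words_of_length n N" by (simp add: T_def block_transducer_def)
  then show ?thesis by (simp add: sync_level_def block_steps words_of_length_def)
qed

lemma block_is_core: "is_core n T"
  unfolding is_core_iff
proof
  show "St (core n T) \<subseteq> St T" by (rule core_subset[OF block_is_transducer])
  show "St T \<subseteq> St (core n T)"
  proof
    fix w assume w: "w \<in> St T"
    then have w': "w \<in> words_of_length n N" by (simp add: T_def block_transducer_def)
    then have "w = steps T w w" by (simp add: block_steps words_of_length_def)
    then show "w \<in> St (core n T)" using block_sync_level w w' unfolding St_core by blast
  qed
qed

lemma block_sync: "strongly_synchronizing n T"
  using block_sync_level by (auto simp: strongly_synchronizing_def)

lemma block_L: "L_transducer n (reduction n T)"
  by (rule reduction_L[OF n block_is_transducer block_sync block_is_core]) (rule block_length_outs)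

lemma block_forced_state:
  assumes x: "x \<in> Xz n"
  shows "forced_state n T x i = window x (i - int N) N"
proof -
  have w: "window x (i - int N) N \<in> St T"
    using window_in_lists[OF x] by (simp add: T_def block_transducer_def words_of_length_def)
  show ?thesis
    using forced_state_eq[OF block_is_transducer block_sync x block_sync_level w]
    by (simp add: block_steps)
qed

lemma block_annotation: "annotation n T (\<lambda>_. 0)"
  by (simp add: annotation_def block_length_outs)

lemma block_out:
  assumes x: "x \<in> Xz n"
  shows "out T (x i) (forced_state n T x i) = [g (window x (i - int N) (Suc N))]"
  using window_append[of x "i - int N" N 1] block_forced_state[OF x]
  by (simp add: T_def block_transducer_def window_def)

lemma block_annotated_map:
  assumes x: "x \<in> Xz n"
  shows "annotated_map n T (\<lambda>_. 0) x = (\<lambda>i. g (window x (i - int N) (Suc N)))"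
proof (rule annotated_map_eqI[OF block_is_transducer block_sync block_annotation x])
  have "window x (i - int N) (Suc N) \<in> words_of_length n (Suc N)" for i
    using window_in_lists[OF x] by (simp add: words_of_length_def)
  then have "(\<lambda>i. g (window x (i - int N) (Suc N))) \<in> Xz n" using g by (simp add: Xz_iff)
  then show "annotated_image n T (\<lambda>_. 0) x (\<lambda>i. g (window x (i - int N) (Suc N)))"
    by (simp add: annotated_image_def block_out[OF x])
qed

text \<open>The right half of the image of a point is what the forced state makes of the right half
  of the point. This brings the prefixes \<open>Lam\<close>, defined through infinite words, to bear
  on bi-infinite ones.\<close>

lemma state_map_block:
  assumes x: "x \<in> Xz n"
  shows "state_map T (forced_state n T x i) (\<lambda>j. x (i + int j)) =
    (\<lambda>j. annotated_map n T (\<lambda>_. 0) x (i + int j))"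
proof (rule state_map_cong[OF block_is_transducer forced_state_in[OF block_is_transducer block_sync x]])
  show "(\<lambda>j. x (i + int j)) \<in> inf_words n" using x by (auto simp: inf_words_def Xz_iff)
  fix m
  let ?o = "outs T (window x i m) (forced_state n T x i)"
  let ?y = "\<lambda>j. annotated_map n T (\<lambda>_. 0) x (i + int j)"
  have p: "prefix m (\<lambda>j. x (i + int j)) = window x i m" by (simp add: subsequence_def window_def)
  have len: "length ?o = m" by (simp add: block_length_outs)
  have "prefix (length ?o) ?y = ?o"
    using annotated_map_run[OF block_is_transducer block_sync block_annotation x, of _ i m] len
    by (intro nth_equalityI) auto
  then show "\<exists>k\<ge>m. prefix (length (outs T (prefix k (\<lambda>j. x (i + int j))) (forced_state n T x i))) ?y =
      outs T (prefix k (\<lambda>j. x (i + int j))) (forced_state n T x i)"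
    using p by (intro exI[of _ m]) simp
qed

text \<open>Removing incomplete response delays the output of a state by the length of the removed prefix,
  so these lengths form an annotation.\<close>

lemma block_annotated_hom_finite:
  assumes fin: "\<forall>q\<in>St T. extent n T q \<noteq> \<infinity>"
  defines "C \<equiv> remove_incomplete_response n T"
  shows "annotation n C (\<lambda>q. int (length (Lam n T [] q)))"
    and "x \<in> Xz n \<Longrightarrow> annotated_map n C (\<lambda>q. int (length (Lam n T [] q))) x =
      annotated_map n T (\<lambda>_. 0) x"
proof -
  let ?L = "\<lambda>q. Lam n T [] q"
  note Tt = n block_is_transducer block_sync block_is_core fin
  have C: "is_transducer n C" "strongly_synchronizing n C" "is_core n C"
    unfolding C_def using remove_is_transducer[OF Tt] remove_sync[OF Tt] remove_core[OF Tt] .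
  have stC: "St C = St T" "\<And>w q. steps C w q = steps T w q"
    unfolding C_def using St_remove[OF Tt] steps_remove[OF Tt] by blast+
  show ann: "annotation n C (\<lambda>q. int (length (?L q)))"
    unfolding annotation_def
  proof (intro ballI)
    fix q w assume q: "q \<in> St C" and w: "w \<in> lists {..<n}"
    have "?L q @ outs C w q = outs T w q @ ?L (steps T w q)"
      unfolding C_def using outs_remove[OF Tt _ w] q stC(1) by simp
    then have "length (?L q @ outs C w q) = length (outs T w q @ ?L (steps T w q))" by simp
    then show "int (length (?L (steps C w q))) =
        int (length (?L q)) + int (length (outs C w q)) - int (length w)"
      by (simp add: stC(2) block_length_outs)
  qed
  assume x: "x \<in> Xz n"
  let ?y = "annotated_map n T (\<lambda>_. 0) x"
  have fs: "forced_state n C x i = forced_state n T x i" for i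
    unfolding forced_state_def sync_level_def stC by simp
  have fT: "forced_state n T x i \<in> St T" for i
    by (rule forced_state_in[OF block_is_transducer block_sync x])
  show "annotated_map n C (\<lambda>q. int (length (?L q))) x = ?y"
  proof (rule annotated_map_eqI[OF C(1,2) ann x])
    have "?y (i + int (length (?L (forced_state n T x i))) + int l) = out C (x i) (forced_state n T x i) ! l"
      if l: "l < length (out C (x i) (forced_state n T x i))" for i l
    proof -
      let ?q = "forced_state n T x i"
      have aw: "[x i] \<in> lists {..<n}" using x by (simp add: Xz_iff)
      have z: "(\<lambda>j. x (i + 1 + int j)) \<in> inf_words n" "(\<lambda>j. x (i + int j)) \<in> inf_words n"
        using x by (auto simp: inf_words_def Xz_iff)
      have split: "(\<lambda>j. x (i + int j)) = [x i] \<frown> (\<lambda>j. x (i + 1 + int j))"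
        by (auto simp: conc_def fun_eq_iff of_nat_diff)
      have q: "?q \<in> St C" using fT stC(1) by simp
      \<comment> \<open>Read from position \<open>i\<close>, the image begins with the removed
        prefix of the forced state, and the output of \<open>C\<close> follows right after
        it.\<close>
      have "(\<lambda>j. ?y (i + int j)) = state_map T ?q (\<lambda>j. x (i + int j))" using state_map_block[OF x] by simp
      also have "\<dots> = ?L ?q \<frown> state_map C ?q (\<lambda>j. x (i + int j))"
        unfolding C_def by (rule state_map_remove[OF Tt fT z(2)])
      also have "\<dots> = ?L ?q \<frown> (outs C [x i] ?q \<frown> state_map C (steps C [x i] ?q) (\<lambda>j. x (i + 1 + int j)))"
        unfolding split using state_map_conc[OF C(1) q aw z(1)] by simp
      finally have eq: "(\<lambda>j. ?y (i + int j)) =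
          ?L ?q \<frown> (out C (x i) ?q \<frown> state_map C (steps C [x i] ?q) (\<lambda>j. x (i + 1 + int j)))" by simp
      have "?y (i + int (length (?L ?q) + l)) = out C (x i) ?q ! l"
        using fun_cong[OF eq, of "length (?L ?q) + l"] l by (simp add: conc_def)
      then show ?thesis by (simp add: add.assoc)
    qed
    moreover have "?y \<in> Xz n" by (rule annotated_map_in[OF block_is_transducer block_sync block_annotation x])
    ultimately show "annotated_image n C (\<lambda>q. int (length (?L q))) x ?y"
      by (simp add: annotated_image_def fs)
  qed
qed

text \<open>Preservation of lengths on loops makes the prime word of the reduction a single letter
  \<open>b\<close>. Every transition can be reached from \<open>q\<close>, whose output is
  constantly \<open>b\<close>, so each transition outputs \<open>b\<close> and collapsing all states
  respects outputs.\<close>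

lemma block_hom_infinite:
  assumes q: "q \<in> St T" "extent n T q = \<infinity>"
  shows "transducer_hom n (\<lambda>_. St T) T (reduction n T)"
proof -
  obtain x d where x: "reduction n T = Z_transducer (St T) x" "d \<in> rotations x"
    "\<And>z. z \<in> inf_words n \<Longrightarrow> state_map T q z = d\<^sup>\<omega>"
    using reduction_infinite_extent[OF n block_is_transducer block_sync block_is_core q] by blast
  have "St T \<in> St (reduction n T)" "steps (reduction n T) [0] (St T) = St T" "[0] \<in> lists {..<n}"
    using x(1) n by (simp_all add: Z_transducer_def)
  then have "length (outs (reduction n T) [0] (St T)) = length [0::nat]"
    using block_L unfolding L_transducer_def by blast
  then have lx: "length x = 1" using x(1) by (simp add: Z_transducer_def)
  then obtain b where b: "x = [b]" by (auto simp: length_Suc_conv)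
  then have d: "d = [b]" using x(2) by (auto simp: rotations_def)
  have out_b: "out T a p = [b]" if a: "a < n" and p: "p \<in> St T" for a p
  proof -
    obtain v where v: "v \<in> lists {..<n}" "steps T v q = p"
      using core_strongly_connected[OF block_is_core] q(1) p unfolding strongly_connected_def by blast
    define z where "z = (v @ [a]) \<frown> (\<lambda>_. 0 :: nat)"
    have va: "v @ [a] \<in> lists {..<n}" using v(1) a by simp
    have z0: "(\<lambda>_. 0) \<in> inf_words n" by (rule inf_words_nonempty[OF n])
    have "d\<^sup>\<omega> = outs T (v @ [a]) q \<frown> state_map T (steps T (v @ [a]) q) (\<lambda>_. 0)"
      using x(3)[OF inf_words_conc[OF va z0]] state_map_conc[OF block_is_transducer q(1) va z0] by simp
    then have "d\<^sup>\<omega> (length v) = (outs T (v @ [a]) q \<frown> state_map T (steps T (v @ [a]) q) (\<lambda>_. 0)) (length v)"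
      by simp
    also have "\<dots> = outs T (v @ [a]) q ! length v"
      by (rule conc_fst) (simp add: block_length_outs del: outs_append)
    also have "\<dots> = out T a p ! 0" using v(2) by (simp add: nth_append block_length_outs)
    finally have "out T a p ! 0 = b" using d by simp
    moreover have "length (out T a p) = 1" by (simp add: T_def block_transducer_def)
    ultimately show ?thesis by (auto simp: length_Suc_conv)
  qed
  have "St T \<noteq> {}" using q(1) by blast
  then show ?thesis
    using out_b x(1) b by (auto simp: transducer_hom_def Z_transducer_def)
qed

end

lemma transducer_hom_trans:
  assumes h: "transducer_hom n h T U" and k: "transducer_hom n k U V"
  shows "transducer_hom n (k \<circ> h) T V"
  unfolding transducer_hom_def
proof (intro conjI allI ballI impI)
  have "h ` St T = St U" "k ` St U = St V" using h k by (simp_all add: transducer_hom_def)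
  then show "(k \<circ> h) ` St T = St V" by (metis image_comp)
  fix a q assume a: "a < n" "q \<in> St T"
  then have "h q \<in> St U" using h by (auto simp: transducer_hom_def)
  then show "step V a ((k \<circ> h) q) = (k \<circ> h) (step T a q)" "out V a ((k \<circ> h) q) = out T a q"
    using a h k by (simp_all add: transducer_hom_def)
qed

text \<open>Coordinate 0 of the image depends on the coordinates from \<open>- K\<close> to
  \<open>K\<close>. Composing with a power of the shift delays the output until all of them have
  been read, so the code looks only at the past and can be run by a transducer.\<close>

lemma shift_End_block_code:
  assumes n: "n \<ge> 1" and \<phi>: "\<phi> \<in> shift_End n"
  shows "\<exists>N K g. (\<forall>w\<in>words_of_length n (Suc N). g w < n) \<and>
    (\<forall>x\<in>Xz n. shift_power n K (\<phi> x) = (\<lambda>i. g (window x (i - int N) (Suc N))))"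
proof -
  obtain I where I: "finite I" "\<And>x y. x \<in> Xz n \<Longrightarrow> y \<in> Xz n \<Longrightarrow> \<forall>i\<in>I. y i = x i \<Longrightarrow> \<phi> y 0 = \<phi> x 0"
    using local_if_continuous_map[OF shift_EndD(2)[OF \<phi>], of 0] by blast
  obtain K :: nat where K: "\<And>i. i \<in> I \<Longrightarrow> \<bar>i\<bar> \<le> int K"
  proof -
    have "finite ((\<lambda>i. nat \<bar>i\<bar>) ` I)" using I(1) by simp
    then have "\<forall>i\<in>I. nat \<bar>i\<bar> \<le> Max (insert 0 ((\<lambda>i. nat \<bar>i\<bar>) ` I))" by simp
    then show ?thesis using that[of "Max (insert 0 ((\<lambda>i. nat \<bar>i\<bar>) ` I))"] by fastforce
  qed
  define N where "N = 2 * K"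
  \<comment> \<open>The word is placed with its first letter at \<open>- K\<close>. The zeros
    outside are arbitrary, as positions beyond distance \<open>K\<close> do not influence coordinate
    0.\<close>
  define pad where "pad w i = (if 0 \<le> i + int K \<and> i + int K < int (length w) then w ! nat (i + int K) else 0)"
    for w :: "nat list" and i
  define g where "g w = \<phi> (pad w) 0" for w
  have pad: "pad w \<in> Xz n" if "w \<in> words_of_length n k" for w k
    using that n by (auto simp: Xz_iff pad_def words_of_length_def)
  have "g w < n" if "w \<in> words_of_length n (Suc N)" for w
    using shift_EndD(3)[OF \<phi> pad[OF that]] by (simp add: g_def Xz_iff)
  moreover have "shift_power n (int K) (\<phi> x) = (\<lambda>i. g (window x (i - int N) (Suc N)))" if x: "x \<in> Xz n" for x
  proof
    fix i
    \<comment> \<open>This translation moves position \<open>i - K\<close>, the centre of the window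
      ending at \<open>i\<close>, to the origin.\<close>
    define c where "c = int K - i"
    have cx: "shift_power n c x \<in> Xz n" by (rule shift_power_in[OF x])
    define w where "w = window x (i - int N) (Suc N)"
    have w: "w \<in> words_of_length n (Suc N)"
      using window_in_lists[OF x] by (simp add: w_def words_of_length_def)
    have "\<forall>j\<in>I. pad w j = shift_power n c x j"
    proof
      fix j assume "j \<in> I"
      then have j: "\<bar>j\<bar> \<le> int K" by (rule K)
      have "0 \<le> j + int K" "j + int K < int (length w)" "nat (j + int K) < Suc N"
        using abs_le_D1[OF j] abs_le_D2[OF j] by (simp_all add: w_def N_def nat_less_iff)
      then have "pad w j = x (i - int N + int (nat (j + int K)))"
        unfolding pad_def by (simp only: if_True simp_thms) (simp only: w_def nth_window)
      also have "\<dots> = x (j - c)"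
      proof -
        have "i - int N + int (nat (j + int K)) = j - c" using j by (simp add: c_def N_def)
        then show ?thesis by (simp only:)
      qed
      finally show "pad w j = shift_power n c x j" using x by (simp add: shift_power_apply)
    qed
    then have "g w = \<phi> (shift_power n c x) 0" using I(2)[OF cx pad[OF w]] by (simp add: g_def)
    also have "\<dots> = \<phi> x (i - int K)"
      using shift_End_commutes[OF \<phi> x] shift_EndD(3)[OF \<phi> x] by (simp add: shift_power_apply c_def)
    finally show "shift_power n (int K) (\<phi> x) i = g (window x (i - int N) (Suc N))"
      using shift_EndD(3)[OF \<phi> x] by (simp add: shift_power_apply w_def)
  qed
  ultimately show ?thesis by blast
qed

lemma L_to_End_surj:
  assumes n: "n \<ge> 1" and \<phi>: "\<phi> \<in> shift_End n"
  shows "\<exists>T :: nat transducer. \<exists>\<alpha>. L_transducer n T \<and> annotation n T \<alpha> \<and>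
    shift_class n (annotated_map n T \<alpha>) = shift_class n \<phi>"
proof -
  obtain N K g where g: "\<forall>w\<in>words_of_length n (Suc N). g w < n"
    and \<phi>g: "\<And>x. x \<in> Xz n \<Longrightarrow> shift_power n K (\<phi> x) = (\<lambda>i. g (window x (i - int N) (Suc N)))"
    using shift_End_block_code[OF n \<phi>] by blast
  define B where "B = block_transducer n N g"
  note blk = n g B_def
  note B = block_is_transducer[OF blk] block_sync[OF blk] block_is_core[OF blk]
  define R where "R = reduction n B"
  have L: "L_transducer n R" unfolding R_def by (rule block_L[OF blk])
  then have M: "M_transducer n R" by (simp add: L_transducer_def)
  obtain V :: "nat transducer" where V: "M_transducer n V" "transducer_eq n R V"
    using nat_representative_exists[OF M] by blast
  obtain f where f: "bij_betw f (St R) (St V)" "\<And>q. q \<in> St R \<Longrightarrow> omega_equiv n R q V (f q)"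
    using V(2) by (auto simp: transducer_eq_def)
  have LV: "L_transducer n V" by (rule transducer_eq_L[OF n L V])
  have tV: "is_transducer n V" "strongly_synchronizing n V" using M_transducerD[OF V(1)] by simp_all
  obtain \<beta> where \<beta>: "annotation n V \<beta>" using annotation_exists[OF LV] by blast
  have homf: "transducer_hom n f R V" by (rule transducer_eq_hom[OF n M V(1) f])
  \<comment> \<open>Homomorphisms preserve annotated maps up to a shift. For infinite extents the
    block transducer itself maps onto its reduction; for finite extents its version without
    incomplete response does, and that version induces the same map.\<close>
  have "\<exists>c. \<forall>x\<in>Xz n. annotated_map n B (\<lambda>_. 0) x = shift_power n c (annotated_map n V \<beta> x)"
  proof (cases "\<exists>q\<in>St B. extent n B q = \<infinity>")
    case True
    then obtain q where q: "q \<in> St B" "extent n B q = \<infinity>" by blast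
    have "transducer_hom n (f \<circ> (\<lambda>_. St B)) B V"
      by (rule transducer_hom_trans[OF _ homf]) (unfold R_def, rule block_hom_infinite[OF blk q])
    then show ?thesis
      by (rule annotated_map_hom[OF B(1,2) core_strongly_connected[OF B(3)] _ block_annotation[OF blk] \<beta>])
  next
    case False
    then have fin: "\<forall>q\<in>St B. extent n B q \<noteq> \<infinity>" by simp
    let ?C = "remove_incomplete_response n B"
    note C = remove_is_transducer[OF n B fin] remove_sync[OF n B fin] remove_core[OF n B fin]
    have "R = identify_equiv_states n ?C"
      unfolding R_def reduction_def using False by (rule if_not_P)
    then have "transducer_hom n (omega_class n ?C) ?C R" using identify_hom[OF n B fin] by simp
    then have "transducer_hom n (f \<circ> omega_class n ?C) ?C V"
      by (rule transducer_hom_trans[OF _ homf])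
    then obtain c where "\<forall>x\<in>Xz n. annotated_map n ?C (\<lambda>q. int (length (Lam n B [] q))) x =
        shift_power n c (annotated_map n V \<beta> x)"
      using annotated_map_hom[OF C(1,2) core_strongly_connected[OF C(3)] _
          block_annotated_hom_finite(1)[OF blk fin] \<beta>] by blast
    then show ?thesis using block_annotated_hom_finite(2)[OF blk fin] by (intro exI[of _ c]) simp
  qed
  then obtain c where c: "\<And>x. x \<in> Xz n \<Longrightarrow>
      annotated_map n B (\<lambda>_. 0) x = shift_power n c (annotated_map n V \<beta> x)"
    by blast
  note FV = annotated_map_End[OF tV \<beta>]
  have "\<phi> x = shift_power n (c - K) (annotated_map n V \<beta> x)" if x: "x \<in> Xz n" for x
  proof -
    have "shift_power n K (\<phi> x) = shift_power n c (annotated_map n V \<beta> x)"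
      using \<phi>g[OF x] block_annotated_map[OF blk x] c[OF x] by simp
    then have "shift_power n (- K) (shift_power n K (\<phi> x)) =
        shift_power n (- K) (shift_power n c (annotated_map n V \<beta> x))" by simp
    then show ?thesis
      using shift_power_add[OF shift_EndD(3)[OF \<phi> x]] shift_power_add[OF shift_EndD(3)[OF FV x]]
        shift_EndD(3)[OF \<phi> x] by (simp add: shift_power_0)
  qed
  then have "shift_class n \<phi> = shift_class n (annotated_map n V \<beta>)"
    using shift_class_eq_iff[OF \<phi> FV] by blast
  then show ?thesis using LV \<beta> by metis
qed


section \<open>The periodic orbit representation\<close>

text \<open>Members of a class differ by powers of the shift, which preserve orbits, so the orbit
  word of the image is the same for all of them.\<close>

lemma periodic_orbit_rep_annotated_map:
  fixes T :: "nat transducer"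
  assumes n: "n \<ge> 1" and M: "M_transducer n T" and \<alpha>: "annotation n T \<alpha>"
  shows "periodic_orbit_rep n (shift_class n (annotated_map n T \<alpha>)) =
    cyclic_action n (transducer_class n T)"
proof
  fix c
  have T: "is_transducer n T" "strongly_synchronizing n T" using M_transducerD[OF M] by simp_all
  let ?F = "annotated_map n T \<alpha>"
  have F: "?F \<in> shift_End n" by (rule annotated_map_End[OF T \<alpha>])
  show "periodic_orbit_rep n (shift_class n ?F) c = cyclic_action n (transducer_class n T) c"
  proof (cases "c \<in> prime_cyclic_words n")
    case c: True
    obtain g where g: "g \<in> c" using prime_cyclic_words_nonempty[OF c] by blast
    have orbit: "orbit_word n (\<phi> x) = cyclic_image T g"
      if \<phi>: "\<phi> \<in> shift_class n ?F" and x: "periodic_point n x" "orbit_word n x = c" for \<phi> x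
    proof -
      have xz: "x \<in> Xz n" using x(1) by (simp add: periodic_point_def)
      obtain i where "\<phi> \<in> shift_End n" "?F x = shift_power n i (\<phi> x)"
        using \<phi> in_shift_class_iff[OF F] xz by blast
      then have "orbit_word n (\<phi> x) = orbit_word n (?F x)"
        using orbit_word_shift(2)[OF shift_End_periodic[OF _ x(1)]] by metis
      then show ?thesis using orbit_word_annotated_map[OF T \<alpha> x(1)] x(2) g by simp
    qed
    have "c = rotations g" "g \<in> lists {..<n}" "prime_word g" using prime_cyclic_wordsD[OF c g] by simp_all
    then obtain x where x: "periodic_point n x" "orbit_word n x = c"
      using periodic_point_exists by metis
    have "(THE d. \<exists>\<phi>\<in>shift_class n ?F. \<exists>x. periodic_point n x \<and> orbit_word n x = c \<and> d = orbit_word n (\<phi> x)) =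
        cyclic_image T g"
    proof (rule the_equality)
      show "\<exists>\<phi>\<in>shift_class n ?F. \<exists>x. periodic_point n x \<and> orbit_word n x = c \<and>
          cyclic_image T g = orbit_word n (\<phi> x)"
        using orbit[OF self_in_shift_class[OF F] x] self_in_shift_class[OF F] x by metis
      fix d
      assume "\<exists>\<phi>\<in>shift_class n ?F. \<exists>x. periodic_point n x \<and> orbit_word n x = c \<and> d = orbit_word n (\<phi> x)"
      then show "d = cyclic_image T g" using orbit by blast
    qed
    then show ?thesis using c cyclic_action_eq[OF n M c g] by (simp add: periodic_orbit_rep_def)
  qed (simp add: periodic_orbit_rep_def cyclic_action_def)
qed

lemma L_set_representative:
  assumes "n \<ge> 1" "A \<in> L_set n"
  shows "\<exists>(T :: nat transducer) \<alpha>. L_transducer n T \<and> M_transducer n T \<and> annotation n T \<alpha> \<and>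
    A = transducer_class n T \<and>
    L_to_End n A = shift_class n (annotated_map n T \<alpha>) \<and> annotated_map n T \<alpha> \<in> shift_End n"
proof -
  obtain T :: "nat transducer" where T: "L_transducer n T" "A = transducer_class n T"
    using assms(2) by (auto simp: L_set_def)
  then have M: "M_transducer n T" by (simp add: L_transducer_def)
  obtain \<alpha> where \<alpha>: "annotation n T \<alpha>" using annotation_exists[OF T(1)] by blast
  have "is_transducer n T" "strongly_synchronizing n T" using M_transducerD[OF M] by simp_all
  then show ?thesis
    using T M \<alpha> L_to_End_class[OF assms(1) M \<alpha>] annotated_map_End by blast
qed

lemma periodic_orbit_rep_L_to_End:
  assumes n: "n \<ge> 1" and A: "A \<in> L_set n"
  shows "periodic_orbit_rep n (L_to_End n A) = cyclic_action n A"
proof -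
  obtain T :: "nat transducer" and \<alpha> where "M_transducer n T" "annotation n T \<alpha>" "A = transducer_class n T"
    "L_to_End n A = shift_class n (annotated_map n T \<alpha>)"
    using L_set_representative[OF n A] by blast
  then show ?thesis using periodic_orbit_rep_annotated_map[OF n] by simp
qed

text \<open>Both sides act in the same way on prime cyclic words, on which the action of transducers is
  faithful.\<close>

lemma L_to_End_mult:
  assumes n: "n \<ge> 2" and A: "A \<in> L_set n" and B: "B \<in> L_set n"
  shows "L_to_End n (A \<otimes>\<^bsub>M_monoid n\<^esub> B) = L_to_End n A \<otimes>\<^bsub>End_quotient n\<^esub> L_to_End n B"
proof -
  have n1: "n \<ge> 1" using n by simp
  interpret submonoid "L_set n" "M_monoid n" by (rule L_set_submonoid[OF n])
  obtain T :: "nat transducer" and \<alpha> where T: "M_transducer n T" "annotation n T \<alpha>" "A = transducer_class n T"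
    "L_to_End n A = shift_class n (annotated_map n T \<alpha>)" "annotated_map n T \<alpha> \<in> shift_End n"
    using L_set_representative[OF n1 A] by blast
  obtain U :: "nat transducer" and \<beta> where U: "M_transducer n U" "annotation n U \<beta>" "B = transducer_class n U"
    "L_to_End n B = shift_class n (annotated_map n U \<beta>)" "annotated_map n U \<beta> \<in> shift_End n"
    using L_set_representative[OF n1 B] by blast
  let ?F = "compose (Xz n) (annotated_map n U \<beta>) (annotated_map n T \<alpha>)"
  have F: "?F \<in> shift_End n" by (rule shift_End_compose[OF T(5) U(5)])
  \<comment> \<open>Taking a representative of the composite from surjectivity avoids annotating the
    reduced product of \<open>T\<close> and \<open>U\<close>; it remains to compare the
    actions.\<close>
  obtain V :: "nat transducer" and \<gamma> where V: "L_transducer n V" "annotation n V \<gamma>"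
    "shift_class n (annotated_map n V \<gamma>) = shift_class n ?F"
    using L_to_End_surj[OF n1 F] by blast
  have MV: "M_transducer n V" using V(1) by (simp add: L_transducer_def)
  have tT: "is_transducer n T" "strongly_synchronizing n T"
    and tU: "is_transducer n U" "strongly_synchronizing n U"
    and tV: "is_transducer n V" "strongly_synchronizing n V"
    using M_transducerD[OF T(1)] M_transducerD[OF U(1)] M_transducerD[OF MV] by simp_all
  have FV: "annotated_map n V \<gamma> \<in> shift_End n" by (rule annotated_map_End[OF tV V(2)])
  have "cyclic_action n (transducer_class n V) = cyclic_action n (A \<otimes>\<^bsub>M_monoid n\<^esub> B)"
  proof
    fix c
    show "cyclic_action n (transducer_class n V) c = cyclic_action n (A \<otimes>\<^bsub>M_monoid n\<^esub> B) c"
    proof (cases "c \<in> prime_cyclic_words n")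
      case c: True
      obtain g where g: "g \<in> c" using prime_cyclic_words_nonempty[OF c] by blast
      have g': "c = rotations g" "g \<in> lists {..<n}" "g \<noteq> []" "prime_word g"
        using prime_cyclic_wordsD[OF c g] by simp_all
      obtain x where x: "periodic_point n x" "orbit_word n x = c"
        using periodic_point_exists g' by metis
      have xz: "x \<in> Xz n" using x(1) by (simp add: periodic_point_def)
      let ?x' = "annotated_map n T \<alpha> x"
      have x': "periodic_point n ?x'" by (rule shift_End_periodic[OF T(5) x(1)])
      have oT: "orbit_word n ?x' = cyclic_image T g"
        using orbit_word_annotated_map[OF tT T(2) x(1)] x(2) g by simp
      have d: "cyclic_image T g \<in> prime_cyclic_words n"
        by (rule cyclic_image_in_prime_cyclic_words[OF tT g'(2,3)])
      obtain v where v: "v \<in> cyclic_image T g" using prime_cyclic_words_nonempty[OF d] by blast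
      obtain i where "annotated_map n V \<gamma> x = shift_power n i (?F x)"
        using V(3) shift_class_eq_iff[OF FV F] xz by blast
      then have "annotated_map n V \<gamma> x = shift_power n i (annotated_map n U \<beta> ?x')"
        using xz by (simp add: compose_eq)
      then have "orbit_word n (annotated_map n V \<gamma> x) = orbit_word n (annotated_map n U \<beta> ?x')"
        using orbit_word_shift(2)[OF shift_End_periodic[OF U(5) x']] by simp
      then have "cyclic_image V g = cyclic_image U v"
        using orbit_word_annotated_map[OF tV V(2) x(1)] x(2) g
          orbit_word_annotated_map[OF tU U(2) x'] oT v by simp
      also have "\<dots> = cyclic_action n (A \<otimes>\<^bsub>M_monoid n\<^esub> B) c"
        unfolding T(3) U(3) cyclic_action_mult[OF n1 T(1) U(1)]
        using c cyclic_action_eq[OF n1 T(1) c g] cyclic_action_eq[OF n1 U(1) d v] by (simp add: compose_eq)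
      finally show ?thesis using cyclic_action_eq[OF n1 MV c g] by simp
    qed (simp add: cyclic_action_def)
  qed
  moreover have "transducer_class n V \<in> carrier (M_monoid n)" "A \<otimes>\<^bsub>M_monoid n\<^esub> B \<in> carrier (M_monoid n)"
    using class_in_carrier[OF n1 MV] m_closed[OF A B] by auto
  ultimately have "transducer_class n V = A \<otimes>\<^bsub>M_monoid n\<^esub> B"
    using cyclic_action_mon[OF n1] unfolding mon_def inj_on_def by blast
  then have "L_to_End n (A \<otimes>\<^bsub>M_monoid n\<^esub> B) = shift_class n (annotated_map n V \<gamma>)"
    using L_to_End_class[OF n1 MV V(2)] by simp
  then show ?thesis using V(3) T(4) U(4) mult_End_quotient[OF T(5) U(5)] by simp
qed

lemma L_to_End_iso:
  assumes n: "n \<ge> 2"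
  shows "L_to_End n \<in> iso (L_monoid n) (End_quotient n)"
proof (rule isoI)
  have n1: "n \<ge> 1" using n by simp
  have carrier: "carrier (L_monoid n) = L_set n" by (simp add: L_monoid_def)
  have closed: "L_to_End n A \<in> carrier (End_quotient n)" if "A \<in> L_set n" for A
    using L_set_representative[OF n1 that] carrier_End_quotient by blast
  show "L_to_End n \<in> hom (L_monoid n) (End_quotient n)"
  proof (rule homI)
    fix A B assume "A \<in> carrier (L_monoid n)" "B \<in> carrier (L_monoid n)"
    then show "L_to_End n A \<in> carrier (End_quotient n)"
      "L_to_End n (A \<otimes>\<^bsub>L_monoid n\<^esub> B) = L_to_End n A \<otimes>\<^bsub>End_quotient n\<^esub> L_to_End n B"
      using closed L_to_End_mult[OF n] by (simp_all add: L_monoid_def)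
  qed
  show "bij_betw (L_to_End n) (carrier (L_monoid n)) (carrier (End_quotient n))"
    unfolding bij_betw_def carrier
  proof
    show "inj_on (L_to_End n) (L_set n)"
    proof (rule inj_onI)
      fix A B assume A: "A \<in> L_set n" and B: "B \<in> L_set n" and eq: "L_to_End n A = L_to_End n B"
      \<comment> \<open>The class of the endomorphism determines the action through its periodic
        orbit representation.\<close>
      have "cyclic_action n A = cyclic_action n B"
        using periodic_orbit_rep_L_to_End[OF n1 A] periodic_orbit_rep_L_to_End[OF n1 B] eq by simp
      moreover have "A \<in> carrier (M_monoid n)" "B \<in> carrier (M_monoid n)"
        using submonoid.subset[OF L_set_submonoid[OF n]] A B by auto
      ultimately show "A = B" using cyclic_action_mon[OF n1] unfolding mon_def inj_on_def by blast
    qed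
    show "L_to_End n ` L_set n = carrier (End_quotient n)"
    proof
      show "L_to_End n ` L_set n \<subseteq> carrier (End_quotient n)" using closed by blast
      show "carrier (End_quotient n) \<subseteq> L_to_End n ` L_set n"
      proof
        fix X assume "X \<in> carrier (End_quotient n)"
        then obtain \<phi> where \<phi>: "\<phi> \<in> shift_End n" "X = shift_class n \<phi>" using carrier_End_quotient by blast
        obtain T :: "nat transducer" and \<alpha> where T: "L_transducer n T" "annotation n T \<alpha>"
          "shift_class n (annotated_map n T \<alpha>) = shift_class n \<phi>"
          using L_to_End_surj[OF n1 \<phi>(1)] by blast
        have M: "M_transducer n T" using T(1) by (simp add: L_transducer_def)
        have "X = L_to_End n (transducer_class n T)" using L_to_End_class[OF n1 M T(2)] T(3) \<phi>(2) by simp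
        then show "X \<in> L_to_End n ` L_set n" using T(1) by (auto simp: L_set_def)
      qed
    qed
  qed
qed

theorem theorem1p6:
  fixes n :: nat
  assumes "n \<ge> 2"
  shows "Group.monoid (End_quotient n) \<and> Group.monoid (M_monoid n) \<and>
    submonoid (L_set n) (M_monoid n) \<and>
    Group.monoid (transformation_monoid (prime_cyclic_words n)) \<and>
    L_to_End n \<in> iso (L_monoid n) (End_quotient n) \<and>
    (\<forall>(T :: nat transducer) \<alpha>. L_transducer n T \<and> annotation n T \<alpha> \<longrightarrow>
       annotated_map n T \<alpha> \<in> shift_End n \<and>
       L_to_End n (transducer_class n T) = shift_class n (annotated_map n T \<alpha>)) \<and>
    cyclic_action n \<in> mon (M_monoid n) (transformation_monoid (prime_cyclic_words n)) \<and>
    cyclic_action n \<one>\<^bsub>M_monoid n\<^esub> = \<one>\<^bsub>transformation_monoid (prime_cyclic_words n)\<^esub> \<and>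
    (\<forall>A \<in> carrier (L_monoid n). cyclic_action n A = periodic_orbit_rep n (L_to_End n A))"
proof (intro conjI allI impI ballI)
  have n1: "n \<ge> 1" using assms by simp
  show "Group.monoid (End_quotient n)" by (rule End_quotient_monoid)
  show "Group.monoid (M_monoid n)" by (rule M_monoid_is_monoid[OF assms])
  show "submonoid (L_set n) (M_monoid n)" by (rule L_set_submonoid[OF assms])
  show "Group.monoid (transformation_monoid (prime_cyclic_words n))"
    by (rule transformation_monoid_is_monoid)
  show "L_to_End n \<in> iso (L_monoid n) (End_quotient n)" by (rule L_to_End_iso[OF assms])
  show "cyclic_action n \<in> mon (M_monoid n) (transformation_monoid (prime_cyclic_words n))"
    by (rule cyclic_action_mon[OF n1])
  show "cyclic_action n \<one>\<^bsub>M_monoid n\<^esub> = \<one>\<^bsub>transformation_monoid (prime_cyclic_words n)\<^esub>"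
    by (rule M_monoid_one(2)[OF assms])
  fix A assume "A \<in> carrier (L_monoid n)"
  then show "cyclic_action n A = periodic_orbit_rep n (L_to_End n A)"
    using periodic_orbit_rep_L_to_End[OF n1] by (simp add: L_monoid_def)
next
  fix T :: "nat transducer" and \<alpha> assume T: "L_transducer n T \<and> annotation n T \<alpha>"
  have n1: "n \<ge> 1" using assms by simp
  have M: "M_transducer n T" using T by (simp add: L_transducer_def)
  then have "is_transducer n T" "strongly_synchronizing n T" using M_transducerD[OF M] by simp_all
  then show "annotated_map n T \<alpha> \<in> shift_End n" using annotated_map_End T by blast
  show "L_to_End n (transducer_class n T) = shift_class n (annotated_map n T \<alpha>)"
    by (rule L_to_End_class[OF n1 M]) (use T in blast)
qed

end
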